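(* Let $(H_t,U_{s,t})$ be a spatial super product system with canonical unit $\{\Omega_t\}$, $\|\Omega_t\|=1$. Then the maps $\mathrm{Exp}_\Omega:\mathfrak{A}_\Omega(H)\to\mathfrak{U}_\Omega(H)$ and $\mathrm{Log}_\Omega:\mathfrak{U}_\Omega(H)\to\mathfrak{A}_\Omega(H)$ between the set $\mathfrak{A}_\Omega(H)$ of centred addits and the set $\mathfrak{U}_\Omega(H)$ of exponential units are mutually inverse.
   Context: A super product system is a family of separable Hilbert spaces $\{H_t\}_{t>0}$ with isometries $U_{s,t}:H_s\otimes H_t\to H_{s+t}$ ($s,t>0$) such that (i) $U_{s_1,s_2+s_3}(1_{H_{s_1}}\otimes U_{s_2,s_3})=U_{s_1+s_2,s_3}(U_{s_1,s_2}\otimes 1_{H_{s_3}})$, and (ii) the set $\{(t,\xi):t>0,\ \xi\in H_t\}$ carries a standard Borel structure for which the projection to $(0,\infty)$, the fibrewise linear operations and inner products, and the multiplication $(\xi,\eta)\mapsto U_{s,t}(\xi\otimes\eta)$ are Borel (as in Arveson's definition of product systems). A unit is a measurable section $u_t\in H_t$ with $U_{s,t}(u_s\otimes u_t)=u_{s+t}$. The system is spatial if it has a unit; fix one, $\Omega_t$ (the canonical unit), with $\|\Omega_t\|=1$, and put $H_0=\mathbb{C}\Omega_0$ with $\|\Omega_0\|=1$ ($\Omega_0$ acting as identity for the multiplication). An exponential unit is a unit with $\langle u_t,\Omega_t\rangle=1$ for all $t$. An addit is a measurable section $b_t\in H_t$ with $b_{s+t}=U_{s,t}(b_s\otimes\Omega_t)+U_{s,t}(\Omega_s\otimes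 b_t)$ for all $s,t$; it is centred if $\langle\Omega_t,b_t\rangle=0$ for all $t$. For a centred addit, $\|b_t\|^2=t\|b_1\|^2$. Itô integral. An adapted process is a family $x_t\in H_t$, $t\ge0$. It is simple if there are $0=s_0<s_1<\cdots$ partitioning $\mathbb{R}_+$, with $\inf_n(s_n-s_{n-1})>0$, and $x_i\in H_{s_i}$ such that $x_t=U_{s_i,t-s_i}(x_i\otimes\Omega_{t-s_i})$ for $t\in[s_i,s_{i+1})$. For a simple process, a centred addit $b$ and $t_0\le t_1$, after refining the partition so that $t_0=s_m$, $t_1=s_n$, set $$\int_{t_0}^{t_1}x_s\,db_s=\sum_{i=m}^{n-1}U_{s_i,\,s_{i+1}-s_i,\,t_1-s_{i+1}}(x_i\otimes b_{s_{i+1}-s_i}\otimes\Omega_{t_1-s_{i+1}}),$$ where $U_{r,s,t}:H_r\otimes H_s\otimes H_t\to H_{r+s+t}$ is the canonical isometry given by associativity. An Itô integrand is an adapted process $x$ such that $t\mapsto\|x_t\|^2$ is continuous and there is an analytic $F:\mathbb{R}_+\to\mathbb{C}$ with $F(0)=0$ and $\langle x_{s+t},U_{s,t}(x_s\otimes\Omega_t)\rangle=\|x_s\|^2F'(t)$ for all $s,t\ge0$. Such $x$ is on every $[t_0,t_1]$ an $L^2$-limit of simple processes $x^n$ (i.e. $\int_{t_0}^{t_1}\|x_s^n-x_s\|^2ds\to0$), and $\int_{t_0}^{t_1}x_s\,db_s:=\lim_n\int_{t_0}^{t_1}x^n_s\,db_s$ (norm limit), independent of the choice of $x^n$. Exponential.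 For a centred addit $b$, $\mathrm{Exp}_\Omega(b)=u$ is the unique continuous solution of $u_t=\Omega_t+\int_0^tu_s\,db_s$ ($t\ge0$); it is an exponential unit. Logarithm. For an exponential unit $u$, $t\ge0$, $n\in\mathbb{N}$ and $1\le i\le2^n$, let $y_t^{i,n}\in H_t$ be the image, under the canonical isometry $H_{t/2^n}^{\otimes 2^n}\to H_t$, of the elementary tensor with $u_{t/2^n}-\Omega_{t/2^n}$ in the $i$-th slot and $\Omega_{t/2^n}$ in all others. Then $\mathrm{Log}_\Omega(u)_t:=\lim_{n\to\infty}\sum_{i=1}^{2^n}y_t^{i,n}$ exists in norm, and $\mathrm{Log}_\Omega(u)$ is a centred addit. *)

theory Defs
  imports "HOL-Analysis.Analysis"
begin

section \<open>Complex Hilbert spaces\<close>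

text \<open>The inner product is linear in its first argument. The norm, the metric and the topology are
  those of the underlying real Hilbert space, so norm x = sqrt (Re (cinner x x)).\<close>

class complex_hilbert_space = real_inner + complete_space +
  fixes scaleC :: "complex \<Rightarrow> 'a \<Rightarrow> 'a" (infixr \<open>*\<^sub>C\<close> 75)
    and cinner :: "'a \<Rightarrow> 'a \<Rightarrow> complex"
  assumes scaleC_add_right: "a *\<^sub>C (x + y) = a *\<^sub>C x + a *\<^sub>C y"
    and scaleC_add_left: "(a + b) *\<^sub>C x = a *\<^sub>C x + b *\<^sub>C x"
    and scaleC_scaleC: "a *\<^sub>C b *\<^sub>C x = (a * b) *\<^sub>C x"
    and scaleR_scaleC: "r *\<^sub>R x = complex_of_real r *\<^sub>C x"
    and cinner_commute: "cinner x y = cnj (cinner y x)"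
    and cinner_add_left: "cinner (x + y) z = cinner x z + cinner y z"
    and cinner_scaleC_left: "cinner (a *\<^sub>C x) y = a * cinner x y"
    and inner_eq_Re_cinner: "inner x y = Re (cinner x y)"

lemma vector_space_scaleC:
  "vector_space (scaleC :: complex \<Rightarrow> 'a::complex_hilbert_space \<Rightarrow> 'a)"
proof
  show "1 *\<^sub>C x = x" for x :: 'a
    using scaleR_scaleC[of 1 x] by simp
qed (simp_all add: scaleC_add_right scaleC_add_left scaleC_scaleC)

definition hilbert_subspace :: "'a::complex_hilbert_space set \<Rightarrow> bool" where
  "hilbert_subspace V \<longleftrightarrow> module.subspace scaleC V \<and> closed V"

definition linear_isometry_on ::
  "'b::complex_hilbert_space set \<Rightarrow> 'a::complex_hilbert_space set \<Rightarrow> ('b \<Rightarrow> 'a) \<Rightarrow> bool" where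
  "linear_isometry_on V W f \<longleftrightarrow>
     f \<in> V \<rightarrow> W \<and>
     (\<forall>x\<in>V. \<forall>y\<in>V. f (x + y) = f x + f y) \<and>
     (\<forall>a. \<forall>x\<in>V. f (a *\<^sub>C x) = a *\<^sub>C f x) \<and>
     (\<forall>x\<in>V. norm (f x) = norm x)"

text \<open>The Hilbert space T with the map (x, y) \<mapsto> tns x y is a model of the Hilbert space tensor
  product of V and W; such a model is unique up to a unique unitary that respects elementary tensors.\<close>

definition is_hilbert_tensor_product ::
  "'a::complex_hilbert_space set \<Rightarrow> 'a set \<Rightarrow> 'b::complex_hilbert_space set
     \<Rightarrow> ('a \<Rightarrow> 'a \<Rightarrow> 'b) \<Rightarrow> bool" where
  "is_hilbert_tensor_product V W T tns \<longleftrightarrow>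
     hilbert_subspace T \<and>
     (\<forall>x\<in>V. \<forall>y\<in>W. tns x y \<in> T) \<and>
     (\<forall>x\<in>V. \<forall>x'\<in>V. \<forall>y\<in>W. tns (x + x') y = tns x y + tns x' y) \<and>
     (\<forall>x\<in>V. \<forall>y\<in>W. \<forall>y'\<in>W. tns x (y + y') = tns x y + tns x y') \<and>
     (\<forall>a. \<forall>x\<in>V. \<forall>y\<in>W. tns (a *\<^sub>C x) y = a *\<^sub>C tns x y \<and> tns x (a *\<^sub>C y) = a *\<^sub>C tns x y) \<and>
     (\<forall>x\<in>V. \<forall>x'\<in>V. \<forall>y\<in>W. \<forall>y'\<in>W. cinner (tns x y) (tns x' y') = cinner x x' * cinner y y') \<and>
     T = closure (module.span scaleC {tns x y | x y. x \<in> V \<and> y \<in> W})"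


section \<open>Super product systems\<close>

definition standard_borel :: "'c measure \<Rightarrow> bool" where
  "standard_borel M \<longleftrightarrow>
     (\<exists>X. completely_metrizable_space X \<and> second_countable X \<and>
          topspace X = space M \<and> sets M = sigma_sets (space M) {U. openin X U})"

text \<open>The fibres are closed subspaces of an ambient complex Hilbert space 'a. This is no restriction:
  any family of separable Hilbert spaces indexed by the reals is fibrewise unitarily equivalent to one
  inside the square summable functions on the reals times the naturals. The ambient space only
  provides the operations of the individual fibres; vectors of different fibres are never added or
  compared. In the same way 'b hosts the tensor products.

  fibre S t is H_t. The tensor product of H_s and H_t is tspace S s t with elementary tensors
  tensor S s t x y, and iso S s t is U_{s,t}. total S is a Borel structure on the set of pairs (t, x)
  with x in H_t; only its space and its sets matter, not its measure. The value fibre S 0 is not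
  constrained by super_product_system.\<close>

record ('a, 'b) sps =
  fibre :: "real \<Rightarrow> 'a set"
  tspace :: "real \<Rightarrow> real \<Rightarrow> 'b set"
  tensor :: "real \<Rightarrow> real \<Rightarrow> 'a \<Rightarrow> 'a \<Rightarrow> 'b"
  iso :: "real \<Rightarrow> real \<Rightarrow> 'b \<Rightarrow> 'a"
  total :: "(real \<times> 'a) measure"

definition fibre_product :: "('a, 'b) sps \<Rightarrow> ((real \<times> 'a) \<times> (real \<times> 'a)) measure" where
  "fibre_product S = restrict_space (total S \<Otimes>\<^sub>M total S) {(p, q). fst p = fst q}"

text \<open>The associativity axiom equates two bounded operators on a threefold tensor product; it is
  stated on elementary tensors, whose span is dense.\<close>

definition super_product_system ::
  "('a::complex_hilbert_space, 'b::complex_hilbert_space) sps \<Rightarrow> bool" where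
  "super_product_system S \<longleftrightarrow>
     (\<forall>t>0. hilbert_subspace (fibre S t) \<and> separable_space (top_of_set (fibre S t))) \<and>
     (\<forall>s>0. \<forall>t>0. is_hilbert_tensor_product (fibre S s) (fibre S t) (tspace S s t) (tensor S s t) \<and>
        linear_isometry_on (tspace S s t) (fibre S (s + t)) (iso S s t)) \<and>
     (\<forall>r>0. \<forall>s>0. \<forall>t>0. \<forall>x\<in>fibre S r. \<forall>y\<in>fibre S s. \<forall>z\<in>fibre S t.
        iso S r (s + t) (tensor S r (s + t) x (iso S s t (tensor S s t y z))) =
        iso S (r + s) t (tensor S (r + s) t (iso S r s (tensor S r s x y)) z)) \<and>
     space (total S) = {(t, x). 0 < t \<and> x \<in> fibre S t} \<and>
     standard_borel (total S) \<and>
     fst \<in> total S \<rightarrow>\<^sub>M borel \<and>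
     (\<lambda>(p, q). (fst p, snd p + snd q)) \<in> fibre_product S \<rightarrow>\<^sub>M total S \<and>
     (\<lambda>(a, p). (fst p, a *\<^sub>C snd p)) \<in> borel \<Otimes>\<^sub>M total S \<rightarrow>\<^sub>M total S \<and>
     (\<lambda>(p, q). cinner (snd p) (snd q)) \<in> fibre_product S \<rightarrow>\<^sub>M borel \<and>
     (\<lambda>(p, q). (fst p + fst q, iso S (fst p) (fst q) (tensor S (fst p) (fst q) (snd p) (snd q))))
        \<in> total S \<Otimes>\<^sub>M total S \<rightarrow>\<^sub>M total S"

text \<open>The multiplication (x, y) \<mapsto> U_{s,t} (x \<otimes> y) for s, t \<ge> 0, where H_0 is spanned by the unit vector
  Om 0, which acts as the identity: if x = c Om_0 then cinner x (Om 0) = c.\<close>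

definition mult :: "('a::complex_hilbert_space, 'b::complex_hilbert_space) sps \<Rightarrow> (real \<Rightarrow> 'a)
    \<Rightarrow> real \<Rightarrow> real \<Rightarrow> 'a \<Rightarrow> 'a \<Rightarrow> 'a" where
  "mult S Om s t x y =
     (if s = 0 then cinner x (Om 0) *\<^sub>C y
      else if t = 0 then cinner y (Om 0) *\<^sub>C x
      else iso S s t (tensor S s t x y))"

text \<open>Sections are families indexed by t \<ge> 0, extensional outside. Including t = 0 in the defining
  equations of units and addits adds no condition for t > 0: it forces the value Om 0 for nonzero
  units and the value 0 for addits.\<close>

definition measurable_sections ::
  "('a::complex_hilbert_space, 'b::complex_hilbert_space) sps \<Rightarrow> (real \<Rightarrow> 'a) set" where
  "measurable_sections S = {x \<in> \<Pi>\<^sub>E t\<in>{0..}. fibre S t.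
     (\<lambda>t. (t, x t)) \<in> restrict_space borel {0<..} \<rightarrow>\<^sub>M total S}"

definition units :: "('a::complex_hilbert_space, 'b::complex_hilbert_space) sps \<Rightarrow> (real \<Rightarrow> 'a)
    \<Rightarrow> (real \<Rightarrow> 'a) set" where
  "units S Om = {u \<in> measurable_sections S.
     \<forall>s\<ge>0. \<forall>t\<ge>0. mult S Om s t (u s) (u t) = u (s + t)}"

definition spatial_super_product_system ::
  "('a::complex_hilbert_space, 'b::complex_hilbert_space) sps \<Rightarrow> (real \<Rightarrow> 'a) \<Rightarrow> bool" where
  "spatial_super_product_system S Om \<longleftrightarrow>
     super_product_system S \<and>
     fibre S 0 = range (\<lambda>c. c *\<^sub>C Om 0) \<and>
     Om \<in> units S Om \<and>
     (\<forall>t\<ge>0. norm (Om t) = 1)"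

definition exponential_units ::
  "('a::complex_hilbert_space, 'b::complex_hilbert_space) sps \<Rightarrow> (real \<Rightarrow> 'a)
     \<Rightarrow> (real \<Rightarrow> 'a) set" where
  "exponential_units S Om = {u \<in> units S Om. \<forall>t\<ge>0. cinner (u t) (Om t) = 1}"

definition addits :: "('a::complex_hilbert_space, 'b::complex_hilbert_space) sps \<Rightarrow> (real \<Rightarrow> 'a)
    \<Rightarrow> (real \<Rightarrow> 'a) set" where
  "addits S Om = {b \<in> measurable_sections S.
     \<forall>s\<ge>0. \<forall>t\<ge>0. b (s + t) = mult S Om s t (b s) (Om t) + mult S Om s t (Om s) (b t)}"

definition centred_addits :: "('a::complex_hilbert_space, 'b::complex_hilbert_space) sps
    \<Rightarrow> (real \<Rightarrow> 'a) \<Rightarrow> (real \<Rightarrow> 'a) set" where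
  "centred_addits S Om = {b \<in> addits S Om. \<forall>t\<ge>0. cinner (Om t) (b t) = 0}"


section \<open>The Ito integral\<close>

definition adapted_processes ::
  "('a::complex_hilbert_space, 'b::complex_hilbert_space) sps \<Rightarrow> (real \<Rightarrow> 'a) set" where
  "adapted_processes S = (\<Pi>\<^sub>E t\<in>{0..}. fibre S t)"

definition simple_representation ::
  "('a::complex_hilbert_space, 'b::complex_hilbert_space) sps \<Rightarrow> (real \<Rightarrow> 'a)
     \<Rightarrow> (nat \<Rightarrow> real) \<Rightarrow> (nat \<Rightarrow> 'a) \<Rightarrow> (real \<Rightarrow> 'a) \<Rightarrow> bool" where
  "simple_representation S Om \<sigma> \<xi> x \<longleftrightarrow>
     \<sigma> 0 = 0 \<and> strict_mono \<sigma> \<and> 0 < (INF n. \<sigma> (Suc n) - \<sigma> n) \<and>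
     (\<forall>i. \<xi> i \<in> fibre S (\<sigma> i)) \<and>
     (\<forall>i. \<forall>t\<in>{\<sigma> i..<\<sigma> (Suc i)}. x t = mult S Om (\<sigma> i) (t - \<sigma> i) (\<xi> i) (Om (t - \<sigma> i)))"

definition simple_process :: "('a::complex_hilbert_space, 'b::complex_hilbert_space) sps
    \<Rightarrow> (real \<Rightarrow> 'a) \<Rightarrow> (real \<Rightarrow> 'a) \<Rightarrow> bool" where
  "simple_process S Om x \<longleftrightarrow>
     x \<in> adapted_processes S \<and> (\<exists>\<sigma> \<xi>. simple_representation S Om \<sigma> \<xi> x)"

text \<open>The sum does not depend on the representation of the simple process, as long as both end points
  occur in the partition.\<close>

definition simple_integral ::
  "('a::complex_hilbert_space, 'b::complex_hilbert_space) sps \<Rightarrow> (real \<Rightarrow> 'a)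
     \<Rightarrow> (real \<Rightarrow> 'a) \<Rightarrow> (real \<Rightarrow> 'a) \<Rightarrow> real \<Rightarrow> real \<Rightarrow> 'a" where
  "simple_integral S Om x b t0 t1 = (THE y. \<exists>\<sigma> \<xi> m n.
     simple_representation S Om \<sigma> \<xi> x \<and> m \<le> n \<and> \<sigma> m = t0 \<and> \<sigma> n = t1 \<and>
     y = (\<Sum>i\<in>{m..<n}.
            mult S Om (\<sigma> (Suc i)) (t1 - \<sigma> (Suc i))
              (mult S Om (\<sigma> i) (\<sigma> (Suc i) - \<sigma> i) (\<xi> i) (b (\<sigma> (Suc i) - \<sigma> i)))
              (Om (t1 - \<sigma> (Suc i)))))"

text \<open>F is analytic on the closed half-line, as a complex valued function of a real variable, iff it is
  the restriction of a function that is holomorphic on a complex neighbourhood of the half-line.\<close>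

definition analytic_on_nonneg :: "(real \<Rightarrow> complex) \<Rightarrow> bool" where
  "analytic_on_nonneg F \<longleftrightarrow>
     (\<exists>G. G analytic_on (complex_of_real ` {0..}) \<and> (\<forall>t\<ge>0. F t = G (complex_of_real t)))"

definition ito_integrand :: "('a::complex_hilbert_space, 'b::complex_hilbert_space) sps
    \<Rightarrow> (real \<Rightarrow> 'a) \<Rightarrow> (real \<Rightarrow> 'a) \<Rightarrow> bool" where
  "ito_integrand S Om x \<longleftrightarrow>
     x \<in> adapted_processes S \<and>
     continuous_on {0..} (\<lambda>t. (norm (x t))\<^sup>2) \<and>
     (\<exists>F. analytic_on_nonneg F \<and> F 0 = 0 \<and>
        (\<forall>s\<ge>0. \<forall>t\<ge>0. cinner (x (s + t)) (mult S Om s t (x s) (Om t)) =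
           of_real ((norm (x s))\<^sup>2) * vector_derivative F (at t within {0..})))"

definition L2_approximates :: "(nat \<Rightarrow> real \<Rightarrow> 'a::complex_hilbert_space) \<Rightarrow> (real \<Rightarrow> 'a)
    \<Rightarrow> real \<Rightarrow> real \<Rightarrow> bool" where
  "L2_approximates X x t0 t1 \<longleftrightarrow>
     (\<forall>n. (\<lambda>s. (norm (X n s - x s))\<^sup>2) integrable_on {t0..t1}) \<and>
     (\<lambda>n. integral {t0..t1} (\<lambda>s. (norm (X n s - x s))\<^sup>2)) \<longlonglongrightarrow> 0"

definition ito_integral ::
  "('a::complex_hilbert_space, 'b::complex_hilbert_space) sps \<Rightarrow> (real \<Rightarrow> 'a)
     \<Rightarrow> (real \<Rightarrow> 'a) \<Rightarrow> (real \<Rightarrow> 'a) \<Rightarrow> real \<Rightarrow> real \<Rightarrow> 'a" where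
  "ito_integral S Om x b t0 t1 = (THE y. \<exists>X.
     (\<forall>n. simple_process S Om (X n)) \<and> L2_approximates X x t0 t1 \<and>
     (\<lambda>n. simple_integral S Om (X n) b t0 t1) \<longlonglongrightarrow> y)"


section \<open>Exponential and logarithm\<close>

text \<open>Continuity of a solution u refers to t \<mapsto> norm (u t) ^ 2, since the values of u lie in different
  spaces; it is part of being an Ito integrand, which the integral equation presupposes.\<close>

definition Exp_addit ::
  "('a::complex_hilbert_space, 'b::complex_hilbert_space) sps \<Rightarrow> (real \<Rightarrow> 'a)
     \<Rightarrow> (real \<Rightarrow> 'a) \<Rightarrow> (real \<Rightarrow> 'a)" where
  "Exp_addit S Om b = (THE u. ito_integrand S Om u \<and>
     (\<forall>t\<ge>0. u t = Om t + ito_integral S Om u b 0 t))"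

text \<open>iterated_mult S Om s x k is the image of x 1 \<otimes> \<dots> \<otimes> x k in H_{k s}, for vectors x i in H_s.\<close>

primrec iterated_mult ::
  "('a::complex_hilbert_space, 'b::complex_hilbert_space) sps \<Rightarrow> (real \<Rightarrow> 'a)
     \<Rightarrow> real \<Rightarrow> (nat \<Rightarrow> 'a) \<Rightarrow> nat \<Rightarrow> 'a" where
  "iterated_mult S Om s x 0 = Om 0"
| "iterated_mult S Om s x (Suc k) = mult S Om (real k * s) s (iterated_mult S Om s x k) (x (Suc k))"

definition log_term ::
  "('a::complex_hilbert_space, 'b::complex_hilbert_space) sps \<Rightarrow> (real \<Rightarrow> 'a)
     \<Rightarrow> (real \<Rightarrow> 'a) \<Rightarrow> real \<Rightarrow> nat \<Rightarrow> nat \<Rightarrow> 'a" where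
  "log_term S Om u t n i = iterated_mult S Om (t / 2 ^ n)
     (\<lambda>j. if j = i then u (t / 2 ^ n) - Om (t / 2 ^ n) else Om (t / 2 ^ n)) (2 ^ n)"

definition Log_unit ::
  "('a::complex_hilbert_space, 'b::complex_hilbert_space) sps \<Rightarrow> (real \<Rightarrow> 'a)
     \<Rightarrow> (real \<Rightarrow> 'a) \<Rightarrow> (real \<Rightarrow> 'a)" where
  "Log_unit S Om u = (\<lambda>t\<in>{0..}. lim (\<lambda>n. \<Sum>i\<in>{1..2 ^ n}. log_term S Om u t n i))"

end

theory Submission
  imports Defs "HOL-Complex_Analysis.Cauchy_Integral_Formula"
begin

text \<open>
  Call an exponential unit \<open>u\<close> and a centred addit \<open>b\<close> associated if
  \<open>\<parallel>u t - Om t - b t\<parallel>\<^sup>2 = O(t\<^sup>2)\<close> as \<open>t \<rightarrow> 0\<close>. Everything reduces to this relation.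

  Given \<open>b\<close>, the products of the vectors \<open>Om + b\<close> over partitions of \<open>[0, t]\<close> change by an orthogonal
  vector under refinement, and their norms are bounded by \<open>exp (c t / 2)\<close>, where \<open>c = \<parallel>b 1\<parallel>\<^sup>2\<close>; so they
  converge along all partitions, and the limit is a unit associated with \<open>b\<close>. In the same way the sums
  of the translates of \<open>u - Om\<close> over partitions converge to an addit associated with \<open>u\<close>. That these
  limits are measurable sections follows from Lusin's separation theorem, since their graphs are Borel
  sets.

  If \<open>u\<close> and \<open>b\<close> are associated, then the errors of \<open>\<Sum> u \<otimes> b \<otimes> Om\<close> against \<open>u t - Om t\<close>, and of the
  logarithmic sums against \<open>b t\<close>, are orthogonal sums of \<open>n\<close> terms of squared norm \<open>O(1/n\<^sup>2)\<close>. So \<open>u\<close>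
  solves the integral equation of \<open>b\<close>, whose solution is unique by the Ito isometry and a Gronwall
  argument, and \<open>Log u = b\<close>.
\<close>

text \<open>A partition into n pieces produces n errors, each of norm O(1/n); added by the triangle
  inequality they would not vanish. Centredness makes the errors of different pieces orthogonal, so
  that squared norms add up to O(1/n). This is the origin of the exponent in the relation:
  \<open>norm (b t)\<close> is of order sqrt t, and an error of order t is already negligible.

  Products over partitions are preferred to Picard iteration because they are multiplicative under
  concatenation, and the limit inherits this; a fixed point would still have to be shown
  multiplicative.

  The total space carries an abstract Borel structure, tied to the norms only through the fibrewise
  operations. A pointwise limit of measurable sections is therefore not measurable by a metric
  argument; what is Borel are fibrewise distances, hence the graph of the limit.

  Uniqueness of the partner needs no argument of its own: \<open>Exp_addit\<close> and
  \<open>Log_unit\<close> are evaluated on an arbitrary associated pair, so existence of a partner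
  on either side gives both inverse laws.\<close>

section \<open>Separation of analytic sets\<close>

text \<open>The family \<open>\<O>\<close> need not be a topology: adding the preimages of intervals under a Borel
  function \<open>f\<close> makes \<open>f\<close> continuous along the branches.\<close>

definition souslin_scheme :: "'c set set \<Rightarrow> 'c set \<Rightarrow> (nat list \<Rightarrow> 'c set) \<Rightarrow> bool" where
  "souslin_scheme \<O> E F \<longleftrightarrow>
     F [] = E \<and> (\<forall>s. (\<Union>k. F (s @ [k])) = F s) \<and>
     (\<forall>\<alpha>. (\<forall>n. F (map \<alpha> [0..<n]) \<noteq> {}) \<longrightarrow>
        (\<exists>x\<in>E. \<forall>U\<in>\<O>. x \<in> U \<longrightarrow> (\<exists>n. F (map \<alpha> [0..<n]) \<subseteq> U)))"

definition has_scheme :: "'c set set \<Rightarrow> 'c set \<Rightarrow> bool" where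
  "has_scheme \<O> E \<longleftrightarrow> (\<exists>F. souslin_scheme \<O> E F)"

lemma souslin_schemeD:
  assumes "souslin_scheme \<O> E F"
  shows "F [] = E" "(\<Union>k. F (s @ [k])) = F s"
    "(\<And>n. F (map \<alpha> [0..<n]) \<noteq> {}) \<Longrightarrow>
        \<exists>x\<in>E. \<forall>U\<in>\<O>. x \<in> U \<longrightarrow> (\<exists>n. F (map \<alpha> [0..<n]) \<subseteq> U)"
  using assms unfolding souslin_scheme_def by blast+

lemma scheme_antimono:
  fixes F :: "nat list \<Rightarrow> 'c set"
  assumes "\<And>s. (\<Union>k. F (s @ [k])) = F s" "m \<le> n"
  shows "F (map \<alpha> [0..<n]) \<subseteq> F (map \<alpha> [0..<m])"
  using assms(2)
proof (induction n rule: dec_induct)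
  case (step n)
  have "F (map \<alpha> [0..<Suc n]) \<subseteq> F (map \<alpha> [0..<n])"
    using assms(1)[of "map \<alpha> [0..<n]"] by auto
  with step.IH show ?case by blast
qed simp

lemma has_scheme_mono:
  assumes "has_scheme \<O> E" "\<O>' \<subseteq> \<O>"
  shows "has_scheme \<O>' E"
proof -
  obtain F where F: "souslin_scheme \<O> E F" using assms(1) unfolding has_scheme_def by blast
  have "souslin_scheme \<O>' E F"
    unfolding souslin_scheme_def
    using souslin_schemeD[OF F] assms(2) by (meson subsetD)
  then show ?thesis unfolding has_scheme_def by blast
qed

text \<open>The root of the scheme is already contained in \<open>V\<close>, so the empty prefix of
  any branch serves for the new set. Together with the next lemma this allows a Borel set to be
  treated as open, on itself and on its complement separately.\<close>

lemma has_scheme_insert_self: "has_scheme \<O> V \<Longrightarrow> has_scheme (insert V \<O>) V"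
proof -
  assume "has_scheme \<O> V"
  then obtain F where F: "souslin_scheme \<O> V F" unfolding has_scheme_def by blast
  have "F (map \<alpha> [0..<0]) \<subseteq> V" for \<alpha>
    using souslin_schemeD(1)[OF F] by simp
  then have "souslin_scheme (insert V \<O>) V F"
    using F unfolding souslin_scheme_def by (metis insert_iff)
  then show "has_scheme (insert V \<O>) V" unfolding has_scheme_def by blast
qed

text \<open>A limit point lies in \<open>W\<close> and hence never in \<open>V\<close>, so the
  condition for the new set is vacuous.\<close>

lemma has_scheme_insert_disjoint:
  assumes "has_scheme \<O> W" "V \<inter> W = {}"
  shows "has_scheme (insert V \<O>) W"
proof -
  obtain F where F: "souslin_scheme \<O> W F" using assms(1) unfolding has_scheme_def by blast
  have "souslin_scheme (insert V \<O>) W F"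
    unfolding souslin_scheme_def
    using souslin_schemeD[OF F] assms(2) by (metis disjoint_iff insertE)
  then show ?thesis unfolding has_scheme_def by blast
qed

text \<open>The limit of a branch cannot lie in the complement of \<open>C\<close>: some set of the
  branch would then be contained in that complement and miss \<open>C\<close>.\<close>

lemma has_scheme_closed:
  assumes "has_scheme \<O> X" "C \<subseteq> X" "X - C \<in> \<O>"
  shows "has_scheme \<O> C"
proof -
  obtain F where "souslin_scheme \<O> X F"
    using assms(1) unfolding has_scheme_def by blast
  note F = souslin_schemeD[OF this]
  show ?thesis
    unfolding has_scheme_def souslin_scheme_def
  proof (intro exI[of _ "\<lambda>s. F s \<inter> C"] conjI allI impI)
    show "F [] \<inter> C = C" using F(1) assms(2) by auto
    show "(\<Union>k. F (s @ [k]) \<inter> C) = F s \<inter> C" for s using F(2)[of s] by blast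
    fix \<alpha> assume ne: "\<forall>n. F (map \<alpha> [0..<n]) \<inter> C \<noteq> {}"
    then obtain x where x: "x \<in> X" "\<And>U. U \<in> \<O> \<Longrightarrow> x \<in> U \<Longrightarrow> \<exists>n. F (map \<alpha> [0..<n]) \<subseteq> U"
      using F(3)[of \<alpha>] by blast
    have "x \<in> C"
      using x(2)[OF assms(3)] x(1) ne by blast
    then show "\<exists>x\<in>C. \<forall>U\<in>\<O>. x \<in> U \<longrightarrow> (\<exists>n. F (map \<alpha> [0..<n]) \<inter> C \<subseteq> U)"
      using x(2) by blast
  qed
qed

lemma map_upt_Cons: "map \<alpha> [0..<Suc n] = \<alpha> 0 # map (\<lambda>i. \<alpha> (Suc i)) [0..<n]"
  by (simp add: map_upt_Suc del: upt_Suc)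

text \<open>The first entry of a branch selects the index \<open>k\<close>; the remaining entries
  follow the scheme of \<open>E k\<close>.\<close>

lemma has_scheme_UN:
  assumes "\<And>k::nat. has_scheme \<O> (E k)"
  shows "has_scheme \<O> (\<Union>k. E k)"
proof -
  have "\<forall>k. \<exists>F. souslin_scheme (\<O>) (E k) F"
    using assms unfolding has_scheme_def by blast
  then obtain F where "\<And>k. souslin_scheme (\<O>) (E k) (F k)" by metis
  note F = souslin_schemeD[OF this]
  define G where "G = case_list (\<Union>k. E k) F"
  have G: "G [] = (\<Union>k. E k)" "G (k # s) = F k s" for k s
    by (auto simp: G_def)
  show ?thesis
    unfolding has_scheme_def souslin_scheme_def
  proof (intro exI[of _ G] conjI allI impI)
    show "(\<Union>k. G (s @ [k])) = G s" for s
      by (cases s) (auto simp: G F(1) F(2))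
    fix \<alpha> assume ne: "\<forall>n. G (map \<alpha> [0..<n]) \<noteq> {}"
    have Gn: "G (map \<alpha> [0..<Suc n]) = F (\<alpha> 0) (map (\<lambda>i. \<alpha> (Suc i)) [0..<n])" for n
      by (simp only: map_upt_Cons G)
    have "F (\<alpha> 0) (map (\<lambda>i. \<alpha> (Suc i)) [0..<n]) \<noteq> {}" for n
      using ne Gn by metis
    from F(3)[OF this] obtain x where "x \<in> E (\<alpha> 0)"
      "\<And>U. U \<in> \<O> \<Longrightarrow> x \<in> U \<Longrightarrow> (\<exists>n. F (\<alpha> 0) (map (\<lambda>i. \<alpha> (Suc i)) [0..<n]) \<subseteq> U)"
      by blast
    then show "\<exists>x\<in>\<Union>k. E k. \<forall>U\<in>\<O>. x \<in> U \<longrightarrow> (\<exists>n. G (map \<alpha> [0..<n]) \<subseteq> U)"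
      using Gn by (metis UN_I UNIV_I)
  qed (simp add: G)
qed

text \<open>The entry \<open>s ! j\<close> of a branch codes the next step of each of the schemes \<open>0, \<dots>, j\<close>; the
  \<open>k\<close>-th scheme therefore starts at position \<open>k\<close>.\<close>

lemma has_scheme_INT:
  assumes E: "\<And>k::nat. has_scheme (\<O> k) (E k)"
    and sep: "\<And>x y. x \<noteq> y \<Longrightarrow> x \<in> (\<Union>k. E k) \<Longrightarrow> y \<in> (\<Union>k. E k) \<Longrightarrow>
        \<exists>U V. U \<in> (\<Inter>k. \<O> k) \<and> V \<in> (\<Inter>k. \<O> k) \<and> x \<in> U \<and> y \<in> V \<and> U \<inter> V = {}"
  shows "has_scheme (\<Union>k. \<O> k) (\<Inter>k. E k)"
proof -
  have "\<forall>k. \<exists>F. souslin_scheme (\<O> k) (E k) F"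
    using E unfolding has_scheme_def by blast
  then obtain F where "\<And>k. souslin_scheme (\<O> k) (E k) (F k)" by metis
  note F = souslin_schemeD[OF this]
  define dec :: "nat \<Rightarrow> nat \<Rightarrow> nat" where "dec k c = (from_nat c :: nat list) ! k" for k c
  define G where "G s = (\<Inter>k. F k (map (dec k) (drop k s)))" for s
  have G_step: "(\<Union>c. G (s @ [c])) = G s" for s
  proof
    show "G s \<subseteq> (\<Union>c. G (s @ [c]))"
    proof
      fix x assume x: "x \<in> G s"
      have "\<exists>j. x \<in> F k (map (dec k) (drop k s) @ [j])" for k
        using x F(2)[of k "map (dec k) (drop k s)"] unfolding G_def by blast
      then obtain j where j: "\<And>k. x \<in> F k (map (dec k) (drop k s) @ [j k])" by metis
      \<comment> \<open>One entry must code the next steps of all schemes that have started, namely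
        those with \<open>k \<le> length s\<close>. These are finitely many, so the code of a list
        suffices.\<close>
      define c where "c = to_nat (map j [0..<Suc (length s)])"
      have "x \<in> F k (map (dec k) (drop k (s @ [c])))" for k
      proof (cases "k \<le> length s")
        case True
        then have "dec k c = j k" by (simp add: dec_def c_def nth_map[of k "[0..<Suc (length s)]"] del: upt_Suc)
        then show ?thesis using True j[of k] by simp
      next
        case False
        moreover have "x \<in> F k (map (dec k) (drop k s))" using x unfolding G_def by blast
        ultimately show ?thesis by simp
      qed
      then show "x \<in> (\<Union>c. G (s @ [c]))" unfolding G_def by blast
    qed
    show "(\<Union>c. G (s @ [c])) \<subseteq> G s"
    proof
      fix x assume "x \<in> (\<Union>c. G (s @ [c]))"
      then obtain c where x: "\<And>k. x \<in> F k (map (dec k) (drop k (s @ [c])))"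
        unfolding G_def by auto
      have "x \<in> F k (map (dec k) (drop k s))" for k
      proof (cases "k \<le> length s")
        case True
        then show ?thesis using x[of k] F(2)[of k "map (dec k) (drop k s)"] by auto
      next
        case False
        then show ?thesis using x[of k] by simp
      qed
      then show "x \<in> G s" unfolding G_def by blast
    qed
  qed
  show ?thesis
    unfolding has_scheme_def souslin_scheme_def
  proof (intro exI[of _ G] conjI allI impI)
    show "G [] = (\<Inter>k. E k)" by (simp add: G_def F)
    show "(\<Union>k. G (s @ [k])) = G s" for s by (rule G_step)
    fix \<alpha> assume ne: "\<forall>n. G (map \<alpha> [0..<n]) \<noteq> {}"
    \<comment> \<open>The branch of scheme \<open>k\<close> decoded from \<open>\<alpha>\<close>;
      its first \<open>n\<close> entries are known once \<open>k + n\<close> entries of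
      \<open>\<alpha>\<close> are.\<close>
    define \<beta> where "\<beta> k i = dec k (\<alpha> (k + i))" for k i
    have eq: "map (dec k) (drop k (map \<alpha> [0..<k + n])) = map (\<beta> k) [0..<n]" for k n
      by (rule nth_equalityI) (auto simp: \<beta>_def)
    have GF: "G (map \<alpha> [0..<k + n]) \<subseteq> F k (map (\<beta> k) [0..<n])" for k n
      unfolding eq[symmetric] G_def by blast
    have "\<exists>x\<in>E k. \<forall>U\<in>\<O> k. x \<in> U \<longrightarrow> (\<exists>n. F k (map (\<beta> k) [0..<n]) \<subseteq> U)" for k
      using F(3) GF ne by (metis subset_empty)
    then obtain x where x: "\<And>k. x k \<in> E k"
      "\<And>k U. U \<in> \<O> k \<Longrightarrow> x k \<in> U \<Longrightarrow> (\<exists>n. F k (map (\<beta> k) [0..<n]) \<subseteq> U)" by metis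
    have xG: "\<exists>n. G (map \<alpha> [0..<n]) \<subseteq> U" if "U \<in> \<O> k" "x k \<in> U" for k U
      using x(2)[OF that] GF by blast
    \<comment> \<open>Distinct limits would have disjoint neighbourhoods belonging to every
      \<open>\<O> k\<close>. Each contains some \<open>G\<close> of the common branch, and the
      deeper of the two would be empty.\<close>
    have x0: "x k = x 0" for k
    proof (rule ccontr)
      assume "x k \<noteq> x 0"
      moreover have "x k \<in> (\<Union>k. E k)" "x 0 \<in> (\<Union>k. E k)" using x(1) by blast+
      ultimately obtain U V where "U \<in> (\<Inter>k. \<O> k)" "V \<in> (\<Inter>k. \<O> k)"
        and UV': "x k \<in> U" "x 0 \<in> V" "U \<inter> V = {}"
        using sep by meson
      then have UV: "U \<in> \<O> k" "V \<in> \<O> 0" "x k \<in> U" "x 0 \<in> V" "U \<inter> V = {}"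
        by (simp_all only: INT_iff UNIV_I)
      obtain m where m: "G (map \<alpha> [0..<m]) \<subseteq> U"
        using xG[OF UV(1,3)] by blast
      obtain n where n: "G (map \<alpha> [0..<n]) \<subseteq> V"
        using xG[OF UV(2,4)] by blast
      have "G (map \<alpha> [0..<max m n]) \<subseteq> U \<inter> V"
        using scheme_antimono[of G m "max m n" \<alpha>, OF G_step]
          scheme_antimono[of G n "max m n" \<alpha>, OF G_step] m n
        by (meson Int_greatest max.cobounded1 max.cobounded2 subset_trans)
      then show False using UV(5) ne by blast
    qed
    show "\<exists>x\<in>\<Inter>k. E k. \<forall>U\<in>\<Union>k. \<O> k. x \<in> U \<longrightarrow> (\<exists>n. G (map \<alpha> [0..<n]) \<subseteq> U)"
    proof (intro bexI[of _ "x 0"] ballI impI)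
      show "x 0 \<in> (\<Inter>k. E k)" using x(1) x0 by (metis INT_I)
      fix U assume "U \<in> (\<Union>k. \<O> k)" "x 0 \<in> U"
      then show "\<exists>n. G (map \<alpha> [0..<n]) \<subseteq> U" using xG x0 by (metis UN_E)
    qed
  qed
qed

text \<open>The sets are intersections of balls of radius (1/2)^i around points of a countable dense
  set. Density makes the successors of a node cover it; completeness gives a limit to every branch
  of nonempty sets.\<close>

lemma has_scheme_topspace:
  assumes "completely_metrizable_space X" "second_countable X"
  shows "has_scheme {U. openin X U} (topspace X)"
proof -
  obtain M d where "Metric_space M d" and cpl: "Metric_space.mcomplete M d"
    and X: "X = Metric_space.mtopology M d"
    using assms(1) unfolding completely_metrizable_space_def by blast
  interpret Metric_space M d by fact
  obtain C where C: "countable C" "C \<subseteq> M" "X closure_of C = M"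
    using second_countable_imp_separable_space[OF assms(2)] unfolding separable_space_def X
    by auto
  define F where "F s = {x\<in>M. \<forall>i<length s. from_nat_into C (s ! i) \<in> M \<and> d x (from_nat_into C (s ! i)) < (1/2) ^ i}"
    for s :: "nat list"
  show ?thesis
    unfolding has_scheme_def souslin_scheme_def
  proof (intro exI[of _ F] conjI allI impI)
    show "F [] = topspace X" by (auto simp: F_def X)
    show "(\<Union>k. F (s @ [k])) = F s" for s
    proof
      show "(\<Union>k. F (s @ [k])) \<subseteq> F s"
        by (auto simp: F_def nth_append less_Suc_eq)
      show "F s \<subseteq> (\<Union>k. F (s @ [k]))"
      proof
        fix x assume x: "x \<in> F s"
        then have "x \<in> M" by (auto simp: F_def)
        then have "x \<in> X closure_of C" using C by simp
        then obtain c where c: "c \<in> C" "d x c < (1/2) ^ length s"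
          unfolding X metric_closure_of by (auto dest!: spec[of _ "(1/2) ^ length s"])
        obtain k where "from_nat_into C k = c"
          using from_nat_into_surj[OF C(1) c(1)] by blast
        then show "x \<in> (\<Union>k. F (s @ [k]))"
          using x c C(2) by (auto simp: F_def nth_append less_Suc_eq intro!: exI[of _ k])
      qed
    qed
    fix \<alpha> assume "\<forall>n. F (map \<alpha> [0..<n]) \<noteq> {}"
    then have "\<forall>n. \<exists>z. z \<in> F (map \<alpha> [0..<n])" by blast
    then obtain y where y: "\<And>n. y n \<in> F (map \<alpha> [0..<n])" by (rule choice[THEN exE]) blast
    then have yM: "\<And>n. y n \<in> M" by (auto simp: F_def)
    \<comment> \<open>Both points lie in the ball number \<open>i\<close> of the branch, hence the
      factor 2.\<close>
    have close: "d z w < 2 * (1/2) ^ i"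
      if "z \<in> F (map \<alpha> [0..<n])" "w \<in> F (map \<alpha> [0..<m])" "i < n" "i < m" for i n m z w
    proof -
      define c where "c = from_nat_into C (\<alpha> i)"
      have "c \<in> M" "d z c < (1/2) ^ i" "d w c < (1/2) ^ i" "z \<in> M" "w \<in> M"
        using that by (auto simp: F_def c_def)
      then show ?thesis using triangle[of z c w] commute[of c w] by auto
    qed
    have small: "\<exists>i. 2 * (1/2) ^ i < e" if "e > 0" for e :: real
    proof -
      have "\<exists>i. (1/2) ^ i < e / 2" using that by (intro real_arch_pow_inv) auto
      then obtain i where "(1/2) ^ i < e / 2" by blast
      then show ?thesis by (intro exI[of _ i]) auto
    qed
    have "MCauchy y"
      unfolding MCauchy_def
    proof (intro conjI allI impI)
      show "range y \<subseteq> M" using yM by auto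
      fix e :: real assume "e > 0"
      then obtain i where "2 * (1/2) ^ i < e" using small by blast
      then show "\<exists>N. \<forall>n n'. N \<le> n \<longrightarrow> N \<le> n' \<longrightarrow> d (y n) (y n') < e"
        using close[OF y y] by (intro exI[of _ "Suc i"]) (meson Suc_le_lessD less_trans)
    qed
    then obtain x where x: "limitin mtopology y x sequentially"
      using cpl unfolding mcomplete_def by blast
    have xM: "x \<in> M" using x limitin_mspace by blast
    show "\<exists>x\<in>topspace X. \<forall>U\<in>{U. openin X U}. x \<in> U \<longrightarrow> (\<exists>n. F (map \<alpha> [0..<n]) \<subseteq> U)"
    proof (intro bexI[of _ x] ballI impI)
      fix U assume "U \<in> {U. openin X U}" "x \<in> U"
      then obtain e where e: "e > 0" "mball x e \<subseteq> U"
        unfolding X openin_mtopology by auto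
      obtain i where i: "2 * (1/2) ^ i < e / 2" using small[of "e/2"] e(1) half_gt_zero by blast
      obtain N where N: "\<And>n. n \<ge> N \<Longrightarrow> d (y n) x < e / 2"
        using x e unfolding limit_metric_sequentially by (metis half_gt_zero)
      have "F (map \<alpha> [0..<Suc i]) \<subseteq> mball x e"
      proof
        fix z assume z: "z \<in> F (map \<alpha> [0..<Suc i])"
        have "d z (y (max N (Suc i))) < e / 2"
          using close[OF z y[of "max N (Suc i)"], of i] i
          by (simp add: less_max_iff_disj)
        moreover have "z \<in> M" using z by (auto simp: F_def)
        ultimately show "z \<in> mball x e"
          using triangle[of z "y (max N (Suc i))" x] N[of "max N (Suc i)"] yM xM
          by (auto simp: commute)
      qed
      then show "\<exists>n. F (map \<alpha> [0..<n]) \<subseteq> U" using e(2) by blast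
    qed (simp add: X xM)
  qed
qed

text \<open>Schemes pass to countable unions and intersections but not directly to complements, so
  the induction over Borel sets carries a set and its complement together. Open sets enter as
  countable unions of closed ones.\<close>

lemma has_scheme_borel:
  assumes X: "completely_metrizable_space X" "second_countable X"
    and V: "V \<in> sigma_sets (topspace X) {U. openin X U}"
  shows "has_scheme {U. openin X U} V \<and> has_scheme {U. openin X U} (topspace X - V)"
proof -
  let ?O = "{U. openin X U}"
  have met: "metrizable_space X" using X(1) completely_metrizable_imp_metrizable_space by blast
  have closed: "has_scheme ?O C" if "closedin X C" for C
    using that by (intro has_scheme_closed[OF has_scheme_topspace[OF X]])
      (auto simp: closedin_subset)
  have sep: "\<exists>U W. U \<in> (\<Inter>k::nat. ?O) \<and> W \<in> (\<Inter>k::nat. ?O) \<and> x \<in> U \<and> y \<in> W \<and> U \<inter> W = {}"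
    if "x \<noteq> y" "x \<in> topspace X" "y \<in> topspace X" for x y
    using metrizable_imp_Hausdorff_space[OF met] that unfolding Hausdorff_space_def disjnt_def
    by auto
  from V show ?thesis
  proof (induction rule: sigma_sets.induct)
    case (Basic a)
    then have a: "openin X a" by simp
    obtain C where C: "\<And>n::nat. closedin X (C n)" "a = (\<Union>n. C n)"
      using open_imp_fsigma_in[OF met a] unfolding fsigma_in_ascending by metis
    show ?case
      using closed a C has_scheme_UN[of ?O C] by auto
  next
    case Empty
    show ?case using closed[of "{}"] closed[of "topspace X"] by simp
  next
    case (Compl a)
    then have "a \<subseteq> topspace X"
      using sigma_sets_into_sp[of ?O "topspace X" a] openin_subset[of X] by blast
    then show ?case using Compl by (simp add: double_diff)
  next
    case (Union a)
    have "has_scheme (\<Union>k::nat. ?O) (\<Inter>k. topspace X - a k)"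
      by (rule has_scheme_INT[of "\<lambda>_. ?O"]) (use Union sep in auto)
    moreover have "(\<Inter>k. topspace X - a k) = topspace X - (\<Union>k. a k)" by auto
    ultimately show ?case using has_scheme_UN[of ?O a] Union by simp
  qed
qed

section \<open>Lusin separation of images under a Borel function\<close>

definition borel_separated :: "real set \<Rightarrow> real set \<Rightarrow> bool" where
  "borel_separated A B \<longleftrightarrow> (\<exists>S\<in>sets borel. A \<subseteq> S \<and> B \<inter> S = {})"

text \<open>For fixed \<open>i\<close> the separating sets are intersected over \<open>j\<close>,
  then the results are united over \<open>i\<close>. The contrapositive lets inseparability descend
  along branches.\<close>

lemma borel_separated_UN:
  assumes "\<And>i j. borel_separated (A i) (B j)"
  shows "borel_separated (\<Union>i::nat. A i) (\<Union>j::nat. B j)"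
proof -
  obtain S where S: "\<And>i j. S i j \<in> sets borel \<and> A i \<subseteq> S i j \<and> B j \<inter> S i j = {}"
    using assms unfolding borel_separated_def by metis
  show ?thesis
    unfolding borel_separated_def
  proof (intro bexI conjI)
    show "(\<Union>i. \<Inter>j. S i j) \<in> sets borel"
      using S by (intro sets.countable_UN sets.countable_INT) auto
    show "(\<Union>j. B j) \<inter> (\<Union>i. \<Inter>j. S i j) = {}" using S by blast
  qed (use S in auto)
qed

text \<open>Two images that cannot be separated stay inseparable along some pair of branches, whose limits
  then have the same image.\<close>

lemma lusin_separation:
  fixes f :: "'c \<Rightarrow> real"
  assumes M: "standard_borel M" and f: "f \<in> M \<rightarrow>\<^sub>M borel"
    and E: "E1 \<in> sets M" "E2 \<in> sets M" and disj: "f ` E1 \<inter> f ` E2 = {}"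
  shows "borel_separated (f ` E1) (f ` E2)"
proof -
  obtain X where X: "completely_metrizable_space X" "second_countable X" "topspace X = space M"
    "sets M = sigma_sets (space M) {U. openin X U}"
    using M unfolding standard_borel_def by blast
  let ?O = "{U. openin X U}"
  \<comment> \<open>Rational intervals form a countable base of the line; their preimages
    \<open>V k\<close> are the countably many sets that have to be made open.\<close>
  define I :: "nat \<Rightarrow> real set" where "I k = (case from_nat k :: rat \<times> rat of (p, q) \<Rightarrow> {of_rat p<..<of_rat q})" for k
  define V where "V k = f -` I k \<inter> space M" for k
  have V: "V k \<in> sets M" for k
    unfolding V_def I_def by (intro measurable_sets[OF f]) (auto split: prod.splits)
  have hs: "has_scheme ?O A" "has_scheme ?O (space M - A)" if "A \<in> sets M" for A
    using has_scheme_borel[OF X(1,2), of A] that X by auto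
  \<comment> \<open>The space is cut into \<open>V k\<close> (index 0) and its complement (every
    other index); on each part \<open>V k\<close> may be added to the open sets.\<close>
  have V': "has_scheme (insert (V k) ?O) (space M)" for k
  proof -
    have "has_scheme (insert (V k) ?O) (if j = 0 then V k else space M - V k)" for j :: nat
      using hs[OF V[of k]] has_scheme_insert_self[of ?O "V k"]
        has_scheme_insert_disjoint[of ?O "space M - V k" "V k"] by auto
    from has_scheme_UN[OF this]
    have "has_scheme (insert (V k) ?O) (\<Union>j::nat. if j = 0 then V k else space M - V k)" .
    moreover have "(\<Union>j::nat. if j = 0 then V k else space M - V k) = space M"
      using sets.sets_into_space[OF V[of k]] by (auto split: if_splits)
    ultimately show ?thesis by simp
  qed
  \<comment> \<open>A scheme for \<open>A\<close> at index 0 is intersected with schemes of the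
    whole space at \<open>Suc j\<close> that know \<open>V j\<close>. The original open sets belong
    to all families and separate points.\<close>
  have scheme: "has_scheme (range V) A" if A: "A \<in> sets M" for A
  proof -
    have AM: "A \<subseteq> space M" using sets.sets_into_space[OF A] .
    have met: "Hausdorff_space X"
      using X(1) completely_metrizable_imp_metrizable_space metrizable_imp_Hausdorff_space by blast
    have "has_scheme (\<Union>k. case k of 0 \<Rightarrow> ?O | Suc j \<Rightarrow> insert (V j) ?O)
        (\<Inter>k. case k of 0 \<Rightarrow> A | Suc j \<Rightarrow> space M)"
    proof (rule has_scheme_INT)
      show "has_scheme (case k of 0 \<Rightarrow> ?O | Suc j \<Rightarrow> insert (V j) ?O)
        (case k of 0 \<Rightarrow> A | Suc j \<Rightarrow> space M)" for k
        using hs(1)[OF A] V' by (auto split: nat.splits)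
      fix x y assume xy: "x \<noteq> y" "x \<in> (\<Union>k. case k of 0 \<Rightarrow> A | Suc j \<Rightarrow> space M)"
        "y \<in> (\<Union>k. case k of 0 \<Rightarrow> A | Suc j \<Rightarrow> space M)"
      moreover have "(case k of 0 \<Rightarrow> A | Suc j \<Rightarrow> space M) \<subseteq> topspace X" for k
        using AM X(3) by (cases k) auto
      ultimately have "x \<in> topspace X" "y \<in> topspace X" by blast+
      then obtain U W where UW: "openin X U" "openin X W" "x \<in> U" "y \<in> W" "disjnt U W"
        using met xy(1) unfolding Hausdorff_space_def by metis
      then show "\<exists>U W. U \<in> (\<Inter>k. case k of 0 \<Rightarrow> ?O | Suc j \<Rightarrow> insert (V j) ?O) \<and>
          W \<in> (\<Inter>k. case k of 0 \<Rightarrow> ?O | Suc j \<Rightarrow> insert (V j) ?O) \<and> x \<in> U \<and> y \<in> W \<and> U \<inter> W = {}"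
        by (intro exI[of _ U] exI[of _ W]) (auto split: nat.split simp: disjnt_def)
    qed
    moreover have "(\<Inter>k. case k of 0 \<Rightarrow> A | Suc j \<Rightarrow> space M) = A"
    proof (intro equalityI INT_greatest)
      show "(\<Inter>k. case k of 0 \<Rightarrow> A | Suc j \<Rightarrow> space M) \<subseteq> A"
        using INT_lower[of 0 UNIV "\<lambda>k. case k of 0 \<Rightarrow> A | Suc j \<Rightarrow> space M"] by simp
      show "A \<subseteq> (case k of 0 \<Rightarrow> A | Suc j \<Rightarrow> space M)" for k
        using AM by (cases k) auto
    qed
    moreover have "V k \<in> (\<Union>k. case k of 0 \<Rightarrow> ?O | Suc j \<Rightarrow> insert (V j) ?O)" for k
      by (rule UN_I[of "Suc k"]) auto
    ultimately show ?thesis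
      using has_scheme_mono[of _ A "range V"] by (simp add: image_subset_iff del: UN_iff)
  qed
  obtain F1 where "souslin_scheme (range V) E1 F1"
    using scheme[OF E(1)] unfolding has_scheme_def by blast
  note F1 = souslin_schemeD[OF this]
  obtain F2 where "souslin_scheme (range V) E2 F2"
    using scheme[OF E(2)] unfolding has_scheme_def by blast
  note F2 = souslin_schemeD[OF this]
  show ?thesis
  proof (rule ccontr)
    assume nsep: "\<not> ?thesis"
    \<comment> \<open>An inseparable pair of nodes has an inseparable pair of successors, by
      \<open>borel_separated_UN\<close>; iteration yields the two branches.\<close>
    define Q where "Q p \<longleftrightarrow> \<not> borel_separated (f ` F1 (fst p)) (f ` F2 (snd p))" for p
    have step: "\<exists>i j. Q (s @ [i], t @ [j])" if "Q (s, t)" for s t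
    proof (rule ccontr)
      assume "\<nexists>i j. Q (s @ [i], t @ [j])"
      then have "borel_separated (\<Union>i. f ` F1 (s @ [i])) (\<Union>j. f ` F2 (t @ [j]))"
        by (intro borel_separated_UN) (auto simp: Q_def)
      then have "borel_separated (f ` F1 s) (f ` F2 t)"
        unfolding image_UN[symmetric] F1(2) F2(2) .
      then show False using that by (simp add: Q_def)
    qed
    then obtain i j where ij: "\<And>s t. Q (s, t) \<Longrightarrow> Q (s @ [i s t], t @ [j s t])" by metis
    define p where "p = rec_nat ([], []) (\<lambda>_ (s, t). (s @ [i s t], t @ [j s t]))"
    have p0: "p 0 = ([], [])" and pS: "\<And>n. p (Suc n) =
        (fst (p n) @ [i (fst (p n)) (snd (p n))], snd (p n) @ [j (fst (p n)) (snd (p n))])"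
      by (auto simp: p_def split: prod.splits)
    define \<alpha> where "\<alpha> n = i (fst (p n)) (snd (p n))" for n
    define \<beta> where "\<beta> n = j (fst (p n)) (snd (p n))" for n
    have p: "p n = (map \<alpha> [0..<n], map \<beta> [0..<n])" for n
      by (induction n) (auto simp: p0 pS \<alpha>_def \<beta>_def)
    have "Q (p n)" for n
    proof (induction n)
      case 0
      then show ?case using nsep by (simp add: p0 Q_def F1 F2)
    next
      case (Suc n)
      then show ?case using ij[of "fst (p n)" "snd (p n)"] by (simp add: pS)
    qed
    then have Qn: "\<not> borel_separated (f ` F1 (map \<alpha> [0..<n])) (f ` F2 (map \<beta> [0..<n]))" for n
      unfolding p Q_def by simp
    \<comment> \<open>The empty set is separated from everything, so inseparability already forces
      both branches to consist of nonempty sets.\<close>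
    have "borel_separated {} B" "borel_separated B {}" for B
      unfolding borel_separated_def by (auto intro: bexI[of _ "{}"] bexI[of _ UNIV])
    then have ne: "F1 (map \<alpha> [0..<n]) \<noteq> {}" "F2 (map \<beta> [0..<n]) \<noteq> {}" for n
      using Qn[of n] by (metis image_empty)+
    obtain x where x: "x \<in> E1" "\<And>k. x \<in> V k \<Longrightarrow> \<exists>n. F1 (map \<alpha> [0..<n]) \<subseteq> V k"
      using F1(3)[OF ne(1)] by blast
    obtain y where y: "y \<in> E2" "\<And>k. y \<in> V k \<Longrightarrow> \<exists>n. F2 (map \<beta> [0..<n]) \<subseteq> V k"
      using F2(3)[OF ne(2)] by blast
    have xy: "x \<in> space M" "y \<in> space M"
      using x(1) y(1) E sets.sets_into_space by blast+
    have nbhd: "\<exists>k. z \<in> V k \<and> f ` V k \<subseteq> {a<..<b}" if z: "z \<in> space M" "f z \<in> {a<..<b}" for z a b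
    proof -
      obtain q r where qr: "a < of_rat q" "of_rat q < f z" "f z < of_rat r" "of_rat r < b"
        using of_rat_dense[of a "f z"] of_rat_dense[of "f z" b] z by auto
      show ?thesis
        by (rule exI[of _ "to_nat (q, r)"]) (use qr z in \<open>auto simp: V_def I_def\<close>)
    qed
    have sep: False if zw: "f x \<in> {a<..<b}" "f y \<in> {c<..<d}" "{a<..<b} \<inter> {c<..<d} = {}" for a b c d
    proof -
      obtain k l where kl: "x \<in> V k" "f ` V k \<subseteq> {a<..<b}" "y \<in> V l" "f ` V l \<subseteq> {c<..<d}"
        using nbhd[OF xy(1) zw(1)] nbhd[OF xy(2) zw(2)] by blast
      obtain m where m: "F1 (map \<alpha> [0..<m]) \<subseteq> V k"
        using x(2)[OF kl(1)] by blast
      obtain n where n: "F2 (map \<beta> [0..<n]) \<subseteq> V l"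
        using y(2)[OF kl(3)] by blast
      have "F1 (map \<alpha> [0..<max m n]) \<subseteq> V k" "F2 (map \<beta> [0..<max m n]) \<subseteq> V l"
        using m n scheme_antimono[of F1 m "max m n" \<alpha>, OF F1(2)]
          scheme_antimono[of F2 n "max m n" \<beta>, OF F2(2)]
        by (meson max.cobounded1 max.cobounded2 subset_trans)+
      then have "borel_separated (f ` F1 (map \<alpha> [0..<max m n])) (f ` F2 (map \<beta> [0..<max m n]))"
        unfolding borel_separated_def using kl zw(3)
        by (intro bexI[of _ "{a<..<b}"]) (blast, simp)
      then show False using Qn by blast
    qed
    \<comment> \<open>The limits lie in \<open>E1\<close> and \<open>E2\<close>, so their images
      differ; disjoint intervals around these images, meeting at the midpoint, would separate deep
      nodes of the two branches.\<close>
    have "f x \<noteq> f y" using disj x(1) y(1) by blast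
    then consider "f x < f y" | "f y < f x" by linarith
    then show False
    proof cases
      case 1
      then show False
        using sep[of "f x - 1" "(f x + f y) / 2" "(f x + f y) / 2" "f y + 1"] by auto
    next
      case 2
      then show False
        using sep[of "(f x + f y) / 2" "f x + 1" "f y - 1" "(f x + f y) / 2"] by auto
    qed
  qed
qed

text \<open>On the image of \<open>s\<close> the map \<open>f\<close> is injective, so the parts of
  this image inside and outside a Borel set \<open>A\<close> have disjoint images under
  \<open>f\<close>. A Borel set of reals separating them cuts out of \<open>D\<close> exactly the
  preimage of \<open>A\<close>.\<close>

lemma measurable_borel_graph:
  fixes f :: "'c \<Rightarrow> real"
  assumes M: "standard_borel M" and f: "f \<in> M \<rightarrow>\<^sub>M borel" and D: "D \<in> sets borel"
    and s: "\<And>t. t \<in> D \<Longrightarrow> f (s t) = t" and graph: "s ` D \<in> sets M"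
  shows "s \<in> restrict_space borel D \<rightarrow>\<^sub>M M"
proof (rule measurableI)
  show "s t \<in> space M" if "t \<in> space (restrict_space borel D)" for t
    using that sets.sets_into_space[OF graph] by (auto simp: space_restrict_space)
next
  fix A assume A: "A \<in> sets M"
  have "f ` (s ` D \<inter> A) \<inter> f ` (s ` D - A) = {}"
    using s by auto
  then obtain S where S: "S \<in> sets borel" "f ` (s ` D \<inter> A) \<subseteq> S" "f ` (s ` D - A) \<inter> S = {}"
    using lusin_separation[OF M f, of "s ` D \<inter> A" "s ` D - A"] graph A
    unfolding borel_separated_def by blast
  have "t \<in> S" if "t \<in> D" "s t \<in> A" for t
    using S(2) that s[OF that(1)] by (metis IntI image_eqI subsetD)
  moreover have "t \<notin> S" if "t \<in> D" "s t \<notin> A" for t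
    using S(3) that s[OF that(1)] by (metis DiffI disjoint_iff image_eqI)
  ultimately have "s -` A \<inter> D = S \<inter> D" by blast
  then show "s -` A \<inter> space (restrict_space borel D) \<in> sets (restrict_space borel D)"
    using S(1) D by (auto simp: sets_restrict_space space_restrict_space)
qed

section \<open>Spatial super product systems\<close>

lemma scaleC_one [simp]: "1 *\<^sub>C x = (x :: 'a::complex_hilbert_space)"
  using scaleR_scaleC[of 1 x] by simp

lemma scaleC_zero_left [simp]: "0 *\<^sub>C x = (0 :: 'a::complex_hilbert_space)"
  using scaleR_scaleC[of 0 x] by simp

lemma scaleC_minus_one: "(- 1) *\<^sub>C x = - (x :: 'a::complex_hilbert_space)"
  using scaleR_scaleC[of "- 1" x] by simp

lemma cinner_add_right: "cinner x (y + z) = cinner x y + cinner x z"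
  by (metis cinner_commute cinner_add_left complex_cnj_add)

lemma cinner_scaleC_right: "cinner x (a *\<^sub>C y) = cnj a * cinner x y"
  by (metis cinner_commute cinner_scaleC_left complex_cnj_mult)

lemma cinner_minus_left: "cinner (- x) y = - cinner x y"
  by (metis cinner_scaleC_left mult_minus1 scaleC_minus_one)

lemma cinner_diff_left: "cinner (x - y) z = cinner x z - cinner y z"
  using cinner_add_left[of x "- y" z] by (simp add: cinner_minus_left)

lemma cinner_diff_right: "cinner x (y - z) = cinner x y - cinner x z"
  by (metis cinner_commute cinner_diff_left complex_cnj_diff)

lemma cinner_zero_left [simp]: "cinner 0 x = 0"
  by (metis cinner_scaleC_left mult_zero_left scaleC_zero_left)

lemma cinner_zero_right [simp]: "cinner x 0 = 0"
  by (metis cinner_commute cinner_zero_left complex_cnj_zero)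

lemma cinner_self: "cinner x x = of_real ((norm x)\<^sup>2)"
proof -
  have "Im (cinner x x) = 0"
    using arg_cong[OF cinner_commute[of x x], of Im] by simp
  moreover have "Re (cinner x x) = (norm x)\<^sup>2"
    by (simp add: inner_eq_Re_cinner[symmetric] power2_norm_eq_inner)
  ultimately show ?thesis by (simp add: complex_eq_iff)
qed

lemma norm_add_orthogonal:
  assumes "cinner x y = 0"
  shows "(norm (x + y))\<^sup>2 = (norm x)\<^sup>2 + (norm y)\<^sup>2"
proof -
  have "inner x y = 0" using assms by (simp add: inner_eq_Re_cinner)
  then show ?thesis by (simp add: power2_norm_eq_inner inner_add inner_commute)
qed

lemma norm_diff_power2: "(norm (x - y))\<^sup>2 = (norm x)\<^sup>2 + (norm y)\<^sup>2 - 2 * Re (cinner x y)"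
  unfolding inner_eq_Re_cinner[symmetric]
  by (simp add: power2_norm_eq_inner inner_diff inner_commute)

text \<open>\<open>cinner\<close> is conjugate linear in its second argument, so pairing with
  \<open>\<i> *\<^sub>C y\<close> exposes the imaginary part. Polarization and continuity of the
  real inner product are transferred in this way.\<close>

lemma cinner_conv_inner: "cinner x y = Complex (inner x y) (inner x (\<i> *\<^sub>C y))"
  by (simp add: complex_eq_iff inner_eq_Re_cinner cinner_scaleC_right)

lemma module_scaleC: "module (scaleC :: complex \<Rightarrow> 'a::complex_hilbert_space \<Rightarrow> 'a)"
  using vector_space_scaleC by (simp add: module_iff_vector_space)

lemma hilbert_subspaceD:
  assumes "hilbert_subspace V"
  shows "0 \<in> V" "x \<in> V \<Longrightarrow> y \<in> V \<Longrightarrow> x + y \<in> V" "x \<in> V \<Longrightarrow> a *\<^sub>C x \<in> V" "closed V"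
  using assms module.subspace_def[OF module_scaleC, of V] unfolding hilbert_subspace_def by auto

text \<open>Polarization gives the real inner product, and complex linearity of \<open>f\<close>
  then gives the imaginary part.\<close>

lemma linear_isometry_on_cinner:
  assumes f: "linear_isometry_on V W f" and V: "hilbert_subspace V" and x: "x \<in> V" and y: "y \<in> V"
  shows "cinner (f x) (f y) = cinner x y"
proof -
  have inner: "inner (f x) (f y) = inner x y" if "x \<in> V" "y \<in> V" for x y
  proof -
    have "f (x + y) = f x + f y" "norm (f (x + y)) = norm (x + y)" "norm (f x) = norm x"
      "norm (f y) = norm y"
      using f that hilbert_subspaceD(2)[OF V that] unfolding linear_isometry_on_def by blast+
    then show ?thesis by (simp add: dot_norm)
  qed
  have "f (\<i> *\<^sub>C y) = \<i> *\<^sub>C f y" using f y unfolding linear_isometry_on_def by auto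
  then show ?thesis
    unfolding cinner_conv_inner
    using inner[OF x y] inner[OF x hilbert_subspaceD(3)[OF V y, of "\<i>"]] by simp
qed

section \<open>The multiplication of fibres, including time zero\<close>

locale spatial_system =
  fixes S :: "('a::complex_hilbert_space, 'b::complex_hilbert_space) sps"
    and Om :: "real \<Rightarrow> 'a"
  assumes spatial: "spatial_super_product_system S Om"
begin

abbreviation "H \<equiv> fibre S"
abbreviation "m \<equiv> mult S Om"

lemma sps: "super_product_system S"
  using spatial unfolding spatial_super_product_system_def by blast

lemma H0: "H 0 = range (\<lambda>c. c *\<^sub>C Om 0)"
  using spatial unfolding spatial_super_product_system_def by blast

lemma norm_Om: "t \<ge> 0 \<Longrightarrow> norm (Om t) = 1"
  using spatial unfolding spatial_super_product_system_def by blast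

lemma cinner_Om: "t \<ge> 0 \<Longrightarrow> cinner (Om t) (Om t) = 1"
  by (simp add: cinner_self norm_Om)

lemma Om_units: "Om \<in> units S Om"
  using spatial unfolding spatial_super_product_system_def by blast

lemma Om_in: "t \<ge> 0 \<Longrightarrow> Om t \<in> H t"
  using Om_units unfolding units_def measurable_sections_def by auto

lemma m_Om: "s \<ge> 0 \<Longrightarrow> t \<ge> 0 \<Longrightarrow> m s t (Om s) (Om t) = Om (s + t)"
  using Om_units unfolding units_def by auto

lemma hilbert_H: "t > 0 \<Longrightarrow> hilbert_subspace (H t)"
  using sps unfolding super_product_system_def by blast

lemma H0_expand:
  assumes "x \<in> H 0"
  shows "x = cinner x (Om 0) *\<^sub>C Om 0"
  using assms by (auto simp: H0 cinner_scaleC_left cinner_Om)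

lemma H_zero: "t \<ge> 0 \<Longrightarrow> 0 \<in> H t"
  by (cases "t = 0") (auto simp: H0 hilbert_H hilbert_subspaceD intro: range_eqI[of _ _ 0])

lemma H_add: "t \<ge> 0 \<Longrightarrow> x \<in> H t \<Longrightarrow> y \<in> H t \<Longrightarrow> x + y \<in> H t"
  by (cases "t = 0") (auto simp: H0 hilbert_H hilbert_subspaceD scaleC_add_left[symmetric])

lemma H_scaleC: "t \<ge> 0 \<Longrightarrow> x \<in> H t \<Longrightarrow> a *\<^sub>C x \<in> H t"
  by (cases "t = 0") (auto simp: H0 hilbert_H hilbert_subspaceD scaleC_scaleC)

lemma H_diff: "t \<ge> 0 \<Longrightarrow> x \<in> H t \<Longrightarrow> y \<in> H t \<Longrightarrow> x - y \<in> H t"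
  using H_add[of t x "(- 1) *\<^sub>C y"] H_scaleC[of t y "- 1"] by (simp add: scaleC_minus_one)

lemma H_closed:
  assumes "t > 0" "\<And>n. x n \<in> H t" "x \<longlonglongrightarrow> y"
  shows "y \<in> H t"
  using closed_sequentially[OF hilbert_subspaceD(4)[OF hilbert_H[OF assms(1)]]] assms(2,3) by blast

lemma tensor_product: "s > 0 \<Longrightarrow> t > 0 \<Longrightarrow>
    is_hilbert_tensor_product (H s) (H t) (tspace S s t) (tensor S s t)"
  and iso: "s > 0 \<Longrightarrow> t > 0 \<Longrightarrow> linear_isometry_on (tspace S s t) (H (s + t)) (iso S s t)"
  using sps unfolding super_product_system_def by simp_all

lemma m_pos: "s > 0 \<Longrightarrow> t > 0 \<Longrightarrow> m s t x y = iso S s t (tensor S s t x y)"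
  by (simp add: mult_def)

lemma m_0_left: "m 0 t x y = cinner x (Om 0) *\<^sub>C y"
  by (simp add: mult_def)

lemma m_0_right: "y \<in> H 0 \<Longrightarrow> x \<in> H s \<Longrightarrow> m s 0 x y = cinner y (Om 0) *\<^sub>C x"
  using H0_expand[of x] H0_expand[of y]
  by (cases "s = 0") (auto simp: mult_def, metis mult.commute scaleC_scaleC)

lemma m_Om0_left [simp]: "m 0 t (Om 0) y = y"
  by (simp add: m_0_left cinner_Om)

lemma m_Om0_right [simp]: "x \<in> H s \<Longrightarrow> m s 0 x (Om 0) = x"
  by (simp add: m_0_right Om_in cinner_Om)

lemma m_in:
  assumes "s \<ge> 0" "t \<ge> 0" "x \<in> H s" "y \<in> H t"
  shows "m s t x y \<in> H (s + t)"
proof (cases "s = 0 \<or> t = 0")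
  case True
  then show ?thesis using assms by (auto simp: m_0_left m_0_right H_scaleC)
next
  case False
  then show ?thesis
    using assms tensor_product[of s t] iso[of s t]
    unfolding is_hilbert_tensor_product_def linear_isometry_on_def by (auto simp: m_pos)
qed

lemma m_add_left:
  assumes "s \<ge> 0" "t \<ge> 0" "x \<in> H s" "x' \<in> H s" "y \<in> H t"
  shows "m s t (x + x') y = m s t x y + m s t x' y"
proof (cases "s = 0 \<or> t = 0")
  case True
  then show ?thesis using assms
    by (auto simp: m_0_left m_0_right H_add scaleC_add_left scaleC_add_right cinner_add_left)
next
  case False
  then show ?thesis
    using assms tensor_product[of s t] iso[of s t]
    unfolding is_hilbert_tensor_product_def linear_isometry_on_def by (auto simp: m_pos)
qed

lemma m_add_right:
  assumes "s \<ge> 0" "t \<ge> 0" "x \<in> H s" "y \<in> H t" "y' \<in> H t"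
  shows "m s t x (y + y') = m s t x y + m s t x y'"
proof (cases "s = 0 \<or> t = 0")
  case True
  then show ?thesis using assms
    by (auto simp: m_0_left m_0_right H_add scaleC_add_left scaleC_add_right cinner_add_left)
next
  case False
  then show ?thesis
    using assms tensor_product[of s t] iso[of s t]
    unfolding is_hilbert_tensor_product_def linear_isometry_on_def by (auto simp: m_pos)
qed

lemma m_scaleC_left:
  assumes "s \<ge> 0" "t \<ge> 0" "x \<in> H s" "y \<in> H t"
  shows "m s t (a *\<^sub>C x) y = a *\<^sub>C m s t x y"
proof (cases "s = 0 \<or> t = 0")
  case True
  then show ?thesis using assms
    by (auto simp: m_0_left m_0_right H_scaleC scaleC_scaleC cinner_scaleC_left mult.commute)
next
  case False
  then show ?thesis
    using assms tensor_product[of s t] iso[of s t]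
    unfolding is_hilbert_tensor_product_def linear_isometry_on_def by (auto simp: m_pos)
qed

lemma m_scaleC_right:
  assumes "s \<ge> 0" "t \<ge> 0" "x \<in> H s" "y \<in> H t"
  shows "m s t x (a *\<^sub>C y) = a *\<^sub>C m s t x y"
proof (cases "s = 0 \<or> t = 0")
  case True
  then show ?thesis using assms
    by (auto simp: m_0_left m_0_right H_scaleC scaleC_scaleC cinner_scaleC_left mult.commute)
next
  case False
  then show ?thesis
    using assms tensor_product[of s t] iso[of s t]
    unfolding is_hilbert_tensor_product_def linear_isometry_on_def by (auto simp: m_pos)
qed

lemma m_diff_left:
  assumes "s \<ge> 0" "t \<ge> 0" "x \<in> H s" "x' \<in> H s" "y \<in> H t"
  shows "m s t (x - x') y = m s t x y - m s t x' y"
  using m_add_left[of s t "x - x'" x' y] H_diff assms by simp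

lemma m_diff_right:
  assumes "s \<ge> 0" "t \<ge> 0" "x \<in> H s" "y \<in> H t" "y' \<in> H t"
  shows "m s t x (y - y') = m s t x y - m s t x y'"
  using m_add_right[of s t x "y - y'" y'] H_diff assms by simp

lemma m_zero_left: "s \<ge> 0 \<Longrightarrow> t \<ge> 0 \<Longrightarrow> y \<in> H t \<Longrightarrow> m s t 0 y = 0"
  using m_diff_left[of s t 0 0 y] H_zero by simp

lemma m_zero_right: "s \<ge> 0 \<Longrightarrow> t \<ge> 0 \<Longrightarrow> x \<in> H s \<Longrightarrow> m s t x 0 = 0"
  using m_diff_right[of s t x 0 0] H_zero by simp

text \<open>All orthogonality arguments below rest on this factorization: two products are
  orthogonal as soon as one pair of corresponding factors is.\<close>

lemma cinner_m:
  assumes "s \<ge> 0" "t \<ge> 0" "x \<in> H s" "x' \<in> H s" "y \<in> H t" "y' \<in> H t"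
  shows "cinner (m s t x y) (m s t x' y') = cinner x x' * cinner y y'"
proof -
  have H0_cinner: "cinner z z' = cinner z (Om 0) * cnj (cinner z' (Om 0))" if "z \<in> H 0" "z' \<in> H 0" for z z'
    using that by (auto simp: H0 cinner_scaleC_left cinner_scaleC_right cinner_Om)
  consider "s = 0" | "s > 0" "t = 0" | "s > 0" "t > 0" using assms by linarith
  then show ?thesis
  proof cases
    case 1
    then show ?thesis using assms H0_cinner[of x x']
      by (simp add: m_0_left cinner_scaleC_left cinner_scaleC_right)
  next
    case 2
    then show ?thesis using assms H0_cinner[of y y']
      by (simp add: m_0_right cinner_scaleC_left cinner_scaleC_right)
  next
    case 3
    note T = tensor_product[OF 3, unfolded is_hilbert_tensor_product_def]
    have "cinner (iso S s t (tensor S s t x y)) (iso S s t (tensor S s t x' y')) =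
        cinner (tensor S s t x y) (tensor S s t x' y')"
      by (rule linear_isometry_on_cinner[OF iso[OF 3]]) (use T assms in auto)
    then show ?thesis using T assms 3 by (simp add: m_pos)
  qed
qed

lemma norm_m:
  assumes "s \<ge> 0" "t \<ge> 0" "x \<in> H s" "y \<in> H t"
  shows "norm (m s t x y) = norm x * norm y"
proof -
  have "cinner (m s t x y) (m s t x y) = complex_of_real ((norm x * norm y)\<^sup>2)"
    using cinner_m[OF assms(1,2,3,3,4,4)] by (simp add: cinner_self power_mult_distrib)
  then show ?thesis
    by (simp only: cinner_self of_real_eq_iff) (simp add: power2_eq_iff_nonneg)
qed

lemma m_assoc:
  assumes "r \<ge> 0" "s \<ge> 0" "t \<ge> 0" "x \<in> H r" "y \<in> H s" "z \<in> H t"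
  shows "m r (s + t) x (m s t y z) = m (r + s) t (m r s x y) z"
proof -
  consider "r = 0" | "r > 0" "s = 0" | "r > 0" "s > 0" "t = 0" | "r > 0" "s > 0" "t > 0"
    using assms by linarith
  then show ?thesis
  proof cases
    case 1
    then show ?thesis using assms by (simp add: m_0_left m_scaleC_left)
  next
    case 2
    then show ?thesis using assms by (simp add: m_0_left m_0_right m_scaleC_left m_scaleC_right)
  next
    case 3
    then show ?thesis using assms by (simp add: m_0_right m_scaleC_right m_in)
  next
    case 4
    then show ?thesis using sps assms unfolding super_product_system_def by (simp add: m_pos)
  qed
qed

text \<open>Associativity with the outer lengths as separate variables, for uses where they match
  only after arithmetic.\<close>

lemma m_assoc_eq:
  assumes "r \<ge> 0" "s \<ge> 0" "t \<ge> 0" "x \<in> H r" "y \<in> H s" "z \<in> H t" "p = s + t" "q = r + s"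
  shows "m q t (m r s x y) z = m r p x (m s t y z)"
  using m_assoc[OF assms(1-6)] assms(7,8) by simp

lemma tendsto_m:
  assumes st: "s \<ge> 0" "t \<ge> 0" and "\<And>n. x n \<in> H s" "\<And>n. y n \<in> H t" "x' \<in> H s" "y' \<in> H t"
    and lim: "x \<longlonglongrightarrow> x'" "y \<longlonglongrightarrow> y'"
  shows "(\<lambda>n. m s t (x n) (y n)) \<longlonglongrightarrow> m s t x' y'"
proof (rule Lim_transform2)
  show "(\<lambda>n::nat. m s t x' y') \<longlonglongrightarrow> m s t x' y'" by simp
  have "(\<lambda>n. norm (x' - x n) * norm (y n) + norm x' * norm (y' - y n)) \<longlonglongrightarrow> norm (x' - x') * norm y' + norm x' * norm (y' - y')"
    using lim by (intro tendsto_intros)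
  moreover have "norm (m s t x' y' - m s t (x n) (y n)) \<le> norm (x' - x n) * norm (y n) + norm x' * norm (y' - y n)" for n
  proof -
    have "m s t x' y' - m s t (x n) (y n) = m s t (x' - x n) (y n) + m s t x' (y' - y n)"
      using assms by (simp add: m_diff_left m_diff_right)
    also have "norm \<dots> \<le> norm (m s t (x' - x n) (y n)) + norm (m s t x' (y' - y n))"
      by (rule norm_triangle_ineq)
    finally show ?thesis using assms by (simp add: norm_m H_diff)
  qed
  ultimately show "(\<lambda>n. m s t x' y' - m s t (x n) (y n)) \<longlonglongrightarrow> 0"
    using Lim_null_comparison[of "\<lambda>n. m s t x' y' - m s t (x n) (y n)"
        "\<lambda>n. norm (x' - x n) * norm (y n) + norm x' * norm (y' - y n)" sequentially]
    by (simp only: diff_self norm_zero mult_zero_left mult_zero_right add_0 always_eventually simp_thms)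
qed

section \<open>Measurable sections\<close>

lemma total_iff: "p \<in> space (total S) \<longleftrightarrow> fst p > 0 \<and> snd p \<in> H (fst p)"
  using sps unfolding super_product_system_def by (auto simp: case_prod_unfold)

lemma standard_borel_total: "standard_borel (total S)"
  and measurable_fst_total: "fst \<in> total S \<rightarrow>\<^sub>M borel"
  and measurable_add_total: "(\<lambda>(p, q). (fst p, snd p + snd q)) \<in> fibre_product S \<rightarrow>\<^sub>M total S"
  and measurable_scaleC_total:
    "(\<lambda>(a, p). (fst p, a *\<^sub>C snd p)) \<in> borel \<Otimes>\<^sub>M total S \<rightarrow>\<^sub>M total S"
  and measurable_cinner_total:
    "(\<lambda>(p, q). cinner (snd p) (snd q)) \<in> fibre_product S \<rightarrow>\<^sub>M borel"
  and measurable_mult_total: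
    "(\<lambda>(p, q). (fst p + fst q, iso S (fst p) (fst q) (tensor S (fst p) (fst q) (snd p) (snd q))))
        \<in> total S \<Otimes>\<^sub>M total S \<rightarrow>\<^sub>M total S"
  using sps unfolding super_product_system_def by simp_all

lemma measurable_fibre_product:
  assumes "(\<lambda>w. (\<tau> w, x w)) \<in> N \<rightarrow>\<^sub>M total S" "(\<lambda>w. (\<tau> w, y w)) \<in> N \<rightarrow>\<^sub>M total S"
  shows "(\<lambda>w. ((\<tau> w, x w), (\<tau> w, y w))) \<in> N \<rightarrow>\<^sub>M fibre_product S"
  unfolding fibre_product_def using assms by (intro measurable_restrict_space2) auto

lemma measurable_section_add:
  assumes "(\<lambda>w. (\<tau> w, x w)) \<in> N \<rightarrow>\<^sub>M total S" "(\<lambda>w. (\<tau> w, y w)) \<in> N \<rightarrow>\<^sub>M total S"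
  shows "(\<lambda>w. (\<tau> w, x w + y w)) \<in> N \<rightarrow>\<^sub>M total S"
proof -
  from measurable_compose[OF measurable_fibre_product[OF assms] measurable_add_total] show ?thesis by simp
qed

lemma measurable_section_scaleC:
  assumes "(\<lambda>w. (\<tau> w, x w)) \<in> N \<rightarrow>\<^sub>M total S"
  shows "(\<lambda>w. (\<tau> w, a *\<^sub>C x w)) \<in> N \<rightarrow>\<^sub>M total S"
proof -
  have "(\<lambda>w. (a, (\<tau> w, x w))) \<in> N \<rightarrow>\<^sub>M borel \<Otimes>\<^sub>M total S"
    using assms by measurable
  from measurable_compose[OF this measurable_scaleC_total] show ?thesis by simp
qed

lemma measurable_section_diff:
  assumes "(\<lambda>w. (\<tau> w, x w)) \<in> N \<rightarrow>\<^sub>M total S" "(\<lambda>w. (\<tau> w, y w)) \<in> N \<rightarrow>\<^sub>M total S"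
  shows "(\<lambda>w. (\<tau> w, x w - y w)) \<in> N \<rightarrow>\<^sub>M total S"
  using measurable_section_add[OF assms(1) measurable_section_scaleC[OF assms(2), of "- 1"]]
  by (simp add: scaleC_minus_one)

lemma measurable_section_norm:
  assumes "(\<lambda>w. (\<tau> w, x w)) \<in> N \<rightarrow>\<^sub>M total S"
  shows "(\<lambda>w. norm (x w)) \<in> borel_measurable N"
proof -
  from measurable_compose[OF measurable_fibre_product[OF assms assms] measurable_cinner_total]
  have "(\<lambda>w. sqrt (Re (cinner (x w) (x w)))) \<in> borel_measurable N" by simp
  then show ?thesis by (simp add: inner_eq_Re_cinner[symmetric] norm_eq_sqrt_inner[symmetric])
qed

lemma measurable_section_m:
  assumes "(\<lambda>w. (\<sigma> w, x w)) \<in> N \<rightarrow>\<^sub>M total S" "(\<lambda>w. (\<tau> w, y w)) \<in> N \<rightarrow>\<^sub>M total S"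
  shows "(\<lambda>w. (\<sigma> w + \<tau> w, m (\<sigma> w) (\<tau> w) (x w) (y w))) \<in> N \<rightarrow>\<^sub>M total S"
proof -
  have "(\<lambda>w. ((\<sigma> w, x w), (\<tau> w, y w))) \<in> N \<rightarrow>\<^sub>M total S \<Otimes>\<^sub>M total S"
    using assms by measurable
  from measurable_compose[OF this measurable_mult_total]
  have "(\<lambda>w. (\<sigma> w + \<tau> w, iso S (\<sigma> w) (\<tau> w) (tensor S (\<sigma> w) (\<tau> w) (x w) (y w)))) \<in> N \<rightarrow>\<^sub>M total S"
    by simp
  moreover have "\<sigma> w > 0" "\<tau> w > 0" if "w \<in> space N" for w
    using measurable_space[OF assms(1) that] measurable_space[OF assms(2) that] by (auto simp: total_iff)
  ultimately show ?thesis by (simp cong: measurable_cong add: m_pos)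
qed

text \<open>The graph of the limit is Borel, and the projection is injective on it.\<close>

lemma measurable_section_limit:
  fixes x :: "nat \<Rightarrow> real \<Rightarrow> 'a"
  assumes x: "\<And>n. (\<lambda>t. (t, x n t)) \<in> restrict_space borel {0<..} \<rightarrow>\<^sub>M total S"
    and lim: "\<And>t. t > 0 \<Longrightarrow> (\<lambda>n. x n t) \<longlonglongrightarrow> y t"
  shows "(\<lambda>t. (t, y t)) \<in> restrict_space borel {0<..} \<rightarrow>\<^sub>M total S"
proof (rule measurable_borel_graph)
  show "standard_borel (total S)" "fst \<in> total S \<rightarrow>\<^sub>M borel"
    by (fact standard_borel_total measurable_fst_total)+
  have xH: "x n t \<in> H t" if "t > 0" for n t
    using measurable_space[OF x[of n], of t] that by (simp add: total_iff space_restrict_space)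
  have fst': "fst \<in> total S \<rightarrow>\<^sub>M restrict_space borel {0<..}"
    using measurable_fst_total by (intro measurable_restrict_space2) (auto simp: total_iff)
  have "(\<lambda>p. (fst p, snd p)) \<in> total S \<rightarrow>\<^sub>M total S" by simp
  moreover have "(\<lambda>p. (fst p, x n (fst p))) \<in> total S \<rightarrow>\<^sub>M total S" for n
    using measurable_compose[OF fst' x] .
  ultimately have d: "(\<lambda>p. norm (snd p - x n (fst p))) \<in> borel_measurable (total S)" for n
    by (intro measurable_section_norm measurable_section_diff)
  \<comment> \<open>Convergence of \<open>x n (fst p)\<close> to \<open>snd p\<close>, written with
    countable quantifiers over fibrewise distances, which are Borel functions on the total
    space.\<close>
  have "{p \<in> space (total S). \<forall>k. \<exists>N. \<forall>n\<ge>N. norm (snd p - x n (fst p)) < inverse (real (Suc k))} \<in> sets (total S)"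
    using d by measurable
  moreover have "(\<lambda>t. (t, y t)) ` {0<..} =
    {p \<in> space (total S). \<forall>k. \<exists>N. \<forall>n\<ge>N. norm (snd p - x n (fst p)) < inverse (real (Suc k))}"
    (is "_ = ?R")
  proof (intro equalityI subsetI)
    fix p assume "p \<in> (\<lambda>t. (t, y t)) ` {0<..}"
    then obtain t where t: "t > 0" "p = (t, y t)" by auto
    have "\<exists>N. \<forall>n\<ge>N. norm (x n t - y t) < inverse (real (Suc k))" for k
      using LIMSEQ_D[OF lim[OF t(1)], of "inverse (real (Suc k))"] by simp
    then show "p \<in> ?R"
      using t H_closed[OF t(1) xH lim[OF t(1)]] by (auto simp: total_iff norm_minus_commute)
  next
    fix p assume p: "p \<in> ?R"
    define t where "t = fst p"
    have t: "t > 0" using p by (auto simp: total_iff t_def)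
    have "(\<lambda>n. x n t) \<longlonglongrightarrow> snd p"
    proof (rule LIMSEQ_I)
      fix r :: real assume "r > 0"
      then obtain k where k: "inverse (real (Suc k)) < r" using reals_Archimedean by blast
      then obtain N where "\<forall>n\<ge>N. norm (snd p - x n t) < inverse (real (Suc k))"
        using p by (auto simp: t_def)
      then show "\<exists>N. \<forall>n\<ge>N. norm (x n t - snd p) < r"
        using k by (intro exI[of _ N]) (metis norm_minus_commute less_trans)
    qed
    then have "snd p = y t" using lim[OF t] LIMSEQ_unique by blast
    then have "p = (t, y t)" by (simp add: t_def prod_eq_iff)
    then show "p \<in> (\<lambda>t. (t, y t)) ` {0<..}" using t by auto
  qed
  ultimately show "(\<lambda>t. (t, y t)) ` {0<..} \<in> sets (total S)" by (simp only:)
qed auto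

end

section \<open>Partitions\<close>

text \<open>Additivity and nonnegativity give monotonicity. Enclosing \<open>real n * t\<close>
  between consecutive integers then bounds \<open>real n * \<bar>f t - f 1 * t\<bar>\<close> by
  \<open>f 1\<close> for every \<open>n\<close>.\<close>

lemma additive_nonneg_imp_linear:
  fixes f :: "real \<Rightarrow> real"
  assumes add: "\<And>s t. s \<ge> 0 \<Longrightarrow> t \<ge> 0 \<Longrightarrow> f (s + t) = f s + f t"
    and nonneg: "\<And>t. t \<ge> 0 \<Longrightarrow> f t \<ge> 0" and t: "t \<ge> 0"
  shows "f t = f 1 * t"
proof -
  have mult: "f (real n * x) = real n * f x" if "x \<ge> 0" for n x
  proof (induction n)
    case 0
    then show ?case using add[of 0 0] by simp
  next
    case (Suc n)
    then show ?case using add[of "real n * x" x] that by (simp add: algebra_simps)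
  qed
  have mono: "f x \<le> f y" if "0 \<le> x" "x \<le> y" for x y
    using add[of x "y - x"] nonneg[of "y - x"] that by simp
  have "real n * \<bar>f t - f 1 * t\<bar> \<le> f 1" for n
  proof -
    define k where "k = nat \<lfloor>real n * t\<rfloor>"
    have k: "real k \<le> real n * t" "real n * t \<le> real (Suc k)"
    proof -
      have "real k = real_of_int \<lfloor>real n * t\<rfloor>" using t by (simp add: k_def)
      then show "real k \<le> real n * t" "real n * t \<le> real (Suc k)"
        using floor_correct[of "real n * t"] by linarith+
    qed
    have k': "real k * f 1 \<le> real n * f t" "real n * f t \<le> real (Suc k) * f 1"
      using mono[of "real k" "real n * t"] mono[of "real n * t" "real (Suc k)"] k t
        mult[of 1 k] mult[of 1 "Suc k"] mult[of t n] by auto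
    have "f 1 * real k \<le> f 1 * (real n * t)" "f 1 * (real n * t) \<le> f 1 * real (Suc k)"
      using k nonneg[of 1] by (auto intro: mult_left_mono)
    with k' have "\<bar>real n * f t - f 1 * (real n * t)\<bar> \<le> f 1"
      by (simp add: abs_le_iff algebra_simps)
    moreover have "real n * f t - f 1 * (real n * t) = real n * (f t - f 1 * t)"
      by (simp add: algebra_simps)
    ultimately show ?thesis by (simp add: abs_mult)
  qed
  then have "\<not> \<bar>f t - f 1 * t\<bar> > 0"
    using reals_Archimedean3[of "\<bar>f t - f 1 * t\<bar>"] by (metis linorder_not_le)
  then show ?thesis by simp
qed

text \<open>Multiplying \<open>1 - x \<le> exp (- x)\<close> by \<open>1 + x\<close> bounds
  \<open>1 - (1 + x) * exp (- x)\<close> by the square of \<open>x\<close>. This second-order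
  remainder is the defect of a single block in both constructions below.\<close>

lemma exp_remainder_le:
  fixes x :: real
  assumes "x \<ge> 0"
  shows "exp x - 1 - x \<le> x\<^sup>2 * exp x"
proof -
  have "(1 + x) * (1 - x) \<le> (1 + x) * exp (- x)"
    using assms exp_ge_add_one_self[of "- x"] by (intro mult_left_mono) auto
  then have "(1 - (1 + x) * exp (- x)) * exp x \<le> x\<^sup>2 * exp x"
    by (intro mult_right_mono) (auto simp: power2_eq_square algebra_simps)
  then show ?thesis by (simp add: algebra_simps exp_minus)
qed

definition pos_list :: "real list \<Rightarrow> bool" where
  "pos_list P \<longleftrightarrow> (\<forall>a\<in>set P. 0 < a)"

lemma pos_list_simps [simp]: "pos_list []" "pos_list (a # P) \<longleftrightarrow> 0 < a \<and> pos_list P"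
  "pos_list (P @ Q) \<longleftrightarrow> pos_list P \<and> pos_list Q"
  "pos_list (replicate n a) \<longleftrightarrow> n = 0 \<or> 0 < a"
  by (auto simp: pos_list_def)

lemma pos_list_sum_nonneg: "pos_list P \<Longrightarrow> sum_list P \<ge> 0"
  by (induction P) auto

text \<open>The measure of fineness: orthogonal errors of the pieces contribute their squares, so
  the error bounds for partitions are multiples of this sum.\<close>

definition sumsq :: "real list \<Rightarrow> real" where
  "sumsq P = (\<Sum>a\<leftarrow>P. a\<^sup>2)"

lemma sumsq_simps [simp]: "sumsq [] = 0" "sumsq (a # P) = a\<^sup>2 + sumsq P"
  "sumsq (P @ Q) = sumsq P + sumsq Q" "sumsq (replicate n a) = real n * a\<^sup>2"
  by (auto simp: sumsq_def sum_list_replicate)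

lemma sumsq_nonneg: "sumsq P \<ge> 0"
  by (auto simp: sumsq_def intro!: sum_list_nonneg)

text \<open>A partition of an interval is the list of the lengths of its pieces; \<open>concat QQ\<close> refines
  \<open>map sum_list QQ\<close>.\<close>

lemma common_refinement:
  assumes "pos_list P" "pos_list P'" "sum_list P = sum_list P'"
  shows "\<exists>QQ QQ'. P = map sum_list QQ \<and> P' = map sum_list QQ' \<and> concat QQ = concat QQ' \<and>
    (\<forall>q\<in>set QQ. pos_list q) \<and> (\<forall>q\<in>set QQ'. pos_list q)"
  using assms
proof (induction "length P + length P'" arbitrary: P P' rule: less_induct)
  case less
  show ?case
  proof (cases P)
    case Nil
    then have "P' = []"
      using less.prems pos_list_sum_nonneg by (cases P') (auto, smt (verit) pos_list_sum_nonneg)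
    then show ?thesis using Nil by auto
  next
    case P: (Cons a R)
    have "P' \<noteq> []"
      using less.prems P pos_list_sum_nonneg[of R] by auto
    then obtain a' R' where P': "P' = a' # R'" by (cases P') auto
    \<comment> \<open>If the first pieces differ, the longer one is cut at the end of the shorter
      one and its rest is put back. The total number of pieces still drops, and the part cut off is
      prepended to the block that refines the rest.\<close>
    consider "a = a'" | "a < a'" | "a' < a" by linarith
    then show ?thesis
    proof cases
      case 1
      then have "\<exists>QQ QQ'. R = map sum_list QQ \<and> R' = map sum_list QQ' \<and> concat QQ = concat QQ' \<and>
          (\<forall>q\<in>set QQ. pos_list q) \<and> (\<forall>q\<in>set QQ'. pos_list q)"
        using less.prems by (intro less.hyps) (simp_all add: P P')
      then obtain QQ QQ' where *: "R = map sum_list QQ" "R' = map sum_list QQ'"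
        "concat QQ = concat QQ'" "\<forall>q\<in>set QQ. pos_list q" "\<forall>q\<in>set QQ'. pos_list q"
        by (elim exE conjE) (rule that)
      then show ?thesis
        using less.prems 1 * by (intro exI[of _ "[a] # QQ"] exI[of _ "[a] # QQ'"]) (auto simp: P P')
    next
      case 2
      then have "\<exists>QQ QQ'. R = map sum_list QQ \<and> (a' - a) # R' = map sum_list QQ' \<and> concat QQ = concat QQ' \<and>
          (\<forall>q\<in>set QQ. pos_list q) \<and> (\<forall>q\<in>set QQ'. pos_list q)"
        using less.prems by (intro less.hyps) (simp_all add: P P')
      then obtain QQ QQ' where *: "R = map sum_list QQ" "(a' - a) # R' = map sum_list QQ'"
        "concat QQ = concat QQ'" "\<forall>q\<in>set QQ. pos_list q" "\<forall>q\<in>set QQ'. pos_list q"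
        by (elim exE conjE) (rule that)
      then obtain q qs where "QQ' = q # qs" by auto
      then show ?thesis
        using less.prems 2 * by (intro exI[of _ "[a] # QQ"] exI[of _ "(a # q) # qs"]) (auto simp: P P')
    next
      case 3
      then have "\<exists>QQ QQ'. (a - a') # R = map sum_list QQ \<and> R' = map sum_list QQ' \<and> concat QQ = concat QQ' \<and>
          (\<forall>q\<in>set QQ. pos_list q) \<and> (\<forall>q\<in>set QQ'. pos_list q)"
        using less.prems by (intro less.hyps) (simp_all add: P P')
      then obtain QQ QQ' where *: "(a - a') # R = map sum_list QQ" "R' = map sum_list QQ'"
        "concat QQ = concat QQ'" "\<forall>q\<in>set QQ. pos_list q" "\<forall>q\<in>set QQ'. pos_list q"
        by (elim exE conjE) (rule that)
      then obtain q qs where "QQ = q # qs" by auto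
      then show ?thesis
        using less.prems 3 * by (intro exI[of _ "(a' # q) # qs"] exI[of _ "[a'] # QQ'"]) (auto simp: P P')
    qed
  qed
qed

lemma sum_list_concat: "sum_list (concat QQ) = sum_list (map sum_list QQ)"
  by (induction QQ) auto

lemma pos_list_concat: "(\<And>q. q \<in> set QQ \<Longrightarrow> pos_list q) \<Longrightarrow> pos_list (concat QQ)"
  by (auto simp: pos_list_def)

abbreviation dyadic :: "real \<Rightarrow> nat \<Rightarrow> real list" where
  "dyadic t n \<equiv> replicate (2 ^ n) (t / 2 ^ n)"

lemma sumsq_dyadic: "sumsq (dyadic t n) = t\<^sup>2 * (1/2) ^ n"
  by (simp add: power_divide power2_eq_square)

lemma sum_list_dyadic: "sum_list (dyadic t n) = t"
  by (simp add: sum_list_replicate)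

lemma sumsq_dyadic_tendsto: "(\<lambda>n. sumsq (dyadic t n)) \<longlonglongrightarrow> 0"
proof -
  have "(\<lambda>n. t\<^sup>2 * (1/2) ^ n) \<longlonglongrightarrow> t\<^sup>2 * 0"
    by (intro tendsto_intros LIMSEQ_power_zero) auto
  then show ?thesis by (simp only: sumsq_dyadic mult_zero_right)
qed

context spatial_system
begin

text \<open>Two partitions of the same interval are compared through a common refinement, which
  makes \<open>V\<close> Cauchy as \<open>sumsq\<close> tends to 0. Dyadic partitions merely select
  the limit; the estimate for an arbitrary \<open>P\<close> follows by letting the dyadic partition
  alone vary.\<close>

lemma partition_limit:
  assumes K: "\<And>t. K t \<ge> 0"
    and V_in: "\<And>P. pos_list P \<Longrightarrow> V P \<in> H (sum_list P)"
    and refine: "\<And>QQ. (\<And>q. q \<in> set QQ \<Longrightarrow> pos_list q) \<Longrightarrow>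
      (norm (V (concat QQ) - V (map sum_list QQ)))\<^sup>2 \<le> K (sum_list (concat QQ)) * sumsq (map sum_list QQ)"
  obtains W where "\<And>t. t \<ge> 0 \<Longrightarrow> W t \<in> H t"
    "\<And>P. pos_list P \<Longrightarrow> (norm (W (sum_list P) - V P))\<^sup>2 \<le> K (sum_list P) * sumsq P"
proof -
  define D where "D P = sqrt (K (sum_list P) * sumsq P)" for P
  have D_nonneg: "D P \<ge> 0" for P unfolding D_def using K sumsq_nonneg by simp
  have dist: "norm (V P - V P') \<le> D P + D P'"
    if P: "pos_list P" "pos_list P'" "sum_list P = sum_list P'" for P P'
  proof -
    obtain QQ QQ' where Q: "P = map sum_list QQ" "P' = map sum_list QQ'" "concat QQ = concat QQ'"
      "\<forall>q\<in>set QQ. pos_list q" "\<forall>q\<in>set QQ'. pos_list q"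
      using common_refinement[OF P] by blast
    have 1: "norm (V (concat QQ) - V P) \<le> D P"
      using refine[of QQ] Q(4) unfolding D_def Q(1) by (intro real_le_rsqrt) (simp add: sum_list_concat)
    have 2: "norm (V (concat QQ) - V P') \<le> D P'"
      using refine[of QQ'] Q(5) unfolding D_def Q(2,3) by (intro real_le_rsqrt) (simp add: sum_list_concat)
    show ?thesis
      using norm_triangle_ineq4[of "V (concat QQ) - V P'" "V (concat QQ) - V P"] 1 2
      by (simp add: norm_minus_commute)
  qed
  have D_lim: "(\<lambda>n. D (dyadic t n)) \<longlonglongrightarrow> 0" for t
  proof -
    have "(\<lambda>n. sqrt (K t * sumsq (dyadic t n))) \<longlonglongrightarrow> sqrt (K t * 0)"
      by (intro tendsto_intros sumsq_dyadic_tendsto)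
    then show ?thesis by (simp only: D_def sum_list_dyadic mult_zero_right real_sqrt_zero)
  qed
  have conv: "convergent (\<lambda>n. V (dyadic t n))" if "t > 0" for t
  proof (rule Cauchy_convergent, rule CauchyI)
    fix e :: real assume "e > 0"
    then obtain N where N: "\<And>n. n \<ge> N \<Longrightarrow> norm (D (dyadic t n) - 0) < e / 2"
      using LIMSEQ_D[OF D_lim, of "e / 2"] by (meson half_gt_zero)
    have "norm (V (dyadic t k) - V (dyadic t l)) < e" if "k \<ge> N" "l \<ge> N" for k l
    proof -
      have "norm (V (dyadic t k) - V (dyadic t l)) \<le> D (dyadic t k) + D (dyadic t l)"
        using \<open>t > 0\<close> by (intro dist) (simp_all add: sum_list_dyadic del: replicate.simps)
      also have "\<dots> < e" using N[OF that(1)] N[OF that(2)] by simp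
      finally show ?thesis .
    qed
    then show "\<exists>N. \<forall>k\<ge>N. \<forall>l\<ge>N. norm (V (dyadic t k) - V (dyadic t l)) < e" by blast
  qed
  \<comment> \<open>The pieces of \<open>dyadic 0 n\<close> are zero, so it is not an admissible
    partition; at time 0 the empty partition is used instead.\<close>
  define W where "W t = (if t = 0 then V [] else lim (\<lambda>n. V (dyadic t n)))" for t
  have W_lim: "(\<lambda>n. V (dyadic t n)) \<longlonglongrightarrow> W t" if "t > 0" for t
    using conv[OF that] that by (simp add: W_def convergent_LIMSEQ_iff)
  show thesis
  proof (rule that)
    fix t :: real assume t: "t \<ge> 0"
    show "W t \<in> H t"
    proof (cases "t = 0")
      case True
      then show ?thesis using V_in[of "[]"] by (simp add: W_def)
    next
      case False
      then have "V (dyadic t n) \<in> H t" for n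
        using V_in[of "dyadic t n"] t by (simp add: sum_list_dyadic)
      then show ?thesis using H_closed[OF _ _ W_lim] t False by force
    qed
  next
    fix P assume P: "pos_list P"
    show "(norm (W (sum_list P) - V P))\<^sup>2 \<le> K (sum_list P) * sumsq P"
    proof (cases P)
      case Nil
      then show ?thesis by (simp add: W_def)
    next
      case (Cons a R)
      define t where "t = sum_list P"
      have t: "t > 0" using P pos_list_sum_nonneg[of R] by (simp add: Cons t_def)
      have "norm (W t - V P) \<le> 0 + D P"
      proof (rule LIMSEQ_le)
        show "(\<lambda>n. norm (V (dyadic t n) - V P)) \<longlonglongrightarrow> norm (W t - V P)"
          by (intro tendsto_intros W_lim t)
        show "(\<lambda>n. D (dyadic t n) + D P) \<longlonglongrightarrow> 0 + D P"
          by (intro tendsto_intros D_lim)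
        show "\<exists>N. \<forall>n\<ge>N. norm (V (dyadic t n) - V P) \<le> D (dyadic t n) + D P"
          using t P by (intro exI allI impI dist) (simp_all add: sum_list_dyadic t_def[symmetric])
      qed
      then have "(norm (W t - V P))\<^sup>2 \<le> (D P)\<^sup>2"
        by (intro power_mono) auto
      also have "(D P)\<^sup>2 = K t * sumsq P" using K sumsq_nonneg by (simp add: D_def t_def)
      finally show ?thesis by (simp add: t_def)
    qed
  qed
qed

lemma partition_limit_tendsto:
  assumes "\<And>P. pos_list P \<Longrightarrow> (norm (W (sum_list P) - V P))\<^sup>2 \<le> K (sum_list P) * sumsq P"
    and P: "\<And>n::nat. pos_list (P n)" "\<And>n. sum_list (P n) = t" "(\<lambda>n. sumsq (P n)) \<longlonglongrightarrow> 0"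
  shows "(\<lambda>n. V (P n) :: 'a) \<longlonglongrightarrow> W t"
proof -
  have le: "norm (V (P n) - W t) \<le> sqrt (K t * sumsq (P n))" for n
    using assms(1)[OF P(1)[of n]] P(2)[of n] by (intro real_le_rsqrt) (simp add: norm_minus_commute)
  have "(\<lambda>n. sqrt (K t * sumsq (P n))) \<longlonglongrightarrow> sqrt (K t * 0)"
    by (intro tendsto_intros P(3))
  then have "(\<lambda>n. sqrt (K t * sumsq (P n))) \<longlonglongrightarrow> 0" by simp
  with always_eventually[OF allI[OF le]] have "(\<lambda>n. V (P n) - W t) \<longlonglongrightarrow> 0"
    by (rule Lim_null_comparison)
  then show ?thesis using LIM_zero_iff by blast
qed

section \<open>Construction of the associated units and addits\<close>

lemma exponential_unitD:
  assumes "u \<in> exponential_units S Om"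
  shows "t \<ge> 0 \<Longrightarrow> u t \<in> H t"
    "s \<ge> 0 \<Longrightarrow> t \<ge> 0 \<Longrightarrow> m s t (u s) (u t) = u (s + t)"
    "t \<ge> 0 \<Longrightarrow> cinner (u t) (Om t) = 1"
    "(\<lambda>t. (t, u t)) \<in> restrict_space borel {0<..} \<rightarrow>\<^sub>M total S"
    "u \<in> extensional {0..}"
  using assms unfolding exponential_units_def units_def measurable_sections_def
  by (auto simp: PiE_def)

lemma exponential_unitI:
  assumes "\<And>t. t \<ge> 0 \<Longrightarrow> u t \<in> H t" "u \<in> extensional {0..}"
    "(\<lambda>t. (t, u t)) \<in> restrict_space borel {0<..} \<rightarrow>\<^sub>M total S"
    "\<And>s t. s \<ge> 0 \<Longrightarrow> t \<ge> 0 \<Longrightarrow> m s t (u s) (u t) = u (s + t)"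
    "\<And>t. t \<ge> 0 \<Longrightarrow> cinner (u t) (Om t) = 1"
  shows "u \<in> exponential_units S Om"
  using assms unfolding exponential_units_def units_def measurable_sections_def
  by (simp add: PiE_def Pi_def)

lemma exponential_unit_0:
  assumes "u \<in> exponential_units S Om"
  shows "u 0 = Om 0"
  using H0_expand[of "u 0"] exponential_unitD(1,3)[OF assms, of 0] by simp

lemma centred_additD:
  assumes "b \<in> centred_addits S Om"
  shows "t \<ge> 0 \<Longrightarrow> b t \<in> H t"
    "s \<ge> 0 \<Longrightarrow> t \<ge> 0 \<Longrightarrow> b (s + t) = m s t (b s) (Om t) + m s t (Om s) (b t)"
    "t \<ge> 0 \<Longrightarrow> cinner (Om t) (b t) = 0" "t \<ge> 0 \<Longrightarrow> cinner (b t) (Om t) = 0"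
    "(\<lambda>t. (t, b t)) \<in> restrict_space borel {0<..} \<rightarrow>\<^sub>M total S"
    "b \<in> extensional {0..}"
proof -
  show "t \<ge> 0 \<Longrightarrow> cinner (Om t) (b t) = 0"
    using assms unfolding centred_addits_def by simp
  then show "t \<ge> 0 \<Longrightarrow> cinner (b t) (Om t) = 0"
    using cinner_commute[of "b t" "Om t"] by simp
qed (use assms in \<open>auto simp: centred_addits_def addits_def measurable_sections_def PiE_def\<close>)

lemma centred_additI:
  assumes "\<And>t. t \<ge> 0 \<Longrightarrow> b t \<in> H t" "b \<in> extensional {0..}"
    "(\<lambda>t. (t, b t)) \<in> restrict_space borel {0<..} \<rightarrow>\<^sub>M total S"
    "\<And>s t. s \<ge> 0 \<Longrightarrow> t \<ge> 0 \<Longrightarrow> b (s + t) = m s t (b s) (Om t) + m s t (Om s) (b t)"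
    "\<And>t. t \<ge> 0 \<Longrightarrow> cinner (b t) (Om t) = 0"
  shows "b \<in> centred_addits S Om"
proof -
  have "cinner (Om t) (b t) = 0" if "t \<ge> 0" for t
    using assms(5)[OF that] cinner_commute[of "Om t" "b t"] by simp
  then show ?thesis
    using assms unfolding centred_addits_def addits_def measurable_sections_def
    by (simp add: PiE_def Pi_def)
qed

lemma centred_addit_0:
  assumes "b \<in> centred_addits S Om"
  shows "b 0 = 0"
  using centred_additD(2)[OF assms, of 0 0] centred_additD(1)[OF assms, of 0] by simp

text \<open>The two summands of \<open>b (s + t)\<close> are orthogonal because \<open>b\<close> is
  centred, so the squared norm is additive in time.\<close>

lemma norm_centred_addit:
  assumes b: "b \<in> centred_addits S Om" and t: "t \<ge> 0"
  shows "(norm (b t))\<^sup>2 = (norm (b 1))\<^sup>2 * t"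
proof -
  note b' = centred_additD[OF b]
  have add: "(norm (b (s + t)))\<^sup>2 = (norm (b s))\<^sup>2 + (norm (b t))\<^sup>2" if "s \<ge> 0" "t \<ge> 0" for s t
    using that b' norm_add_orthogonal[of "m s t (b s) (Om t)" "m s t (Om s) (b t)"]
    by (simp add: cinner_m Om_in norm_m norm_Om)
  show ?thesis
    by (rule additive_nonneg_imp_linear[of "\<lambda>t. (norm (b t))\<^sup>2", OF add _ t]) simp_all
qed

lemma norm_exponential_unit_minus:
  assumes u: "u \<in> exponential_units S Om" and t: "t \<ge> 0"
  shows "(norm (u t))\<^sup>2 = 1 + (norm (u t - Om t))\<^sup>2"
  using exponential_unitD(3)[OF u t] by (simp add: norm_diff_power2 norm_Om[OF t])

text \<open>Norms multiply, and the component along \<open>Om\<close> has norm 1, so the logarithm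
  of the squared norm is additive and nonnegative, hence linear.\<close>

lemma norm_exponential_unit:
  assumes u: "u \<in> exponential_units S Om"
  obtains \<gamma> where "\<gamma> \<ge> 0" "\<And>t. t \<ge> 0 \<Longrightarrow> (norm (u t))\<^sup>2 = exp (\<gamma> * t)"
proof -
  note u' = exponential_unitD[OF u]
  define f where "f t = ln ((norm (u t))\<^sup>2)" for t
  have ge1: "(norm (u t))\<^sup>2 \<ge> 1" if "t \<ge> 0" for t
    using norm_exponential_unit_minus[OF u that] by simp
  have add: "f (s + t) = f s + f t" if "s \<ge> 0" "t \<ge> 0" for s t
  proof -
    have "(norm (u (s + t)))\<^sup>2 = (norm (u s))\<^sup>2 * (norm (u t))\<^sup>2"
      using u' that by (metis norm_m power_mult_distrib)
    moreover have "(norm (u s))\<^sup>2 > 0" "(norm (u t))\<^sup>2 > 0"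
      using ge1 that by (meson less_le_trans zero_less_one)+
    ultimately show ?thesis by (simp only: f_def ln_mult_pos)
  qed
  have nonneg: "f t \<ge> 0" if "t \<ge> 0" for t using ge1[OF that] by (simp add: f_def)
  show thesis
  proof (rule that[of "f 1"])
    show "f 1 \<ge> 0" using nonneg by simp
    fix t :: real assume t: "t \<ge> 0"
    have "f t = f 1 * t" by (rule additive_nonneg_imp_linear) (use add nonneg t in auto)
    moreover have "exp (f t) = (norm (u t))\<^sup>2"
      unfolding f_def by (rule exp_ln) (use ge1[OF t] in linarith)
    ultimately show "(norm (u t))\<^sup>2 = exp (f 1 * t)" by simp
  qed
qed

lemma tendsto_cinner_left:
  assumes "x \<longlonglongrightarrow> (x' :: 'a)"
  shows "(\<lambda>n. cinner (x n) y) \<longlonglongrightarrow> cinner x' y"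
  unfolding cinner_conv_inner tendsto_complex_iff by (simp add: assms tendsto_intros)

section \<open>Riemann products and Riemann sums over partitions\<close>

primrec partition_prod :: "(real \<Rightarrow> 'a) \<Rightarrow> real list \<Rightarrow> 'a" where
  "partition_prod v [] = Om 0"
| "partition_prod v (a # P) = m a (sum_list P) (v a) (partition_prod v P)"

primrec partition_sum :: "(real \<Rightarrow> 'a) \<Rightarrow> real list \<Rightarrow> 'a" where
  "partition_sum \<beta> [] = 0"
| "partition_sum \<beta> (a # P) = m a (sum_list P) (\<beta> a) (Om (sum_list P)) + m a (sum_list P) (Om a) (partition_sum \<beta> P)"

lemma partition_prod_in:
  assumes "\<And>t. t \<ge> 0 \<Longrightarrow> v t \<in> H t" "pos_list P"
  shows "partition_prod v P \<in> H (sum_list P)"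
  using assms(2) by (induction P) (auto simp: Om_in assms(1) m_in pos_list_sum_nonneg)

lemma partition_sum_in:
  assumes "\<And>t. t \<ge> 0 \<Longrightarrow> \<beta> t \<in> H t" "pos_list P"
  shows "partition_sum \<beta> P \<in> H (sum_list P)"
  using assms(2) by (induction P) (auto simp: Om_in H_zero assms(1) m_in pos_list_sum_nonneg H_add)

text \<open>Concatenation of partitions becomes multiplication; in the limit this is the equation of
  a unit.\<close>

lemma partition_prod_append:
  assumes "\<And>t. t \<ge> 0 \<Longrightarrow> v t \<in> H t" "pos_list P" "pos_list Q"
  shows "partition_prod v (P @ Q) = m (sum_list P) (sum_list Q) (partition_prod v P) (partition_prod v Q)"
  using assms(2)
  by (induction P) (auto simp: assms partition_prod_in pos_list_sum_nonneg m_assoc)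

text \<open>In the limit this becomes the equation of an addit.\<close>

lemma partition_sum_append:
  assumes \<beta>: "\<And>t. t \<ge> 0 \<Longrightarrow> \<beta> t \<in> H t" and "pos_list P" and Q: "pos_list Q"
  shows "partition_sum \<beta> (P @ Q) = m (sum_list P) (sum_list Q) (partition_sum \<beta> P) (Om (sum_list Q)) +
    m (sum_list P) (sum_list Q) (Om (sum_list P)) (partition_sum \<beta> Q)"
  using assms(2)
proof (induction P)
  case Nil
  then show ?case using Q \<beta> by (simp add: partition_sum_in m_zero_left Om_in pos_list_sum_nonneg)
next
  case (Cons a P)
  define p where "p = sum_list P"
  define q where "q = sum_list Q"
  have a: "a \<ge> 0" "p \<ge> 0" "q \<ge> 0" and P: "pos_list P"
    using Cons.prems Q by (auto simp: p_def q_def pos_list_sum_nonneg)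
  have IH: "partition_sum \<beta> (P @ Q) = m p q (partition_sum \<beta> P) (Om q) + m p q (Om p) (partition_sum \<beta> Q)"
    using Cons.IH P by (simp add: p_def q_def)
  have in': "partition_sum \<beta> P \<in> H p" "partition_sum \<beta> Q \<in> H q"
    using partition_sum_in[OF \<beta>] P Q by (auto simp: p_def q_def)
  have "partition_sum \<beta> ((a # P) @ Q) = m a (p + q) (\<beta> a) (m p q (Om p) (Om q)) +
      m a (p + q) (Om a) (m p q (partition_sum \<beta> P) (Om q)) + m a (p + q) (Om a) (m p q (Om p) (partition_sum \<beta> Q))"
    using a in' by (simp add: p_def[symmetric] q_def[symmetric] IH m_Om m_add_right m_in Om_in)
  also have "\<dots> = m (a + p) q (m a p (\<beta> a) (Om p)) (Om q) + m (a + p) q (m a p (Om a) (partition_sum \<beta> P)) (Om q)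
      + m (a + p) q (m a p (Om a) (Om p)) (partition_sum \<beta> Q)"
    using a in' \<beta> by (simp only: m_assoc Om_in)
  also have "\<dots> = m (a + p) q (partition_sum \<beta> (a # P)) (Om q) + m (a + p) q (Om (a + p)) (partition_sum \<beta> Q)"
    using a in' \<beta> by (simp add: p_def[symmetric] m_add_left m_in Om_in m_Om)
  finally show ?case by (simp add: p_def q_def)
qed

lemma measurable_section_rescale:
  assumes v: "(\<lambda>t. (t, v t)) \<in> restrict_space borel {0<..} \<rightarrow>\<^sub>M total S" and "r > 0"
  shows "(\<lambda>t. (t * r, v (t * r))) \<in> restrict_space borel {0<..} \<rightarrow>\<^sub>M total S"
proof -
  have "(\<lambda>t. t * r) \<in> restrict_space borel {0<..} \<rightarrow>\<^sub>M restrict_space borel {0<..}"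
    using assms(2) by (intro measurable_restrict_space2 measurable_restrict_space1)
      (auto simp: space_restrict_space)
  from measurable_compose[OF this v] show ?thesis by simp
qed

text \<open>The count \<open>Suc k\<close> avoids the empty product, which sits at time 0, outside
  \<open>total S\<close>. The time is kept as a multiple of \<open>t * r\<close>, so that each step
  of the recursion is one application of the Borel multiplication.\<close>

lemma measurable_partition_prod:
  assumes v: "(\<lambda>t. (t, v t)) \<in> restrict_space borel {0<..} \<rightarrow>\<^sub>M total S" and "r > 0"
  shows "(\<lambda>t. (real (Suc k) * (t * r), partition_prod v (replicate (Suc k) (t * r))))
    \<in> restrict_space borel {0<..} \<rightarrow>\<^sub>M total S"
proof (induction k)
  case 0
  have "v t \<in> H t" if "t > 0" for t
    using measurable_space[OF v, of t] that by (simp add: total_iff space_restrict_space)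
  then have "partition_prod v (replicate (Suc 0) (t * r)) = v (t * r)" if "t > 0" for t
    using that assms(2) by simp
  then show ?case
    using measurable_section_rescale[OF assms]
    by (subst measurable_cong[of _ _ "\<lambda>t. (t * r, v (t * r))"]) (auto simp: space_restrict_space)
next
  case (Suc k)
  have eq: "real (Suc (Suc k)) * (t * r) = t * r + real (Suc k) * (t * r)" for t
    by (simp add: algebra_simps)
  have "partition_prod v (replicate (Suc (Suc k)) (t * r)) =
      m (t * r) (real (Suc k) * (t * r)) (v (t * r)) (partition_prod v (replicate (Suc k) (t * r)))" for t
    by (subst replicate_Suc, subst partition_prod.simps(2), subst sum_list_replicate) simp
  then show ?case
    unfolding eq using measurable_section_m[OF measurable_section_rescale[OF assms] Suc.IH] by simp
qed

lemma measurable_partition_sum: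
  assumes v: "(\<lambda>t. (t, v t)) \<in> restrict_space borel {0<..} \<rightarrow>\<^sub>M total S" and "r > 0"
  shows "(\<lambda>t. (real (Suc k) * (t * r), partition_sum v (replicate (Suc k) (t * r))))
    \<in> restrict_space borel {0<..} \<rightarrow>\<^sub>M total S"
proof (induction k)
  case 0
  have "v t \<in> H t" if "t > 0" for t
    using measurable_space[OF v, of t] that by (simp add: total_iff space_restrict_space)
  then have "partition_sum v (replicate (Suc 0) (t * r)) = v (t * r)" if "t > 0" for t
    using that assms(2) by (simp add: m_zero_right Om_in)
  then show ?case
    using measurable_section_rescale[OF assms]
    by (subst measurable_cong[of _ _ "\<lambda>t. (t * r, v (t * r))"]) (auto simp: space_restrict_space)
next
  case (Suc k)
  have Om': "(\<lambda>t. (t, Om t)) \<in> restrict_space borel {0<..} \<rightarrow>\<^sub>M total S"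
    using Om_units unfolding units_def measurable_sections_def by blast
  have eq: "real (Suc (Suc k)) * (t * r) = t * r + real (Suc k) * (t * r)" for t
    by (simp add: algebra_simps)
  have Om_k: "(\<lambda>t. (real (Suc k) * (t * r), Om (real (Suc k) * (t * r)))) \<in> restrict_space borel {0<..} \<rightarrow>\<^sub>M total S"
    using measurable_section_rescale[OF Om', of "real (Suc k) * r"] assms(2)
    by (simp add: mult_ac)
  have "partition_sum v (replicate (Suc (Suc k)) (t * r)) =
      m (t * r) (real (Suc k) * (t * r)) (v (t * r)) (Om (real (Suc k) * (t * r))) +
      m (t * r) (real (Suc k) * (t * r)) (Om (t * r)) (partition_sum v (replicate (Suc k) (t * r)))" for t
    by (subst replicate_Suc, subst partition_sum.simps(2), subst (1 2 3) sum_list_replicate) simp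
  then show ?case
    unfolding eq
    using measurable_section_add[OF measurable_section_m[OF measurable_section_rescale[OF assms] Om_k]
      measurable_section_m[OF measurable_section_rescale[OF Om' assms(2)] Suc.IH]] by simp
qed

lemma measurable_dyadic:
  assumes v: "(\<lambda>t. (t, v t)) \<in> restrict_space borel {0<..} \<rightarrow>\<^sub>M total S"
  shows "(\<lambda>t. (t, partition_prod v (dyadic t n))) \<in> restrict_space borel {0<..} \<rightarrow>\<^sub>M total S"
    "(\<lambda>t. (t, partition_sum v (dyadic t n))) \<in> restrict_space borel {0<..} \<rightarrow>\<^sub>M total S"
proof -
  obtain k where k: "2 ^ n = Suc k" using not0_implies_Suc[of "2 ^ n"] by auto
  then have eq: "real (Suc k) * (t * (1 / real (Suc k))) = t" for t by simp
  have "t / 2 ^ n = t * (1 / real (Suc k))" for t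
    using arg_cong[OF k, of real] by simp
  then have d: "dyadic t n = replicate (Suc k) (t * (1 / real (Suc k)))" for t
    using k by metis
  show "(\<lambda>t. (t, partition_prod v (dyadic t n))) \<in> restrict_space borel {0<..} \<rightarrow>\<^sub>M total S"
    "(\<lambda>t. (t, partition_sum v (dyadic t n))) \<in> restrict_space borel {0<..} \<rightarrow>\<^sub>M total S"
    unfolding d using measurable_partition_prod[OF v, of "1 / real (Suc k)" k]
      measurable_partition_sum[OF v, of "1 / real (Suc k)" k] unfolding eq by simp_all
qed

definition associated :: "(real \<Rightarrow> 'a) \<Rightarrow> (real \<Rightarrow> 'a) \<Rightarrow> bool" where
  "associated u b \<longleftrightarrow> (\<exists>C. \<forall>t\<in>{0..1}. (norm (u t - Om t - b t))\<^sup>2 \<le> C * t\<^sup>2)"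

text \<open>Against \<open>Om a\<close> and \<open>b a\<close> the product over a block has the same
  inner products as the single factor \<open>v a\<close>. Hence it differs from \<open>v a\<close>
  by a vector orthogonal to \<open>v a\<close>, and the squared distance is the difference of the
  squared norms, at most \<open>exp (c * a) - 1 - c * a\<close>.\<close>

lemma partition_prod_block:
  assumes b: "b \<in> centred_addits S Om" and q: "pos_list q"
  defines "v \<equiv> \<lambda>t. Om t + b t" and "c \<equiv> (norm (b 1))\<^sup>2" and "a \<equiv> sum_list q"
  shows "cinner (partition_prod v q) (Om a) = 1" "cinner (partition_prod v q) (b a) = of_real (c * a)"
    "(norm (partition_prod v q))\<^sup>2 \<le> exp (c * a)" "cinner (partition_prod v q - v a) (v a) = 0"
    "(norm (partition_prod v q - v a))\<^sup>2 \<le> c\<^sup>2 * a\<^sup>2 * exp (c * a)"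
    "(norm (v a))\<^sup>2 \<le> exp (c * a)"
proof -
  note b' = centred_additD[OF b]
  have v_in: "v t \<in> H t" if "t \<ge> 0" for t
    using that b'(1) by (simp add: v_def Om_in H_add)
  have v_Om: "cinner (v t) (Om t) = 1" if "t \<ge> 0" for t
    using b'(4)[OF that] by (simp add: v_def cinner_add_left cinner_Om[OF that])
  have v_b: "cinner (v t) (b t) = of_real (c * t)" if "t \<ge> 0" for t
    using b'(3)[OF that] unfolding c_def norm_centred_addit[OF b that, symmetric]
    by (simp add: v_def cinner_add_left cinner_self)
  have v_norm: "(norm (v t))\<^sup>2 = 1 + c * t" if "t \<ge> 0" for t
    using norm_add_orthogonal[OF b'(3)[OF that]] norm_centred_addit[OF b that]
    by (simp add: v_def norm_Om that c_def)
  have "cinner (partition_prod v q) (Om (sum_list q)) = 1 \<and> cinner (partition_prod v q) (b (sum_list q)) = of_real (c * sum_list q)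
    \<and> (norm (partition_prod v q))\<^sup>2 \<le> exp (c * sum_list q)"
    using q
  proof (induction q)
    case Nil
    then show ?case by (simp add: cinner_Om norm_Om centred_addit_0[OF b])
  next
    case (Cons x q)
    define p where "p = sum_list q"
    have x: "x \<ge> 0" "p \<ge> 0" and q: "pos_list q"
      using Cons.prems by (auto simp: p_def pos_list_sum_nonneg)
    have in': "partition_prod v q \<in> H p" "b x \<in> H x" "b p \<in> H p" "v x \<in> H x" "Om x \<in> H x" "Om p \<in> H p"
      using partition_prod_in[OF v_in q] b' x v_in by (auto simp: p_def Om_in)
    have IH: "cinner (partition_prod v q) (Om p) = 1" "cinner (partition_prod v q) (b p) = of_real (c * p)"
      "(norm (partition_prod v q))\<^sup>2 \<le> exp (c * p)"
      using Cons.IH[OF q] by (auto simp: p_def)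
    have "(norm (m x p (v x) (partition_prod v q)))\<^sup>2 = (1 + c * x) * (norm (partition_prod v q))\<^sup>2"
      using in' x by (simp add: norm_m power_mult_distrib v_norm)
    also have "\<dots> \<le> exp (c * x) * exp (c * p)"
      using IH(3) exp_ge_add_one_self[of "c * x"] x by (intro mult_mono) (auto simp: c_def)
    finally have "(norm (m x p (v x) (partition_prod v q)))\<^sup>2 \<le> exp (c * (x + p))"
      by (simp add: exp_add[symmetric] algebra_simps)
    moreover have "cinner (m x p (v x) (partition_prod v q)) (Om (x + p)) = 1"
      using in' x IH by (simp add: m_Om[symmetric] cinner_m v_Om)
    moreover have "cinner (m x p (v x) (partition_prod v q)) (b (x + p)) = of_real (c * (x + p))"
      using in' x IH by (simp add: b'(2) cinner_add_right cinner_m v_Om v_b distrib_left)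
    ultimately show ?case by (simp add: p_def)
  qed
  then show 1: "cinner (partition_prod v q) (Om a) = 1" "cinner (partition_prod v q) (b a) = of_real (c * a)"
    "(norm (partition_prod v q))\<^sup>2 \<le> exp (c * a)" by (auto simp: a_def)
  have a: "a \<ge> 0" using q by (simp add: a_def pos_list_sum_nonneg)
  have *: "cinner (partition_prod v q) (v a) = of_real (1 + c * a)"
    using 1 by (simp add: v_def cinner_add_right)
  then show "cinner (partition_prod v q - v a) (v a) = 0"
    by (simp add: cinner_diff_left cinner_self v_norm[OF a])
  have "(norm (partition_prod v q - v a))\<^sup>2 = (norm (partition_prod v q))\<^sup>2 - (1 + c * a)"
    using * by (simp add: norm_diff_power2 v_norm[OF a])
  also have "\<dots> \<le> (c * a)\<^sup>2 * exp (c * a)"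
    using 1(3) exp_remainder_le[of "c * a"] a by (simp add: c_def)
  finally show "(norm (partition_prod v q - v a))\<^sup>2 \<le> c\<^sup>2 * a\<^sup>2 * exp (c * a)"
    by (simp add: power_mult_distrib)
  show "(norm (v a))\<^sup>2 \<le> exp (c * a)"
    using v_norm[OF a] exp_ge_add_one_self[of "c * a"] by simp
qed

text \<open>Blocks are exchanged one at a time. The error of the first block and that of the rest
  are orthogonal, because their first factors \<open>partition_prod v q - v a\<close> and
  \<open>v a\<close> are; the growth factors of block and rest multiply to the exponential of the
  total length.\<close>

lemma partition_prod_refine:
  assumes b: "b \<in> centred_addits S Om" and "\<And>q. q \<in> set QQ \<Longrightarrow> pos_list q"
  defines "v \<equiv> \<lambda>t. Om t + b t" and "c \<equiv> (norm (b 1))\<^sup>2"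
  shows "(norm (partition_prod v (concat QQ) - partition_prod v (map sum_list QQ)))\<^sup>2
    \<le> c\<^sup>2 * exp (c * sum_list (concat QQ)) * sumsq (map sum_list QQ)"
  using assms(2)
proof (induction QQ)
  case Nil
  then show ?case by simp
next
  case (Cons q QQ)
  have v_in: "v t \<in> H t" if "t \<ge> 0" for t
    using that centred_additD(1)[OF b] by (simp add: v_def Om_in H_add)
  define a where "a = sum_list q"
  define p where "p = sum_list (concat QQ)"
  define P where "P = partition_prod v (map sum_list QQ)"
  define Q where "Q = partition_prod v (concat QQ)"
  have q: "pos_list q" and QQ: "\<And>q. q \<in> set QQ \<Longrightarrow> pos_list q" using Cons.prems by auto
  have pQ: "pos_list (concat QQ)" using QQ by (rule pos_list_concat)
  have a: "a \<ge> 0" "p \<ge> 0"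
    using q pQ by (auto simp: a_def p_def pos_list_sum_nonneg)
  have blk: "cinner (partition_prod v q - v a) (v a) = 0"
    "(norm (partition_prod v q - v a))\<^sup>2 \<le> c\<^sup>2 * a\<^sup>2 * exp (c * a)" "(norm (v a))\<^sup>2 \<le> exp (c * a)"
    using partition_prod_block(4-6)[OF b q] unfolding v_def c_def a_def by simp_all
  \<comment> \<open>\<open>partition_prod_in\<close> does not apply here: empty blocks have length
    0, so \<open>map sum_list QQ\<close> need not be a \<open>pos_list\<close>.\<close>
  have P_in: "P \<in> H p"
  proof -
    have P_in': "partition_prod v (map sum_list R) \<in> H (sum_list (map sum_list R))"
      if "\<And>q. q \<in> set R \<Longrightarrow> pos_list q" for R
      using that
    proof (induction R)
      case (Cons r R)
      then show ?case
        using pos_list_sum_nonneg[of r] pos_list_sum_nonneg[OF pos_list_concat[of R]]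
        by (simp add: v_in m_in sum_list_concat)
    qed (simp add: Om_in)
    show ?thesis using P_in'[OF QQ] by (simp add: P_def p_def sum_list_concat)
  qed
  have in': "P \<in> H p" "Q \<in> H p" "v a \<in> H a" "partition_prod v q \<in> H a"
    using P_in partition_prod_in[OF v_in pQ] partition_prod_in[OF v_in q] a v_in by (auto simp: Q_def p_def a_def)
  have Q_norm: "(norm Q)\<^sup>2 \<le> exp (c * p)"
    using partition_prod_block(3)[OF b pQ] by (simp add: Q_def p_def v_def c_def)
  have "partition_prod v (concat (q # QQ)) - partition_prod v (map sum_list (q # QQ)) = m a p (partition_prod v q) Q - m a p (v a) P"
    using partition_prod_append[OF v_in q pQ] by (simp add: a_def p_def P_def Q_def sum_list_concat)
  also have "\<dots> = m a p (partition_prod v q - v a) Q + m a p (v a) (Q - P)"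
    using in' a by (simp add: m_diff_left m_diff_right)
  finally have eq: "partition_prod v (concat (q # QQ)) - partition_prod v (map sum_list (q # QQ)) =
      m a p (partition_prod v q - v a) Q + m a p (v a) (Q - P)" .
  have "cinner (m a p (partition_prod v q - v a) Q) (m a p (v a) (Q - P)) = 0"
    using in' a blk(1) by (simp add: cinner_m H_diff)
  from norm_add_orthogonal[OF this] have "(norm (partition_prod v (concat (q # QQ)) - partition_prod v (map sum_list (q # QQ))))\<^sup>2
      = (norm (partition_prod v q - v a))\<^sup>2 * (norm Q)\<^sup>2 + (norm (v a))\<^sup>2 * (norm (Q - P))\<^sup>2"
    unfolding eq using in' a by (simp add: H_diff norm_m power_mult_distrib)
  also have "\<dots> \<le> (c\<^sup>2 * a\<^sup>2 * exp (c * a)) * exp (c * p) + exp (c * a) * (c\<^sup>2 * exp (c * p) * sumsq (map sum_list QQ))"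
    using Q_norm blk(2,3) Cons.IH[OF QQ]
    by (intro add_mono mult_mono) (auto simp: P_def Q_def p_def)
  also have "\<dots> = c\<^sup>2 * exp (c * (a + p)) * (a\<^sup>2 + sumsq (map sum_list QQ))"
    by (simp add: exp_add algebra_simps)
  finally show ?case by (simp add: a_def p_def)
qed

lemma associated_unit_exists:
  assumes b: "b \<in> centred_addits S Om"
  shows "\<exists>u\<in>exponential_units S Om. associated u b"
proof -
  define v where "v = (\<lambda>t. Om t + b t)"
  define c where "c = (norm (b 1))\<^sup>2"
  define K where "K t = c\<^sup>2 * exp (c * t)" for t
  note b' = centred_additD[OF b]
  have v_in: "v t \<in> H t" if "t \<ge> 0" for t
    using that b'(1) by (simp add: v_def Om_in H_add)
  obtain W where W: "\<And>t. t \<ge> 0 \<Longrightarrow> W t \<in> H t"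
    "\<And>P. pos_list P \<Longrightarrow> (norm (W (sum_list P) - partition_prod v P))\<^sup>2 \<le> K (sum_list P) * sumsq P"
  proof (rule partition_limit[of K "partition_prod v", OF _ partition_prod_in[OF v_in]])
    show "K t \<ge> 0" for t by (simp add: K_def)
    show "(norm (partition_prod v (concat QQ) - partition_prod v (map sum_list QQ)))\<^sup>2
        \<le> K (sum_list (concat QQ)) * sumsq (map sum_list QQ)"
      if "\<And>q. q \<in> set QQ \<Longrightarrow> pos_list q" for QQ
      using partition_prod_refine[OF b that] by (simp add: K_def v_def c_def)
  qed (assumption | rule that)+
  note lim = partition_limit_tendsto[OF W(2)]
  have dy: "(\<lambda>n. partition_prod v (dyadic t n)) \<longlonglongrightarrow> W t" if "t > 0" for t
    using that by (intro lim) (auto simp: sum_list_dyadic sumsq_dyadic_tendsto simp del: sumsq_simps(4))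
  have W0: "W 0 = Om 0" using W(2)[of "[]"] by simp
  have mult: "m s t (W s) (W t) = W (s + t)" if "s \<ge> 0" "t \<ge> 0" for s t
  proof (cases "s = 0 \<or> t = 0")
    case True
    then show ?thesis using W0 W(1) that by auto
  next
    case False
    then have st: "s > 0" "t > 0" using that by auto
    have "(\<lambda>n. sumsq (dyadic s n) + sumsq (dyadic t n)) \<longlonglongrightarrow> 0 + 0"
      by (intro tendsto_add sumsq_dyadic_tendsto)
    \<comment> \<open>The concatenation is in general not a dyadic partition of
      \<open>s + t\<close>; this is where convergence along arbitrary partitions is used.\<close>
    then have "(\<lambda>n. partition_prod v (dyadic s n @ dyadic t n)) \<longlonglongrightarrow> W (s + t)"
      using st by (intro lim) (auto simp: sum_list_dyadic simp del: sumsq_simps(4))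
    moreover have "partition_prod v (dyadic s n @ dyadic t n) = m s t (partition_prod v (dyadic s n)) (partition_prod v (dyadic t n))" for n
      using partition_prod_append[OF v_in, of "dyadic s n" "dyadic t n"] st by (simp add: sum_list_dyadic)
    moreover have "(\<lambda>n. m s t (partition_prod v (dyadic s n)) (partition_prod v (dyadic t n))) \<longlonglongrightarrow> m s t (W s) (W t)"
      using st partition_prod_in[OF v_in, of "dyadic s _"] partition_prod_in[OF v_in, of "dyadic t _"] W(1)
      by (intro tendsto_m dy) (auto simp: sum_list_dyadic)
    ultimately show ?thesis using LIMSEQ_unique by fastforce
  qed
  have Om_W: "cinner (W t) (Om t) = 1" if "t \<ge> 0" for t
  proof (cases "t = 0")
    case True
    then show ?thesis by (simp add: W0 cinner_Om)
  next
    case False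
    then have "cinner (partition_prod v (dyadic t n)) (Om t) = 1" for n
      using partition_prod_block(1)[OF b, of "dyadic t n"] that by (simp add: v_def sum_list_dyadic)
    then show ?thesis
      using tendsto_cinner_left[OF dy, of t "Om t"] that False by (simp add: LIMSEQ_const_iff)
  qed
  have meas: "(\<lambda>t. (t, W t)) \<in> restrict_space borel {0<..} \<rightarrow>\<^sub>M total S"
  proof (rule measurable_section_limit[OF _ dy])
    have "(\<lambda>t. (t, Om t)) \<in> restrict_space borel {0<..} \<rightarrow>\<^sub>M total S"
      using Om_units unfolding units_def measurable_sections_def by blast
    then have "(\<lambda>t. (t, v t)) \<in> restrict_space borel {0<..} \<rightarrow>\<^sub>M total S"
      unfolding v_def by (intro measurable_section_add b'(5))
    then show "(\<lambda>t. (t, partition_prod v (dyadic t n))) \<in> restrict_space borel {0<..} \<rightarrow>\<^sub>M total S" for n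
      by (rule measurable_dyadic)
  qed
  define u where "u = restrict W {0..}"
  have "u \<in> exponential_units S Om"
  proof (rule exponential_unitI)
    show "(\<lambda>t. (t, u t)) \<in> restrict_space borel {0<..} \<rightarrow>\<^sub>M total S"
      using meas by (subst measurable_cong[of _ _ "\<lambda>t. (t, W t)"]) (auto simp: u_def space_restrict_space)
  qed (auto simp: u_def W(1) mult Om_W)
  moreover have "associated u b"
    unfolding associated_def
  \<comment> \<open>The one-piece partition \<open>[t]\<close> compares \<open>W t\<close> with
    \<open>v t\<close> itself; the constant is \<open>K 1\<close>, which bounds \<open>K t\<close>
    for \<open>t \<le> 1\<close>.\<close>
  proof (intro exI[of _ "c\<^sup>2 * exp c"] ballI)
    fix t :: real assume t: "t \<in> {0..1}"
    show "(norm (u t - Om t - b t))\<^sup>2 \<le> c\<^sup>2 * exp c * t\<^sup>2"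
    proof (cases "t = 0")
      case True
      then show ?thesis by (simp add: u_def W0 centred_addit_0[OF b])
    next
      case False
      have "(norm (W t - v t))\<^sup>2 \<le> K t * t\<^sup>2"
        using W(2)[of "[t]"] t False v_in[of t] by simp
      also have "\<dots> \<le> c\<^sup>2 * exp c * t\<^sup>2"
        using t by (auto simp: K_def c_def intro!: mult_mono mult_left_le)
      finally show ?thesis using t by (simp add: u_def v_def diff_diff_eq)
    qed
  qed
  ultimately show ?thesis by blast
qed

text \<open>\<open>\<beta>\<close> is additive up to the product of \<open>\<beta>\<close> with
  itself, which is orthogonal to the first-order terms. So pairing the sum with
  \<open>\<beta> a\<close> gives the squared norm of the sum, and the squared distance is
  \<open>exp (\<gamma> * a) - 1\<close> minus that squared norm, which is at least
  \<open>\<gamma> * a\<close>.\<close>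

lemma partition_sum_block:
  assumes u: "u \<in> exponential_units S Om" and \<gamma>: "\<gamma> \<ge> 0" "\<And>t. t \<ge> 0 \<Longrightarrow> (norm (u t))\<^sup>2 = exp (\<gamma> * t)"
    and q: "pos_list q"
  defines "\<beta> \<equiv> \<lambda>t. u t - Om t" and "a \<equiv> sum_list q"
  shows "cinner (partition_sum \<beta> q) (Om a) = 0" "cinner (partition_sum \<beta> q - \<beta> a) (Om a) = 0"
    "(norm (partition_sum \<beta> q - \<beta> a))\<^sup>2 \<le> \<gamma>\<^sup>2 * a\<^sup>2 * exp (\<gamma> * a)"
proof -
  note u' = exponential_unitD[OF u]
  have \<beta>_in: "\<beta> t \<in> H t" if "t \<ge> 0" for t
    using that u'(1) by (simp add: \<beta>_def Om_in H_diff)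
  have \<beta>_Om: "cinner (\<beta> t) (Om t) = 0" "cinner (Om t) (\<beta> t) = 0" if "t \<ge> 0" for t
    using u'(3)[OF that] cinner_commute[of "Om t" "u t"]
    by (simp_all add: \<beta>_def cinner_diff_left cinner_diff_right cinner_Om that)
  have \<beta>_norm: "(norm (\<beta> t))\<^sup>2 = exp (\<gamma> * t) - 1" if "t \<ge> 0" for t
    using norm_exponential_unit_minus[OF u that] \<gamma>(2)[OF that] by (simp add: \<beta>_def)
  have \<beta>_add: "\<beta> (s + t) = m s t (\<beta> s) (Om t) + m s t (Om s) (\<beta> t) + m s t (\<beta> s) (\<beta> t)"
    if "s \<ge> 0" "t \<ge> 0" for s t
    using that u'(1) by (simp add: \<beta>_def m_diff_left m_diff_right H_diff Om_in m_Om u'(2))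
  have "cinner (partition_sum \<beta> q) (Om (sum_list q)) = 0 \<and> cinner (partition_sum \<beta> q) (\<beta> (sum_list q)) = of_real ((norm (partition_sum \<beta> q))\<^sup>2)
    \<and> (norm (partition_sum \<beta> q))\<^sup>2 \<ge> \<gamma> * sum_list q"
    using q
  proof (induction q)
    case Nil
    then show ?case by simp
  next
    case (Cons x q)
    define p where "p = sum_list q"
    have x: "x \<ge> 0" "p \<ge> 0" and q: "pos_list q"
      using Cons.prems by (auto simp: p_def pos_list_sum_nonneg)
    have in': "partition_sum \<beta> q \<in> H p" "\<beta> x \<in> H x" "\<beta> p \<in> H p" "Om x \<in> H x" "Om p \<in> H p"
      using partition_sum_in[OF \<beta>_in q] x \<beta>_in by (auto simp: p_def Om_in)
    have IH: "cinner (partition_sum \<beta> q) (Om p) = 0" "cinner (partition_sum \<beta> q) (\<beta> p) = of_real ((norm (partition_sum \<beta> q))\<^sup>2)"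
      "(norm (partition_sum \<beta> q))\<^sup>2 \<ge> \<gamma> * p"
      using Cons.IH[OF q] by (auto simp: p_def)
    define y where "y = m x p (\<beta> x) (Om p) + m x p (Om x) (partition_sum \<beta> q)"
    have y_norm: "(norm y)\<^sup>2 = (norm (\<beta> x))\<^sup>2 + (norm (partition_sum \<beta> q))\<^sup>2"
      unfolding y_def using in' x \<beta>_Om
      by (simp add: norm_add_orthogonal cinner_m norm_m norm_Om)
    have "cinner y (Om (x + p)) = 0"
      using in' x IH \<beta>_Om by (simp add: y_def m_Om[symmetric] cinner_add_left cinner_m)
    moreover have "cinner y (\<beta> (x + p)) = of_real ((norm y)\<^sup>2)"
      using in' x IH \<beta>_Om
      by (simp add: y_def[symmetric] y_norm)
        (simp add: y_def \<beta>_add cinner_add_left cinner_add_right cinner_m cinner_Om cinner_self norm_m norm_Om)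
    moreover have "(norm y)\<^sup>2 \<ge> \<gamma> * (x + p)"
      unfolding y_norm \<beta>_norm[OF x(1)]
      using IH(3) exp_ge_add_one_self[of "\<gamma> * x"] distrib_left[of \<gamma> x p] by linarith
    ultimately show ?case by (simp add: p_def y_def)
  qed
  then have 1: "cinner (partition_sum \<beta> q) (Om a) = 0" "cinner (partition_sum \<beta> q) (\<beta> a) = of_real ((norm (partition_sum \<beta> q))\<^sup>2)"
    "(norm (partition_sum \<beta> q))\<^sup>2 \<ge> \<gamma> * a" by (auto simp: a_def)
  have a: "a \<ge> 0" using q by (simp add: a_def pos_list_sum_nonneg)
  show "cinner (partition_sum \<beta> q) (Om a) = 0" by (fact 1(1))
  then show "cinner (partition_sum \<beta> q - \<beta> a) (Om a) = 0"
    using \<beta>_Om[OF a] by (simp add: cinner_diff_left)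
  have "(norm (partition_sum \<beta> q - \<beta> a))\<^sup>2 = (norm (\<beta> a))\<^sup>2 - (norm (partition_sum \<beta> q))\<^sup>2"
    using 1(2) by (simp add: norm_diff_power2)
  also have "\<dots> \<le> (\<gamma> * a)\<^sup>2 * exp (\<gamma> * a)"
    using 1(3) exp_remainder_le[of "\<gamma> * a"] a \<gamma>(1) by (simp add: \<beta>_norm)
  finally show "(norm (partition_sum \<beta> q - \<beta> a))\<^sup>2 \<le> \<gamma>\<^sup>2 * a\<^sup>2 * exp (\<gamma> * a)"
    by (simp add: power_mult_distrib)
qed

text \<open>The error of the first block is followed by \<open>Om p\<close>, the error of the rest
  is preceded by \<open>Om a\<close>. They are orthogonal because the block error is orthogonal to
  \<open>Om a\<close>.\<close>

lemma partition_sum_refine: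
  assumes u: "u \<in> exponential_units S Om" and \<gamma>: "\<gamma> \<ge> 0" "\<And>t. t \<ge> 0 \<Longrightarrow> (norm (u t))\<^sup>2 = exp (\<gamma> * t)"
    and "\<And>q. q \<in> set QQ \<Longrightarrow> pos_list q"
  defines "\<beta> \<equiv> \<lambda>t. u t - Om t"
  shows "(norm (partition_sum \<beta> (concat QQ) - partition_sum \<beta> (map sum_list QQ)))\<^sup>2
    \<le> \<gamma>\<^sup>2 * exp (\<gamma> * sum_list (concat QQ)) * sumsq (map sum_list QQ)"
  using assms(4)
proof (induction QQ)
  case Nil
  then show ?case by simp
next
  case (Cons q QQ)
  have \<beta>_in: "\<beta> t \<in> H t" if "t \<ge> 0" for t
    using that exponential_unitD(1)[OF u] by (simp add: \<beta>_def Om_in H_diff)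
  define a where "a = sum_list q"
  define p where "p = sum_list (concat QQ)"
  define P where "P = partition_sum \<beta> (map sum_list QQ)"
  define Q where "Q = partition_sum \<beta> (concat QQ)"
  have q: "pos_list q" and QQ: "\<And>q. q \<in> set QQ \<Longrightarrow> pos_list q" using Cons.prems by auto
  have pQ: "pos_list (concat QQ)" using QQ by (rule pos_list_concat)
  have a: "a \<ge> 0" "p \<ge> 0"
    using q pQ by (auto simp: a_def p_def pos_list_sum_nonneg)
  have blk: "cinner (partition_sum \<beta> q - \<beta> a) (Om a) = 0"
    "(norm (partition_sum \<beta> q - \<beta> a))\<^sup>2 \<le> \<gamma>\<^sup>2 * a\<^sup>2 * exp (\<gamma> * a)"
    using partition_sum_block(2,3)[OF u \<gamma> q] unfolding \<beta>_def a_def by simp_all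
  have P_in: "P \<in> H p"
  proof -
    have P_in': "partition_sum \<beta> (map sum_list R) \<in> H (sum_list (map sum_list R))"
      if "\<And>q. q \<in> set R \<Longrightarrow> pos_list q" for R
      using that
    proof (induction R)
      case (Cons r R)
      then show ?case
        using pos_list_sum_nonneg[of r] pos_list_sum_nonneg[OF pos_list_concat[of R]]
        by (simp add: \<beta>_in m_in H_add Om_in sum_list_concat)
    qed (simp add: H_zero)
    show ?thesis using P_in'[OF QQ] by (simp add: P_def p_def sum_list_concat)
  qed
  have in': "P \<in> H p" "Q \<in> H p" "\<beta> a \<in> H a" "partition_sum \<beta> q \<in> H a" "Om a \<in> H a" "Om p \<in> H p"
    using P_in partition_sum_in[OF \<beta>_in pQ] partition_sum_in[OF \<beta>_in q] a \<beta>_in by (auto simp: Q_def p_def a_def Om_in)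
  have "partition_sum \<beta> (concat (q # QQ)) - partition_sum \<beta> (map sum_list (q # QQ)) =
      (m a p (partition_sum \<beta> q) (Om p) + m a p (Om a) Q) - (m a p (\<beta> a) (Om p) + m a p (Om a) P)"
    using partition_sum_append[OF \<beta>_in q pQ] by (simp add: a_def p_def P_def Q_def sum_list_concat)
  also have "\<dots> = m a p (partition_sum \<beta> q - \<beta> a) (Om p) + m a p (Om a) (Q - P)"
    using in' a by (simp add: m_diff_left m_diff_right)
  finally have eq: "partition_sum \<beta> (concat (q # QQ)) - partition_sum \<beta> (map sum_list (q # QQ)) =
      m a p (partition_sum \<beta> q - \<beta> a) (Om p) + m a p (Om a) (Q - P)" .
  have "cinner (m a p (partition_sum \<beta> q - \<beta> a) (Om p)) (m a p (Om a) (Q - P)) = 0"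
    using in' a blk(1) by (simp add: cinner_m H_diff)
  from norm_add_orthogonal[OF this] have "(norm (partition_sum \<beta> (concat (q # QQ)) - partition_sum \<beta> (map sum_list (q # QQ))))\<^sup>2
      = (norm (partition_sum \<beta> q - \<beta> a))\<^sup>2 + (norm (Q - P))\<^sup>2"
    unfolding eq using in' a by (simp add: H_diff norm_m norm_Om)
  also have "\<dots> \<le> \<gamma>\<^sup>2 * a\<^sup>2 * exp (\<gamma> * a) + \<gamma>\<^sup>2 * exp (\<gamma> * p) * sumsq (map sum_list QQ)"
    using blk(2) Cons.IH[OF QQ] by (intro add_mono) (auto simp: P_def Q_def p_def)
  \<comment> \<open>Neighbouring pieces contribute no growth; the exponents are enlarged only to
    reach the form that \<open>partition_limit\<close> expects.\<close>
  also have "\<dots> \<le> \<gamma>\<^sup>2 * a\<^sup>2 * exp (\<gamma> * (a + p)) + \<gamma>\<^sup>2 * exp (\<gamma> * (a + p)) * sumsq (map sum_list QQ)"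
    using a \<gamma>(1) by (intro add_mono mult_mono) (auto intro: mult_left_mono sumsq_nonneg)
  also have "\<dots> = \<gamma>\<^sup>2 * exp (\<gamma> * (a + p)) * (a\<^sup>2 + sumsq (map sum_list QQ))"
    by (simp add: algebra_simps)
  finally show ?case by (simp add: a_def p_def)
qed

lemma associated_addit_exists:
  assumes u: "u \<in> exponential_units S Om"
  shows "\<exists>b\<in>centred_addits S Om. associated u b"
proof -
  obtain \<gamma> where \<gamma>: "\<gamma> \<ge> 0" "\<And>t. t \<ge> 0 \<Longrightarrow> (norm (u t))\<^sup>2 = exp (\<gamma> * t)"
    by (rule norm_exponential_unit[OF u]) (rule that)
  define \<beta> where "\<beta> = (\<lambda>t. u t - Om t)"
  define K where "K t = \<gamma>\<^sup>2 * exp (\<gamma> * t)" for t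
  note u' = exponential_unitD[OF u]
  have \<beta>_in: "\<beta> t \<in> H t" if "t \<ge> 0" for t
    using that u'(1) by (simp add: \<beta>_def Om_in H_diff)
  obtain W where W: "\<And>t. t \<ge> 0 \<Longrightarrow> W t \<in> H t"
    "\<And>P. pos_list P \<Longrightarrow> (norm (W (sum_list P) - partition_sum \<beta> P))\<^sup>2 \<le> K (sum_list P) * sumsq P"
  proof (rule partition_limit[of K "partition_sum \<beta>", OF _ partition_sum_in[OF \<beta>_in]])
    show "K t \<ge> 0" for t by (simp add: K_def)
    show "(norm (partition_sum \<beta> (concat QQ) - partition_sum \<beta> (map sum_list QQ)))\<^sup>2
        \<le> K (sum_list (concat QQ)) * sumsq (map sum_list QQ)"
      if "\<And>q. q \<in> set QQ \<Longrightarrow> pos_list q" for QQ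
      using partition_sum_refine[OF u \<gamma> that] by (simp add: K_def \<beta>_def)
  qed (assumption | rule that)+
  note lim = partition_limit_tendsto[OF W(2)]
  have dy: "(\<lambda>n. partition_sum \<beta> (dyadic t n)) \<longlonglongrightarrow> W t" if "t > 0" for t
    using that by (intro lim) (auto simp: sum_list_dyadic sumsq_dyadic_tendsto simp del: sumsq_simps(4))
  have W0: "W 0 = 0" using W(2)[of "[]"] by simp
  have add: "W (s + t) = m s t (W s) (Om t) + m s t (Om s) (W t)" if "s \<ge> 0" "t \<ge> 0" for s t
  proof (cases "s = 0 \<or> t = 0")
    case True
    then show ?thesis using W0 W(1) that by (auto simp: m_zero_left m_zero_right Om_in)
  next
    case False
    then have st: "s > 0" "t > 0" using that by auto
    have "(\<lambda>n. sumsq (dyadic s n) + sumsq (dyadic t n)) \<longlonglongrightarrow> 0 + 0"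
      by (intro tendsto_add sumsq_dyadic_tendsto)
    then have "(\<lambda>n. partition_sum \<beta> (dyadic s n @ dyadic t n)) \<longlonglongrightarrow> W (s + t)"
      using st by (intro lim) (auto simp: sum_list_dyadic simp del: sumsq_simps(4))
    moreover have "partition_sum \<beta> (dyadic s n @ dyadic t n) =
        m s t (partition_sum \<beta> (dyadic s n)) (Om t) + m s t (Om s) (partition_sum \<beta> (dyadic t n))" for n
      using partition_sum_append[OF \<beta>_in, of "dyadic s n" "dyadic t n"] st by (simp add: sum_list_dyadic)
    moreover have "(\<lambda>n. m s t (partition_sum \<beta> (dyadic s n)) (Om t) + m s t (Om s) (partition_sum \<beta> (dyadic t n)))
        \<longlonglongrightarrow> m s t (W s) (Om t) + m s t (Om s) (W t)"
      using st partition_sum_in[OF \<beta>_in, of "dyadic s _"] partition_sum_in[OF \<beta>_in, of "dyadic t _"] W(1)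
      by (intro tendsto_add tendsto_m dy tendsto_const) (auto simp: sum_list_dyadic Om_in)
    ultimately show ?thesis using LIMSEQ_unique by fastforce
  qed
  have Om_W: "cinner (W t) (Om t) = 0" if "t \<ge> 0" for t
  proof (cases "t = 0")
    case True
    then show ?thesis by (simp add: W0)
  next
    case False
    then have "cinner (partition_sum \<beta> (dyadic t n)) (Om t) = 0" for n
      using partition_sum_block(1)[OF u \<gamma>, of "dyadic t n"] that by (simp add: \<beta>_def sum_list_dyadic)
    then show ?thesis
      using tendsto_cinner_left[OF dy, of t "Om t"] that False by (simp add: LIMSEQ_const_iff)
  qed
  have meas: "(\<lambda>t. (t, W t)) \<in> restrict_space borel {0<..} \<rightarrow>\<^sub>M total S"
  proof (rule measurable_section_limit[OF _ dy])
    have "(\<lambda>t. (t, Om t)) \<in> restrict_space borel {0<..} \<rightarrow>\<^sub>M total S"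
      using Om_units unfolding units_def measurable_sections_def by blast
    then have "(\<lambda>t. (t, \<beta> t)) \<in> restrict_space borel {0<..} \<rightarrow>\<^sub>M total S"
      unfolding \<beta>_def by (intro measurable_section_diff u'(4))
    then show "(\<lambda>t. (t, partition_sum \<beta> (dyadic t n))) \<in> restrict_space borel {0<..} \<rightarrow>\<^sub>M total S" for n
      by (rule measurable_dyadic)
  qed
  define b where "b = restrict W {0..}"
  have "b \<in> centred_addits S Om"
  proof (rule centred_additI)
    show "(\<lambda>t. (t, b t)) \<in> restrict_space borel {0<..} \<rightarrow>\<^sub>M total S"
      using meas by (subst measurable_cong[of _ _ "\<lambda>t. (t, W t)"]) (auto simp: b_def space_restrict_space)
  qed (auto simp: b_def W(1) add Om_W)
  moreover have "associated u b"
    unfolding associated_def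
  proof (intro exI[of _ "\<gamma>\<^sup>2 * exp \<gamma>"] ballI)
    fix t :: real assume t: "t \<in> {0..1}"
    show "(norm (u t - Om t - b t))\<^sup>2 \<le> \<gamma>\<^sup>2 * exp \<gamma> * t\<^sup>2"
    proof (cases "t = 0")
      case True
      then show ?thesis by (simp add: b_def W0 exponential_unit_0[OF u])
    next
      case False
      have "(norm (W t - \<beta> t))\<^sup>2 \<le> K t * t\<^sup>2"
        using W(2)[of "[t]"] t False \<beta>_in[of t] by (simp add: m_zero_right Om_in)
      also have "\<dots> \<le> \<gamma>\<^sup>2 * exp \<gamma> * t\<^sup>2"
        using t \<gamma>(1) by (auto simp: K_def intro!: mult_mono mult_left_le)
      finally show ?thesis using t by (simp add: b_def \<beta>_def norm_minus_commute)
    qed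
  qed
  ultimately show ?thesis by blast
qed

section \<open>Integrals of simple processes\<close>

text \<open>The Ito sum over \<open>[s, s + sum_list P]\<close>. Only values at left end points
  enter, so it makes sense for any adapted process; \<open>simple_on\<close> records separately that
  the process is simple for this partition.\<close>

primrec ito_sum :: "(real \<Rightarrow> 'a) \<Rightarrow> (real \<Rightarrow> 'a) \<Rightarrow> real list \<Rightarrow> real \<Rightarrow> 'a" where
  "ito_sum x b [] s = 0"
| "ito_sum x b (a # P) s = m (s + a) (sum_list P) (m s a (x s) (b a)) (Om (sum_list P)) + ito_sum x b P (s + a)"

definition simple_block :: "(real \<Rightarrow> 'a) \<Rightarrow> real \<Rightarrow> real \<Rightarrow> bool" where
  "simple_block x s a \<longleftrightarrow> (\<forall>r\<in>{0..<a}. x (s + r) = m s r (x s) (Om r))"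

primrec simple_on :: "(real \<Rightarrow> 'a) \<Rightarrow> real list \<Rightarrow> real \<Rightarrow> bool" where
  "simple_on x [] s \<longleftrightarrow> True"
| "simple_on x (a # P) s \<longleftrightarrow> simple_block x s a \<and> simple_on x P (s + a)"

lemma simple_on_append: "simple_on x (P @ Q) s \<longleftrightarrow> simple_on x P s \<and> simple_on x Q (s + sum_list P)"
  by (induction P arbitrary: s) (auto simp: add.assoc)

context
  fixes b x
  assumes b: "b \<in> centred_addits S Om" and x: "\<And>t. t \<ge> 0 \<Longrightarrow> x t \<in> H t"
begin

lemma ito_sum_in:
  assumes "s \<ge> 0" "pos_list P"
  shows "ito_sum x b P s \<in> H (s + sum_list P)"
  using assms
proof (induction P arbitrary: s)
  case (Cons a P)
  then have "ito_sum x b P (s + a) \<in> H (s + a + sum_list P)"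
    "m (s + a) (sum_list P) (m s a (x s) (b a)) (Om (sum_list P)) \<in> H (s + a + sum_list P)"
    using pos_list_sum_nonneg[of P] centred_additD(1)[OF b] by (auto simp: m_in x Om_in)
  then show ?case
    using Cons.prems pos_list_sum_nonneg[of P] H_add[of "s + a + sum_list P"] by (simp add: add.assoc)
qed (simp add: H_zero)

text \<open>The martingale property: each summand contains an increment of \<open>b\<close> where
  the extension of \<open>y\<close> has \<open>Om\<close>, and \<open>b\<close> is centred.\<close>

lemma ito_sum_orthogonal:
  assumes "s \<ge> 0" "pos_list P" "y \<in> H s"
  shows "cinner (m s (sum_list P) y (Om (sum_list P))) (ito_sum x b P s) = 0"
  using assms
proof (induction P arbitrary: s y)
  case (Cons a P)
  define p where "p = sum_list P"
  have a: "a \<ge> 0" "p \<ge> 0" and P: "pos_list P" using Cons.prems by (auto simp: p_def pos_list_sum_nonneg)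
  have y': "m s a y (Om a) \<in> H (s + a)" using Cons.prems a by (simp add: m_in Om_in)
  have "m s (a + p) y (Om (a + p)) = m (s + a) p (m s a y (Om a)) (Om p)"
    using Cons.prems a by (simp add: m_Om[symmetric] m_assoc Om_in)
  moreover have "cinner (m (s + a) p (m s a y (Om a)) (Om p)) (ito_sum x b P (s + a)) = 0"
    using Cons.IH[OF _ P y'] Cons.prems a by (simp add: p_def)
  moreover have "cinner (m (s + a) p (m s a y (Om a)) (Om p)) (m (s + a) p (m s a (x s) (b a)) (Om p)) = 0"
    using Cons.prems a centred_additD(1,3)[OF b] y' by (simp add: cinner_m m_in Om_in x)
  ultimately show ?case by (simp add: p_def[symmetric] cinner_add_right)
qed simp

text \<open>The Ito isometry. The first summand is a vector of \<open>H (s + a)\<close> extended by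
  \<open>Om\<close>, hence orthogonal to the later ones, and its squared norm is the integral of a
  constant over the first piece.\<close>

lemma ito_sum_isometry:
  assumes "s \<ge> 0" "pos_list P" "simple_on x P s"
  shows "((\<lambda>r. (norm (b 1))\<^sup>2 * (norm (x r))\<^sup>2) has_integral (norm (ito_sum x b P s))\<^sup>2) {s..s + sum_list P}"
  using assms
proof (induction P arbitrary: s)
  case Nil
  then show ?case by (simp add: has_integral_refl)
next
  case (Cons a P)
  define c where "c = (norm (b 1))\<^sup>2"
  define p where "p = sum_list P"
  have a: "a > 0" "p \<ge> 0" and s: "s \<ge> 0" and P: "pos_list P"
    using Cons.prems by (auto simp: p_def pos_list_sum_nonneg)
  have y: "m s a (x s) (b a) \<in> H (s + a)"
    using a s centred_additD(1)[OF b] by (simp add: m_in x)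
  have "((\<lambda>r. c * (norm (x s))\<^sup>2) has_integral (c * (norm (x s))\<^sup>2) * a) {s..s + a}"
    using has_integral_const_real[of "c * (norm (x s))\<^sup>2" s "s + a"] a by (simp add: mult.commute)
  then have 1: "((\<lambda>r. c * (norm (x r))\<^sup>2) has_integral (c * (norm (x s))\<^sup>2) * a) {s..s + a}"
  \<comment> \<open>At the right end point the block is over and \<open>x\<close> may jump; a single
    point does not affect the integral.\<close>
  proof (rule has_integral_spike[of "{s + a}", rotated 2])
    fix r assume r: "r \<in> {s..s + a} - {s + a}"
    then have "r - s \<in> {0..<a}" by auto
    then have "x (s + (r - s)) = m s (r - s) (x s) (Om (r - s))"
      using Cons.prems(3) unfolding simple_on.simps simple_block_def by blast
    then show "c * (norm (x r))\<^sup>2 = c * (norm (x s))\<^sup>2"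
      using r s by (simp add: norm_m x Om_in norm_Om)
  qed simp
  have "simple_on x P (s + a)" using Cons.prems by simp
  then have 2: "((\<lambda>r. c * (norm (x r))\<^sup>2) has_integral (norm (ito_sum x b P (s + a)))\<^sup>2) {s + a..s + a + p}"
    unfolding c_def p_def using a s P by (intro Cons.IH) auto
  have "cinner (m (s + a) p (m s a (x s) (b a)) (Om p)) (ito_sum x b P (s + a)) = 0"
    using ito_sum_orthogonal[of "s + a" P, OF _ P y] a s by (simp add: p_def)
  moreover have "(norm (m s a (x s) (b a)))\<^sup>2 = c * (norm (x s))\<^sup>2 * a"
    using a s x centred_additD(1)[OF b] norm_centred_addit[OF b, of a]
    by (simp add: norm_m power_mult_distrib c_def mult.commute mult.left_commute)
  ultimately have "(norm (ito_sum x b (a # P) s))\<^sup>2 = c * (norm (x s))\<^sup>2 * a + (norm (ito_sum x b P (s + a)))\<^sup>2"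
    using a s y by (simp add: p_def[symmetric] norm_add_orthogonal norm_m Om_in norm_Om)
  moreover have "((\<lambda>r. c * (norm (x r))\<^sup>2) has_integral c * (norm (x s))\<^sup>2 * a + (norm (ito_sum x b P (s + a)))\<^sup>2) {s..s + a + p}"
    by (rule has_integral_combine[OF _ _ 1 2]) (use a in auto)
  ultimately show ?case by (simp add: c_def p_def add.assoc)
qed

lemma ito_sum_append:
  assumes "s \<ge> 0" "pos_list P" "pos_list Q"
  shows "ito_sum x b (P @ Q) s = m (s + sum_list P) (sum_list Q) (ito_sum x b P s) (Om (sum_list Q)) + ito_sum x b Q (s + sum_list P)"
  using assms(1,2)
proof (induction P arbitrary: s)
  case Nil
  then show ?case using assms(3) by (simp add: m_zero_left Om_in pos_list_sum_nonneg)
next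
  case (Cons a P)
  define p where "p = sum_list P"
  define q where "q = sum_list Q"
  have a: "a \<ge> 0" "p \<ge> 0" "q \<ge> 0" "s \<ge> 0" and P: "pos_list P"
    using Cons.prems assms(3) by (auto simp: p_def q_def pos_list_sum_nonneg)
  have y: "m s a (x s) (b a) \<in> H (s + a)"
    using a centred_additD(1)[OF b] by (simp add: m_in x)
  have J: "ito_sum x b P (s + a) \<in> H (s + (a + p))"
    using ito_sum_in[of "s + a" P] a P by (simp add: p_def add.assoc)
  have "m (s + a) (p + q) (m s a (x s) (b a)) (Om (p + q)) =
      m (s + (a + p)) q (m (s + a) p (m s a (x s) (b a)) (Om p)) (Om q)"
    using a y m_assoc[of "s + a" p q "m s a (x s) (b a)" "Om p" "Om q"] by (simp add: m_Om Om_in add.assoc)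
  moreover have "m (s + a) p (m s a (x s) (b a)) (Om p) \<in> H (s + (a + p))"
    using m_in[of "s + a" p _ "Om p"] a y by (simp add: Om_in add.assoc)
  ultimately show ?case
    using Cons.IH[of "s + a"] P a J
    by (simp add: p_def[symmetric] q_def[symmetric] m_add_left Om_in add.assoc)
qed

text \<open>Blocks are half-open, so it is \<open>p > 0\<close> that keeps \<open>s + a\<close>
  inside the block.\<close>

lemma simple_block_shift:
  assumes "s \<ge> 0" "a > 0" "p > 0" "simple_block x s (a + p)"
  shows "simple_block x s a" "simple_block x (s + a) p" "x (s + a) = m s a (x s) (Om a)"
proof -
  show "simple_block x s a" using assms by (auto simp: simple_block_def)
  show *: "x (s + a) = m s a (x s) (Om a)" using assms by (auto simp: simple_block_def)
  show "simple_block x (s + a) p"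
    unfolding simple_block_def
  proof
    fix r assume r: "r \<in> {0..<p}"
    then have "x (s + (a + r)) = m s (a + r) (x s) (Om (a + r))"
      using assms(2,4) by (auto simp: simple_block_def)
    then show "x (s + a + r) = m (s + a) r (x (s + a)) (Om r)"
      using r assms by (simp add: * m_Om[symmetric] m_assoc Om_in x add.assoc)
  qed
qed

text \<open>Inside a block \<open>x\<close> continues as \<open>x s\<close> followed by
  \<open>Om\<close>, so the summands combine by the additivity of \<open>b\<close>.\<close>

lemma ito_sum_block:
  assumes "s \<ge> 0" "pos_list q" "simple_block x s (sum_list q)"
  shows "ito_sum x b q s = m s (sum_list q) (x s) (b (sum_list q))" "simple_on x q s"
proof -
  have "ito_sum x b q s = m s (sum_list q) (x s) (b (sum_list q)) \<and> simple_on x q s"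
    using assms
  proof (induction q arbitrary: s)
    case Nil
    then show ?case by (simp add: centred_addit_0[OF b] m_zero_right x)
  next
    case (Cons a q)
    show ?case
    proof (cases "q = []")
      case True
      then show ?thesis
        using Cons.prems m_in[of s a "x s" "b a"] centred_additD(1)[OF b] by (simp add: x)
    next
      case False
      define p where "p = sum_list q"
      have p: "p > 0" and a: "a > 0" "s \<ge> 0" and q: "pos_list q"
        using False Cons.prems pos_list_sum_nonneg[of "tl q"] by (cases q; auto simp: p_def)+
      have "simple_block x s (a + p)" using Cons.prems by (simp add: p_def)
      note sh = simple_block_shift[OF a(2,1) p this]
      have IH: "ito_sum x b q (s + a) = m (s + a) p (x (s + a)) (b p)" "simple_on x q (s + a)"
        using Cons.IH[of "s + a"] q a sh(2) by (auto simp: p_def)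
      have ba: "b a \<in> H a" "b p \<in> H p" "x s \<in> H s"
        using a p centred_additD(1)[OF b] x by auto
      have "m s (a + p) (x s) (b (a + p)) = m s (a + p) (x s) (m a p (b a) (Om p)) + m s (a + p) (x s) (m a p (Om a) (b p))"
        using a p ba by (simp add: centred_additD(2)[OF b] m_add_right m_in Om_in)
      also have "\<dots> = m (s + a) p (m s a (x s) (b a)) (Om p) + m (s + a) p (m s a (x s) (Om a)) (b p)"
        using a p ba by (simp add: m_assoc Om_in)
      also have "\<dots> = ito_sum x b (a # q) s" by (simp add: p_def[symmetric] IH sh(3))
      finally show ?thesis using IH sh(1) by (simp add: p_def)
    qed
  qed
  then show "ito_sum x b q s = m s (sum_list q) (x s) (b (sum_list q))" "simple_on x q s" by blast+
qed

lemma ito_sum_refine: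
  assumes "s \<ge> 0" "\<And>q. q \<in> set QQ \<Longrightarrow> pos_list q" "simple_on x (map sum_list QQ) s"
  shows "ito_sum x b (concat QQ) s = ito_sum x b (map sum_list QQ) s" "simple_on x (concat QQ) s"
proof -
  have "ito_sum x b (concat QQ) s = ito_sum x b (map sum_list QQ) s \<and> simple_on x (concat QQ) s"
    using assms
  proof (induction QQ arbitrary: s)
    case (Cons q QQ)
    have q: "pos_list q" "pos_list (concat QQ)" and QQ: "\<And>q. q \<in> set QQ \<Longrightarrow> pos_list q"
      using Cons.prems(2) pos_list_concat[of QQ] by auto
    have blk: "simple_block x s (sum_list q)" "simple_on x (map sum_list QQ) (s + sum_list q)"
      using Cons.prems by auto
    have "ito_sum x b (concat QQ) (s + sum_list q) = ito_sum x b (map sum_list QQ) (s + sum_list q) \<and>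
        simple_on x (concat QQ) (s + sum_list q)"
      using Cons.prems(1) pos_list_sum_nonneg[OF q(1)] QQ blk(2) by (intro Cons.IH) auto
    then show ?case
      using ito_sum_block[OF Cons.prems(1) q(1) blk(1)] ito_sum_append[OF Cons.prems(1) q]
      by (simp add: simple_on_append sum_list_concat)
  qed simp
  then show "ito_sum x b (concat QQ) s = ito_sum x b (map sum_list QQ) s" "simple_on x (concat QQ) s"
    by blast+
qed

text \<open>Both sums equal the sum over a common refinement. This makes the integral of a simple
  process independent of its representation.\<close>

lemma ito_sum_partition_unique:
  assumes "pos_list P" "pos_list P'" "sum_list P = sum_list P'" "simple_on x P 0" "simple_on x P' 0"
  shows "ito_sum x b P 0 = ito_sum x b P' 0"
proof -
  obtain QQ QQ' where "P = map sum_list QQ" "P' = map sum_list QQ'" "concat QQ = concat QQ'"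
    "\<forall>q\<in>set QQ. pos_list q" "\<forall>q\<in>set QQ'. pos_list q"
    using common_refinement[OF assms(1-3)] by blast
  then show ?thesis
    using ito_sum_refine(1)[of 0 QQ] ito_sum_refine(1)[of 0 QQ'] assms(4,5) by auto
qed

end

lemma ito_sum_diff:
  assumes b: "b \<in> centred_addits S Om" and x: "\<And>t. t \<ge> 0 \<Longrightarrow> x t \<in> H t" and y: "\<And>t. t \<ge> 0 \<Longrightarrow> y t \<in> H t"
    and "s \<ge> 0" "pos_list P"
  shows "ito_sum (\<lambda>t. x t - y t) b P s = ito_sum x b P s - ito_sum y b P s"
  using assms(4,5)
proof (induction P arbitrary: s)
  case (Cons a P)
  define p where "p = sum_list P"
  have a: "a \<ge> 0" "p \<ge> 0" "s \<ge> 0" and P: "pos_list P"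
    using Cons.prems by (auto simp: p_def pos_list_sum_nonneg)
  have in': "x s \<in> H s" "y s \<in> H s" "b a \<in> H a" using a x y centred_additD(1)[OF b] by auto
  then have in'': "m s a (x s) (b a) \<in> H (s + a)" "m s a (y s) (b a) \<in> H (s + a)"
    using a by (auto simp: m_in)
  show ?case
    using Cons.IH[of "s + a"] P a in' in''
    by (simp add: p_def[symmetric] m_diff_left Om_in)
qed simp

lemma simple_on_diff:
  assumes x: "\<And>t. t \<ge> 0 \<Longrightarrow> x t \<in> H t" and y: "\<And>t. t \<ge> 0 \<Longrightarrow> y t \<in> H t" and "s \<ge> 0" "pos_list P"
    and "simple_on x P s" "simple_on y P s"
  shows "simple_on (\<lambda>t. x t - y t) P s"
  using assms(3-)
proof (induction P arbitrary: s)
  case (Cons a P)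
  then have "simple_block (\<lambda>t. x t - y t) s a"
    unfolding simple_block_def by (auto simp: simple_block_def m_diff_left x y Om_in)
  then show ?case using Cons by simp
qed simp

text \<open>Translation from partition points to lists of lengths. The vectors
  \<open>\<xi> i\<close> are forced to be \<open>x (\<sigma> i)\<close>, so a representation amounts
  to a partition on which \<open>x\<close> is simple.\<close>

lemma simple_representation_list:
  assumes b: "b \<in> centred_addits S Om" and x: "\<And>t. t \<ge> 0 \<Longrightarrow> x t \<in> H t"
    and rep: "simple_representation S Om \<sigma> \<xi> x" and "k \<le> n"
  defines "P \<equiv> \<lambda>k. map (\<lambda>i. \<sigma> (Suc i) - \<sigma> i) [k..<n]"
  shows "pos_list (P k)" "sum_list (P k) = \<sigma> n - \<sigma> k" "simple_on x (P k) (\<sigma> k)"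
    "(\<Sum>i\<in>{k..<n}. m (\<sigma> (Suc i)) (\<sigma> n - \<sigma> (Suc i))
       (m (\<sigma> i) (\<sigma> (Suc i) - \<sigma> i) (\<xi> i) (b (\<sigma> (Suc i) - \<sigma> i))) (Om (\<sigma> n - \<sigma> (Suc i)))) =
     ito_sum x b (P k) (\<sigma> k)"
proof -
  have \<sigma>: "\<sigma> 0 = 0" "\<sigma> i < \<sigma> (Suc i)" for i
    using rep unfolding simple_representation_def strict_mono_Suc_iff by auto
  have \<sigma>0: "\<sigma> i \<ge> 0" for i
    by (induction i) (use \<sigma> in \<open>auto intro: order_trans less_imp_le\<close>)
  have \<xi>_in: "\<xi> i \<in> H (\<sigma> i)" and
    x_eq: "\<And>t. t \<in> {\<sigma> i..<\<sigma> (Suc i)} \<Longrightarrow> x t = m (\<sigma> i) (t - \<sigma> i) (\<xi> i) (Om (t - \<sigma> i))" for i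
    using rep unfolding simple_representation_def by auto
  have \<xi>: "\<xi> i = x (\<sigma> i)" for i
    using x_eq[of "\<sigma> i" i] \<sigma>(2)[of i] \<xi>_in[of i] by simp
  have blk: "simple_block x (\<sigma> i) (\<sigma> (Suc i) - \<sigma> i)" for i
    unfolding simple_block_def
  proof
    fix r assume "r \<in> {0..<\<sigma> (Suc i) - \<sigma> i}"
    then show "x (\<sigma> i + r) = m (\<sigma> i) r (x (\<sigma> i)) (Om r)"
      using x_eq[of "\<sigma> i + r" i] by (simp add: \<xi>)
  qed
  have "pos_list (P k) \<and> sum_list (P k) = \<sigma> n - \<sigma> k \<and> simple_on x (P k) (\<sigma> k) \<and>
    (\<Sum>i\<in>{k..<n}. m (\<sigma> (Suc i)) (\<sigma> n - \<sigma> (Suc i))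
       (m (\<sigma> i) (\<sigma> (Suc i) - \<sigma> i) (\<xi> i) (b (\<sigma> (Suc i) - \<sigma> i))) (Om (\<sigma> n - \<sigma> (Suc i)))) =
     ito_sum x b (P k) (\<sigma> k)"
    using \<open>k \<le> n\<close>
  proof (induction k rule: inc_induct)
    case base
    then show ?case by (simp add: P_def)
  next
    case (step k)
    have "P k = (\<sigma> (Suc k) - \<sigma> k) # P (Suc k)"
      using step.hyps by (simp add: P_def upt_conv_Cons)
    then show ?case
      using step blk[of k] \<sigma>(2)[of k]
      by (simp add: sum.atLeast_Suc_lessThan \<xi>)
  qed
  then show "pos_list (P k)" "sum_list (P k) = \<sigma> n - \<sigma> k" "simple_on x (P k) (\<sigma> k)"
    "(\<Sum>i\<in>{k..<n}. m (\<sigma> (Suc i)) (\<sigma> n - \<sigma> (Suc i))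
       (m (\<sigma> i) (\<sigma> (Suc i) - \<sigma> i) (\<xi> i) (b (\<sigma> (Suc i) - \<sigma> i))) (Om (\<sigma> n - \<sigma> (Suc i)))) =
     ito_sum x b (P k) (\<sigma> k)" by blast+
qed

lemma simple_process_in: "simple_process S Om x \<Longrightarrow> t \<ge> 0 \<Longrightarrow> x t \<in> H t"
  unfolding simple_process_def adapted_processes_def by auto

text \<open>The positive infimum of the gaps makes the partition points unbounded, so
  \<open>t\<close> lies in some block; that block is split at \<open>t\<close>.\<close>

lemma simple_representation_insert:
  assumes x: "\<And>t. t \<ge> 0 \<Longrightarrow> x t \<in> H t"
    and rep: "simple_representation S Om \<sigma> \<xi> x" and t: "t \<ge> 0"
  shows "\<exists>\<sigma> \<xi> n. simple_representation S Om \<sigma> \<xi> x \<and> \<sigma> n = t"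
proof -
  have \<sigma>: "\<sigma> 0 = 0" "\<sigma> i < \<sigma> (Suc i)" for i
    using rep unfolding simple_representation_def strict_mono_Suc_iff by auto
  have \<sigma>0: "\<sigma> i \<ge> 0" for i
    by (induction i) (use \<sigma> in \<open>auto intro: order_trans less_imp_le\<close>)
  have \<xi>_in: "\<xi> i \<in> H (\<sigma> i)" and
    x_eq: "\<And>t. t \<in> {\<sigma> i..<\<sigma> (Suc i)} \<Longrightarrow> x t = m (\<sigma> i) (t - \<sigma> i) (\<xi> i) (Om (t - \<sigma> i))" for i
    using rep unfolding simple_representation_def by auto
  define e where "e = (INF n. \<sigma> (Suc n) - \<sigma> n)"
  have e: "e > 0" using rep unfolding simple_representation_def e_def by blast
  have "bdd_below (range (\<lambda>n. \<sigma> (Suc n) - \<sigma> n))"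
    using \<sigma>(2) by (intro bdd_belowI2[of _ 0]) (simp add: less_imp_le)
  then have gap: "\<sigma> (Suc n) - \<sigma> n \<ge> e" for n
    unfolding e_def by (rule cINF_lower) simp
  have "\<sigma> n \<ge> real n * e" for n
  proof (induction n)
    case (Suc n)
    then show ?case using gap[of n] by (simp add: algebra_simps)
  qed (simp add: \<sigma>)
  moreover obtain n where "t < real n * e" using reals_Archimedean3[OF e] by blast
  ultimately have "t < \<sigma> n" using less_le_trans by blast
  then have ex: "\<exists>n. t < \<sigma> n" by blast
  define l where "l = (LEAST n. t < \<sigma> n)"
  have l: "t < \<sigma> l" "\<And>n. n < l \<Longrightarrow> \<not> t < \<sigma> n"
    using LeastI_ex[OF ex] not_less_Least by (auto simp: l_def)
  obtain k where k: "l = Suc k" using l(1) t \<sigma>(1) by (cases l) auto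
  have tk: "\<sigma> k \<le> t" "t < \<sigma> (Suc k)" using l(1) l(2)[of k] k by auto
  show ?thesis
  proof (cases "\<sigma> k = t")
    case True
    then show ?thesis using rep by blast
  next
    case False
    then have tk': "\<sigma> k < t" using tk by simp
    define \<sigma>' where "\<sigma>' i = (if i \<le> k then \<sigma> i else if i = Suc k then t else \<sigma> (i - 1))" for i
    \<comment> \<open>Only the two parts of the split block have new lengths, so this minimum bounds
      all gaps from below.\<close>
    define e' where "e' = Min {e, t - \<sigma> k, \<sigma> (Suc k) - t}"
    have e': "e' > 0" "e' \<le> e" "e' \<le> t - \<sigma> k" "e' \<le> \<sigma> (Suc k) - t"
      using e tk tk' by (auto simp: e'_def)
    have cases: "i < k \<or> i = k \<or> i = Suc k \<or> (\<exists>j. i = Suc j \<and> j > k)" for i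
      by (cases i) auto
    have gap': "\<sigma>' (Suc i) - \<sigma>' i \<ge> e'" for i
      using cases[of i] gap[of i] gap[of "i - 1"] e' by (auto simp: \<sigma>'_def)
    have \<sigma>'_nonneg: "\<sigma>' i \<ge> 0" for i using \<sigma>0 t by (simp add: \<sigma>'_def)
    have \<sigma>'_Suc: "\<sigma>' i < \<sigma>' (Suc i)" for i using gap'[of i] e'(1) by linarith
    have "simple_representation S Om \<sigma>' (\<lambda>i. x (\<sigma>' i)) x"
      unfolding simple_representation_def
    proof (intro conjI allI ballI)
      show "\<sigma>' 0 = 0" by (simp add: \<sigma>'_def \<sigma>)
      show "strict_mono \<sigma>'" using \<sigma>'_Suc by (simp add: strict_mono_Suc_iff)
      have "e' \<le> (INF n. \<sigma>' (Suc n) - \<sigma>' n)" by (rule cINF_greatest) (use gap' in auto)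
      then show "0 < (INF n. \<sigma>' (Suc n) - \<sigma>' n)" using e'(1) by linarith
      show "x (\<sigma>' i) \<in> H (\<sigma>' i)" for i using x \<sigma>'_nonneg by blast
      fix i r assume r: "r \<in> {\<sigma>' i..<\<sigma>' (Suc i)}"
      \<comment> \<open>Every new block lies inside an old one; by associativity the representation
        can be restarted at its left end.\<close>
      have "\<exists>j. \<sigma> j \<le> \<sigma>' i \<and> \<sigma>' (Suc i) \<le> \<sigma> (Suc j)"
        using cases[of i]
      proof (elim disjE exE conjE)
        assume "i < k" then show ?thesis by (intro exI[of _ i]) (simp add: \<sigma>'_def)
      next
        assume "i = k" then show ?thesis using tk by (intro exI[of _ k]) (simp add: \<sigma>'_def)
      next
        assume "i = Suc k" then show ?thesis using tk by (intro exI[of _ k]) (simp add: \<sigma>'_def)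
      next
        fix j assume "i = Suc j" "k < j" then show ?thesis by (intro exI[of _ j]) (simp add: \<sigma>'_def)
      qed
      then obtain j where j: "\<sigma> j \<le> \<sigma>' i" "\<sigma>' (Suc i) \<le> \<sigma> (Suc j)" by blast
      have 1: "x r = m (\<sigma> j) (r - \<sigma> j) (\<xi> j) (Om (r - \<sigma> j))"
        using j r by (intro x_eq) auto
      have 2: "x (\<sigma>' i) = m (\<sigma> j) (\<sigma>' i - \<sigma> j) (\<xi> j) (Om (\<sigma>' i - \<sigma> j))"
        using j r by (intro x_eq) auto
      have "m (\<sigma>' i) (r - \<sigma>' i) (m (\<sigma> j) (\<sigma>' i - \<sigma> j) (\<xi> j) (Om (\<sigma>' i - \<sigma> j))) (Om (r - \<sigma>' i)) =
          m (\<sigma> j) (r - \<sigma> j) (\<xi> j) (m (\<sigma>' i - \<sigma> j) (r - \<sigma>' i) (Om (\<sigma>' i - \<sigma> j)) (Om (r - \<sigma>' i)))"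
        using j r by (intro m_assoc_eq) (auto simp: \<sigma>0 Om_in \<xi>_in)
      then show "x r = m (\<sigma>' i) (r - \<sigma>' i) (x (\<sigma>' i)) (Om (r - \<sigma>' i))"
        unfolding 1 2 using j r by (simp add: m_Om)
    qed
    then show ?thesis by (intro exI[of _ \<sigma>'] exI[of _ "\<lambda>i. x (\<sigma>' i)"] exI[of _ "Suc k"]) (simp add: \<sigma>'_def)
  qed
qed

lemma simple_integral_eq:
  assumes b: "b \<in> centred_addits S Om" and x: "\<And>t. t \<ge> 0 \<Longrightarrow> x t \<in> H t"
    and rep: "simple_representation S Om \<sigma> \<xi> x"
  shows "simple_integral S Om x b 0 (\<sigma> n) = ito_sum x b (map (\<lambda>i. \<sigma> (Suc i) - \<sigma> i) [0..<n]) 0"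
proof -
  have \<sigma>0: "\<sigma> 0 = 0" using rep unfolding simple_representation_def by blast
  note L = simple_representation_list[OF b x rep le0, of n, unfolded \<sigma>0]
  show ?thesis
    unfolding simple_integral_def
  proof (rule the_equality)
    show "\<exists>\<sigma>' \<xi>' k l. simple_representation S Om \<sigma>' \<xi>' x \<and> k \<le> l \<and> \<sigma>' k = 0 \<and> \<sigma>' l = \<sigma> n \<and>
       ito_sum x b (map (\<lambda>i. \<sigma> (Suc i) - \<sigma> i) [0..<n]) 0 = (\<Sum>i\<in>{k..<l}.
            mult S Om (\<sigma>' (Suc i)) (\<sigma> n - \<sigma>' (Suc i))
              (mult S Om (\<sigma>' i) (\<sigma>' (Suc i) - \<sigma>' i) (\<xi>' i) (b (\<sigma>' (Suc i) - \<sigma>' i)))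
              (Om (\<sigma> n - \<sigma>' (Suc i))))"
      using rep \<sigma>0 L(4) by (intro exI[of _ \<sigma>] exI[of _ \<xi>] exI[of _ 0] exI[of _ n]) simp
  next
    fix y
    assume "\<exists>\<sigma>' \<xi>' k l. simple_representation S Om \<sigma>' \<xi>' x \<and> k \<le> l \<and> \<sigma>' k = 0 \<and> \<sigma>' l = \<sigma> n \<and>
       y = (\<Sum>i\<in>{k..<l}.
            mult S Om (\<sigma>' (Suc i)) (\<sigma> n - \<sigma>' (Suc i))
              (mult S Om (\<sigma>' i) (\<sigma>' (Suc i) - \<sigma>' i) (\<xi>' i) (b (\<sigma>' (Suc i) - \<sigma>' i)))
              (Om (\<sigma> n - \<sigma>' (Suc i))))"
    then obtain \<sigma>' \<xi>' k l where rep': "simple_representation S Om \<sigma>' \<xi>' x" and kl: "k \<le> l"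
      "\<sigma>' k = 0" "\<sigma>' l = \<sigma> n" and y: "y = (\<Sum>i\<in>{k..<l}.
            mult S Om (\<sigma>' (Suc i)) (\<sigma> n - \<sigma>' (Suc i))
              (mult S Om (\<sigma>' i) (\<sigma>' (Suc i) - \<sigma>' i) (\<xi>' i) (b (\<sigma>' (Suc i) - \<sigma>' i)))
              (Om (\<sigma> n - \<sigma>' (Suc i))))" by blast
    note L' = simple_representation_list[OF b x rep' kl(1), unfolded kl(2,3)]
    have y': "y = ito_sum x b (map (\<lambda>i. \<sigma>' (Suc i) - \<sigma>' i) [k..<l]) 0"
      using simple_representation_list(4)[OF b x rep' kl(1)] kl(2,3) y by simp
    have "sum_list (map (\<lambda>i. \<sigma> (Suc i) - \<sigma> i) [0..<n]) = \<sigma> n"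
      using L(2) by simp
    moreover have "sum_list (map (\<lambda>i. \<sigma>' (Suc i) - \<sigma>' i) [k..<l]) = \<sigma> n"
      using L'(2) by simp
    ultimately have eq: "sum_list (map (\<lambda>i. \<sigma>' (Suc i) - \<sigma>' i) [k..<l]) =
        sum_list (map (\<lambda>i. \<sigma> (Suc i) - \<sigma> i) [0..<n])" by (rule trans[OF _ sym, rotated])
    show "y = ito_sum x b (map (\<lambda>i. \<sigma> (Suc i) - \<sigma> i) [0..<n]) 0"
      unfolding y' by (rule ito_sum_partition_unique[OF b x L'(1) L(1) eq L'(3) L(3)])
  qed
qed

lemma simple_integral_partition:
  assumes b: "b \<in> centred_addits S Om" and x: "simple_process S Om x" and t: "t \<ge> 0"
  obtains P where "pos_list P" "sum_list P = t" "simple_on x P 0" "simple_integral S Om x b 0 t = ito_sum x b P 0"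
proof -
  note x_in = simple_process_in[OF x]
  obtain \<sigma> \<xi> n where rep: "simple_representation S Om \<sigma> \<xi> x" and n: "\<sigma> n = t"
    using simple_representation_insert[OF x_in _ t] x unfolding simple_process_def by blast
  have \<sigma>0: "\<sigma> 0 = 0" using rep unfolding simple_representation_def by blast
  note L = simple_representation_list[OF b x_in rep le0, of n, unfolded \<sigma>0 n]
  show thesis
    using that[OF L(1) _ L(3)] L(2) simple_integral_eq[OF b x_in rep, of n] n by simp
qed

text \<open>On a common refinement of their partitions both processes are simple, so the isometry
  for Ito sums applies to the difference.\<close>

lemma simple_integral_isometry:
  assumes b: "b \<in> centred_addits S Om" and x: "simple_process S Om x" and y: "simple_process S Om y"
    and t: "t \<ge> 0"
  shows "((\<lambda>r. (norm (b 1))\<^sup>2 * (norm (x r - y r))\<^sup>2) has_integral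
    (norm (simple_integral S Om x b 0 t - simple_integral S Om y b 0 t))\<^sup>2) {0..t}"
proof -
  note x_in = simple_process_in[OF x] and y_in = simple_process_in[OF y]
  obtain P where P: "pos_list P" "sum_list P = t" "simple_on x P 0" "simple_integral S Om x b 0 t = ito_sum x b P 0"
    by (rule simple_integral_partition[OF b x t])
  obtain P' where P': "pos_list P'" "sum_list P' = t" "simple_on y P' 0" "simple_integral S Om y b 0 t = ito_sum y b P' 0"
    by (rule simple_integral_partition[OF b y t])
  obtain QQ QQ' where Q: "P = map sum_list QQ" "P' = map sum_list QQ'" "concat QQ = concat QQ'"
    "\<forall>q\<in>set QQ. pos_list q" "\<forall>q\<in>set QQ'. pos_list q"
    using common_refinement[OF P(1) P'(1)] P(2) P'(2) by metis
  define R where "R = concat QQ"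
  have R: "pos_list R" "sum_list R = t"
    using Q(4) P(2) by (auto simp: R_def Q(1) sum_list_concat intro: pos_list_concat)
  have xR: "ito_sum x b P 0 = ito_sum x b R 0" "simple_on x R 0"
    using ito_sum_refine[OF b x_in, of 0 QQ] Q P(3) by (auto simp: R_def)
  have yR: "ito_sum y b P' 0 = ito_sum y b R 0" "simple_on y R 0"
    using ito_sum_refine[OF b y_in, of 0 QQ'] Q P'(3) by (auto simp: R_def)
  have d_in: "x t - y t \<in> H t" if "t \<ge> 0" for t using that x_in y_in by (simp add: H_diff)
  have "simple_on (\<lambda>t. x t - y t) R 0"
    using simple_on_diff[OF x_in y_in _ R(1) xR(2) yR(2)] by simp
  from ito_sum_isometry[OF b d_in _ R(1) this]
  show ?thesis
    using ito_sum_diff[OF b x_in y_in _ R(1), of 0] by (simp add: R(2) P(4) P'(4) xR(1) yR(1))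
qed

end

section \<open>The Ito integral equation\<close>

text \<open>Along the half-line the derivative of \<open>F\<close> is the complex derivative of a
  holomorphic extension, which is continuous.\<close>

lemma continuous_on_derivative_nonneg:
  assumes "analytic_on_nonneg F"
  shows "continuous_on {0..} (\<lambda>t. vector_derivative F (at t within {0..}))"
proof -
  obtain G where G: "G analytic_on (complex_of_real ` {0..})" and FG: "\<And>t. t \<ge> 0 \<Longrightarrow> F t = G (complex_of_real t)"
    using assms unfolding analytic_on_nonneg_def by blast
  have eq: "vector_derivative F (at t within {0..}) = deriv G (complex_of_real t)" if t: "t \<ge> 0" for t
  proof (rule vector_derivative_within)
    \<comment> \<open>The derivative within a set is determined only at limit points of the set; the
      end point 0 is included.\<close>
    have "t islimpt {t..t + 1}" by (simp add: islimpt_Icc)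
    then have "t islimpt {0..}" by (rule islimpt_subset) (use t in auto)
    then show "at t within {0..} \<noteq> bot" by (simp add: trivial_limit_within)
    have "(G has_field_derivative deriv G (of_real t)) (at (of_real t))"
      unfolding DERIV_deriv_iff_field_differentiable
      by (rule analytic_on_imp_differentiable_at[OF G imageI]) (simp add: t)
    then have "((\<lambda>x. G (complex_of_real x)) has_vector_derivative deriv G (of_real t)) (at t within {0..})"
      by (rule has_vector_derivative_at_within[OF has_vector_derivative_real_field])
    then show "(F has_vector_derivative deriv G (of_real t)) (at t within {0..})"
      by (rule has_vector_derivative_transform[rotated 2]) (use t FG in auto)
  qed
  have "continuous_on {0..} (\<lambda>t. deriv G (complex_of_real t))"
  proof -
    have "continuous_on (complex_of_real ` {0..}) (deriv G)"
      using analytic_deriv[OF G] analytic_imp_holomorphic holomorphic_on_imp_continuous_on by blast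
    then show ?thesis
      by (rule continuous_on_compose2) (auto intro!: continuous_intros)
  qed
  then show ?thesis by (rule continuous_on_eq) (simp add: eq)
qed

context spatial_system
begin

section \<open>Discretization of Ito integrands\<close>

definition grid :: "real \<Rightarrow> real \<Rightarrow> real" where
  "grid \<delta> s = \<delta> * of_int \<lfloor>s / \<delta>\<rfloor>"

definition discretize :: "(real \<Rightarrow> 'a) \<Rightarrow> real \<Rightarrow> real \<Rightarrow> 'a" where
  "discretize x \<delta> = (\<lambda>s\<in>{0..}. m (grid \<delta> s) (s - grid \<delta> s) (x (grid \<delta> s)) (Om (s - grid \<delta> s)))"

lemma grid_bounds:
  assumes "\<delta> > 0" "s \<ge> 0"
  shows "0 \<le> grid \<delta> s" "grid \<delta> s \<le> s" "s < grid \<delta> s + \<delta>"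
proof -
  show "0 \<le> grid \<delta> s" using assms by (simp add: grid_def)
  have "of_int \<lfloor>s / \<delta>\<rfloor> * \<delta> \<le> s"
    by (rule iffD1[OF pos_le_divide_eq[OF assms(1)] of_int_floor_le])
  moreover have "s < (of_int \<lfloor>s / \<delta>\<rfloor> + 1) * \<delta>"
    by (rule iffD1[OF pos_divide_less_eq[OF assms(1)] floor_less_cancel]) simp
  ultimately show "grid \<delta> s \<le> s" "s < grid \<delta> s + \<delta>" by (auto simp: grid_def algebra_simps)
qed

lemma grid_eq:
  assumes "\<delta> > 0" "s \<in> {real n * \<delta>..<real (Suc n) * \<delta>}"
  shows "grid \<delta> s = real n * \<delta>"
proof -
  have "\<lfloor>s / \<delta>\<rfloor> = int n"
    using assms by (intro floor_unique) (auto simp: pos_le_divide_eq pos_divide_less_eq algebra_simps)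
  then show ?thesis by (simp add: grid_def)
qed

lemma discretize_grid:
  assumes "\<delta> > 0" "x (real n * \<delta>) \<in> H (real n * \<delta>)"
  shows "discretize x \<delta> (real n * \<delta>) = x (real n * \<delta>)"
  using grid_eq[OF assms(1), of "real n * \<delta>" n] assms by (simp add: discretize_def)

lemma discretize_representation:
  assumes x: "\<And>t. t \<ge> 0 \<Longrightarrow> x t \<in> H t" and \<delta>: "\<delta> > 0"
  shows "simple_representation S Om (\<lambda>n. real n * \<delta>) (\<lambda>n. x (real n * \<delta>)) (discretize x \<delta>)"
  unfolding simple_representation_def
proof (intro conjI allI ballI)
  show "strict_mono (\<lambda>n. real n * \<delta>)" using \<delta> by (simp add: strict_mono_def)
  have "real (Suc n) * \<delta> - real n * \<delta> = \<delta>" for n by (simp add: algebra_simps)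
  then show "0 < (INF n. real (Suc n) * \<delta> - real n * \<delta>)" using \<delta> by (simp only: cINF_const UNIV_not_empty simp_thms)
  fix i s assume s: "s \<in> {real i * \<delta>..<real (Suc i) * \<delta>}"
  moreover have "s \<ge> 0" using s \<delta> by (auto intro: order_trans[rotated])
  ultimately show "discretize x \<delta> s = m (real i * \<delta>) (s - real i * \<delta>) (x (real i * \<delta>)) (Om (s - real i * \<delta>))"
    using grid_eq[OF \<delta> s] by (simp add: discretize_def)
qed (use x \<delta> in auto)

lemma discretize_simple:
  assumes x: "\<And>t. t \<ge> 0 \<Longrightarrow> x t \<in> H t" and \<delta>: "\<delta> > 0"
  shows "simple_process S Om (discretize x \<delta>)"
proof -
  have "discretize x \<delta> s \<in> H s" if "s \<ge> 0" for s
    using m_in[of "grid \<delta> s" "s - grid \<delta> s"] grid_bounds[OF \<delta> that] that x by (simp add: discretize_def Om_in)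
  then have "discretize x \<delta> \<in> adapted_processes S"
    unfolding adapted_processes_def by (auto simp: discretize_def)
  then show ?thesis using discretize_representation[OF assms] unfolding simple_process_def by blast
qed

lemma discretize_integral:
  assumes b: "b \<in> centred_addits S Om" and x: "\<And>t. t \<ge> 0 \<Longrightarrow> x t \<in> H t" and \<delta>: "\<delta> > 0"
  shows "simple_integral S Om (discretize x \<delta>) b 0 (real n * \<delta>) = ito_sum x b (replicate n \<delta>) 0"
proof -
  have "map (\<lambda>i. real (Suc i) * \<delta> - real i * \<delta>) [0..<n] = replicate n \<delta>"
    by (rule nth_equalityI) (auto simp: algebra_simps)
  then have "simple_integral S Om (discretize x \<delta>) b 0 (real n * \<delta>) = ito_sum (discretize x \<delta>) b (replicate n \<delta>) 0"
    using simple_integral_eq[OF b simple_process_in[OF discretize_simple[OF x \<delta>]] discretize_representation[OF x \<delta>], of n]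
    by simp
  \<comment> \<open>Ito sums read a process only at partition points, where the discretization
    agrees with \<open>x\<close>. The starting index \<open>k\<close> is left free for the
    induction.\<close>
  also have "ito_sum (discretize x \<delta>) b (replicate n \<delta>) (real k * \<delta>) = ito_sum x b (replicate n \<delta>) (real k * \<delta>)" for k
  proof (induction n arbitrary: k)
    case (Suc n)
    have "real k * \<delta> + \<delta> = real (Suc k) * \<delta>" by (simp add: algebra_simps)
    then show ?case using Suc.IH[of "Suc k"] discretize_grid[OF \<delta>, of x k] x \<delta> by simp
  qed simp
  from this[of 0] have "ito_sum (discretize x \<delta>) b (replicate n \<delta>) 0 = ito_sum x b (replicate n \<delta>) 0" by simp
  finally show ?thesis .
qed

lemma ito_integrand_in: "ito_integrand S Om x \<Longrightarrow> t \<ge> 0 \<Longrightarrow> x t \<in> H t"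
  unfolding ito_integrand_def adapted_processes_def by auto

text \<open>Expanding the square turns the integrand condition into one about norms;
  \<open>h\<close> is the real part of the derivative of \<open>F\<close>. Its value at 0 is
  determined by the case \<open>t = 0\<close> only if some \<open>x s\<close> is nonzero, whence the
  conditional form.\<close>

lemma ito_integrand_increment:
  assumes x: "ito_integrand S Om x"
  obtains h where "continuous_on {0..} h" "\<And>s. s \<ge> 0 \<Longrightarrow> x s \<noteq> 0 \<Longrightarrow> h 0 = 1"
    "\<And>s t. s \<ge> 0 \<Longrightarrow> t \<ge> 0 \<Longrightarrow> (norm (m s t (x s) (Om t) - x (s + t)))\<^sup>2 =
      (norm (x s))\<^sup>2 + (norm (x (s + t)))\<^sup>2 - 2 * (norm (x s))\<^sup>2 * h t"
proof -
  note x_in = ito_integrand_in[OF x]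
  obtain F where F: "analytic_on_nonneg F"
    "\<And>s t. s \<ge> 0 \<Longrightarrow> t \<ge> 0 \<Longrightarrow> cinner (x (s + t)) (m s t (x s) (Om t)) =
           of_real ((norm (x s))\<^sup>2) * vector_derivative F (at t within {0..})"
    using x unfolding ito_integrand_def by blast
  define h where "h t = Re (vector_derivative F (at t within {0..}))" for t
  have F': "Re (cinner (x (s + t)) (m s t (x s) (Om t))) = (norm (x s))\<^sup>2 * h t" if "s \<ge> 0" "t \<ge> 0" for s t
    using F(2)[OF that] by (simp add: h_def del: of_real_power)
  show thesis
  proof (rule that)
    show "continuous_on {0..} h"
      unfolding h_def by (intro continuous_intros continuous_on_derivative_nonneg F)
    fix s :: real assume s: "s \<ge> 0"
    then show "h 0 = 1" if "x s \<noteq> 0"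
      using F'[of s 0] that x_in[OF s] by (simp add: cinner_self)
    fix t :: real assume t: "t \<ge> 0"
    show "(norm (m s t (x s) (Om t) - x (s + t)))\<^sup>2 =
      (norm (x s))\<^sup>2 + (norm (x (s + t)))\<^sup>2 - 2 * (norm (x s))\<^sup>2 * h t"
      using norm_diff_power2[of "x (s + t)" "m s t (x s) (Om t)"] F'[OF s t] s t x_in[OF s]
      by (simp add: norm_minus_commute norm_m Om_in norm_Om)
  qed
qed

lemma discretize_increment:
  assumes h: "\<And>s t. s \<ge> 0 \<Longrightarrow> t \<ge> 0 \<Longrightarrow> (norm (m s t (x s) (Om t) - x (s + t)))\<^sup>2 =
      (norm (x s))\<^sup>2 + (norm (x (s + t)))\<^sup>2 - 2 * (norm (x s))\<^sup>2 * h t"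
    and "\<delta> > 0" "s \<ge> 0"
  shows "(norm (discretize x \<delta> s - x s))\<^sup>2 = (norm (x (grid \<delta> s)))\<^sup>2 + (norm (x s))\<^sup>2
      - 2 * (norm (x (grid \<delta> s)))\<^sup>2 * h (s - grid \<delta> s)"
  using h[of "grid \<delta> s" "s - grid \<delta> s"] grid_bounds[OF assms(2,3)] assms(3) by (simp add: discretize_def)

text \<open>With \<open>g\<close> the squared norm of \<open>x\<close> and \<open>r\<close> the grid
  point before \<open>s\<close>, the squared error is
  \<open>(g s - g r) + 2 * g r * (1 - h (s - r))\<close>. Uniform continuity of \<open>g\<close>
  controls the first term, continuity of \<open>h\<close> at 0 the second.\<close>

lemma discretize_approximates:
  assumes x: "ito_integrand S Om x" and "t \<ge> 0" "\<epsilon> > 0"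
  shows "\<exists>d>0. \<forall>\<delta>\<in>{0<..<d}. \<forall>s\<in>{0..t}. (norm (discretize x \<delta> s - x s))\<^sup>2 \<le> \<epsilon>"
proof (cases "\<forall>s\<ge>0. x s = 0")
  \<comment> \<open>If \<open>x\<close> vanishes identically, nothing is known about
    \<open>h 0\<close>, but the discretization vanishes too.\<close>
  case True
  have "discretize x \<delta> s = 0" if "\<delta> > 0" "s \<ge> 0" for \<delta> s
    using True grid_bounds[OF that] that by (simp add: discretize_def m_zero_left Om_in)
  then show ?thesis using True assms(3) by (intro exI[of _ 1]) auto
next
  case False
  obtain h where h: "continuous_on {0..} h" "\<And>s. s \<ge> 0 \<Longrightarrow> x s \<noteq> 0 \<Longrightarrow> h 0 = 1"
    "\<And>s t. s \<ge> 0 \<Longrightarrow> t \<ge> 0 \<Longrightarrow> (norm (m s t (x s) (Om t) - x (s + t)))\<^sup>2 =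
      (norm (x s))\<^sup>2 + (norm (x (s + t)))\<^sup>2 - 2 * (norm (x s))\<^sup>2 * h t"
    by (rule ito_integrand_increment[OF x]) (rule that)
  have h0: "h 0 = 1" using False h(2) by blast
  define g where "g s = (norm (x s))\<^sup>2" for s
  have g: "continuous_on {0..t} g"
    using x continuous_on_subset[of "{0..}" _ "{0..t}"] unfolding ito_integrand_def g_def by auto
  have "bounded (g ` {0..t})"
    by (intro compact_imp_bounded compact_continuous_image g compact_Icc)
  then obtain M where M: "M > 0" "\<And>s. s \<in> {0..t} \<Longrightarrow> norm (g s) \<le> M"
    unfolding bounded_pos by auto
  have "uniformly_continuous_on {0..t} g"
    by (intro compact_uniformly_continuous g compact_Icc)
  then obtain d1 where d1: "d1 > 0" "\<And>s s'. s \<in> {0..t} \<Longrightarrow> s' \<in> {0..t} \<Longrightarrow> dist s' s < d1 \<Longrightarrow> dist (g s') (g s) < \<epsilon> / 2"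
    unfolding uniformly_continuous_on_def using assms(3) by (meson half_gt_zero)
  \<comment> \<open>This tolerance for \<open>h\<close> leaves
    \<open>2 * M * (\<epsilon> / (4 * M))\<close>, half of \<open>\<epsilon>\<close>, for the second
    term.\<close>
  have "\<epsilon> / (4 * M) > 0" using assms(3) M by simp
  then obtain d2 where d2: "d2 > 0" "\<And>r. r \<ge> 0 \<Longrightarrow> r < d2 \<Longrightarrow> \<bar>h r - 1\<bar> < \<epsilon> / (4 * M)"
    using h(1)[unfolded continuous_on_iff, rule_format, of 0 "\<epsilon> / (4 * M)"] h0
    by (auto simp: dist_real_def)
  show ?thesis
  proof (intro exI[of _ "min d1 d2"] conjI ballI)
    show "min d1 d2 > 0" using d1 d2 by simp
    fix \<delta> s assume \<delta>: "\<delta> \<in> {0<..<min d1 d2}" and s: "s \<in> {0..t}"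
    define r where "r = grid \<delta> s"
    have r: "0 \<le> r" "r \<le> s" "s < r + \<delta>"
      using grid_bounds[of \<delta> s] \<delta> s by (auto simp: r_def)
    have eq: "(norm (discretize x \<delta> s - x s))\<^sup>2 = (g s - g r) + 2 * g r * (1 - h (s - r))"
      using discretize_increment[of x h \<delta> s, OF h(3)] \<delta> s by (simp add: g_def r_def algebra_simps)
    have "dist (g s) (g r) < \<epsilon> / 2"
      using r s \<delta> by (intro d1(2)) (auto simp: dist_real_def)
    then have 1: "g s - g r \<le> \<epsilon> / 2" unfolding dist_real_def by linarith
    have "1 - h (s - r) \<le> \<epsilon> / (4 * M)" using d2(2)[of "s - r"] r \<delta> by auto
    then have "g r * (1 - h (s - r)) \<le> g r * (\<epsilon> / (4 * M))"
      by (intro mult_left_mono) (auto simp: g_def)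
    also have "\<dots> \<le> M * (\<epsilon> / (4 * M))"
      using M(2)[of r] r s \<open>\<epsilon> / (4 * M) > 0\<close> by (intro mult_right_mono) auto
    also have "\<dots> = \<epsilon> / 4" using M(1) by simp
    finally show "(norm (discretize x \<delta> s - x s))\<^sup>2 \<le> \<epsilon>" using eq 1 by simp
  qed
qed

text \<open>On each grid cell the squared error agrees, off the right end point, with a continuous
  function; the cells are joined by induction.\<close>

lemma discretize_integrable:
  assumes x: "ito_integrand S Om x" and \<delta>: "\<delta> > 0"
  shows "(\<lambda>s. (norm (discretize x \<delta> s - x s))\<^sup>2) integrable_on {0..real n * \<delta>}"
proof (induction n)
  case 0
  then show ?case using has_integral_refl(2) unfolding integrable_on_def by auto
next
  case (Suc n)
  obtain h where h: "continuous_on {0..} h"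
    "\<And>s t. s \<ge> 0 \<Longrightarrow> t \<ge> 0 \<Longrightarrow> (norm (m s t (x s) (Om t) - x (s + t)))\<^sup>2 =
      (norm (x s))\<^sup>2 + (norm (x (s + t)))\<^sup>2 - 2 * (norm (x s))\<^sup>2 * h t"
    by (rule ito_integrand_increment[OF x]) (rule that)
  define r where "r = real n * \<delta>"
  have r: "r \<ge> 0" "real (Suc n) * \<delta> = r + \<delta>" using \<delta> by (auto simp: r_def algebra_simps)
  let ?f = "\<lambda>s. (norm (x r))\<^sup>2 + (norm (x s))\<^sup>2 - 2 * (norm (x r))\<^sup>2 * h (s - r)"
  have "continuous_on {r..r + \<delta>} (\<lambda>s. (norm (x s))\<^sup>2)"
    using x r continuous_on_subset[of "{0..}" _ "{r..r + \<delta>}"] unfolding ito_integrand_def by auto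
  moreover have "continuous_on {r..r + \<delta>} (\<lambda>s. h (s - r))"
    by (rule continuous_on_compose2[OF h(1)]) (auto intro!: continuous_intros)
  ultimately have "continuous_on {r..r + \<delta>} ?f"
    by (intro continuous_on_add continuous_on_diff continuous_on_mult_left continuous_on_const)
  then have "?f integrable_on {r..r + \<delta>}" by (rule integrable_continuous_real)
  then have "(\<lambda>s. (norm (discretize x \<delta> s - x s))\<^sup>2) integrable_on {r..r + \<delta>}"
  proof (rule integrable_spike[of _ _ "{r + \<delta>}"])
    fix s assume "s \<in> {r..r + \<delta>} - {r + \<delta>}"
    then have s: "s \<in> {r..<r + \<delta>}" by auto
    then have "grid \<delta> s = r"
      using grid_eq[OF \<delta>, of s n] unfolding r(2) r_def by blast
    then show "(norm (discretize x \<delta> s - x s))\<^sup>2 = ?f s"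
      using discretize_increment[of x h \<delta> s, OF h(2) \<delta>] s r by simp
  qed simp
  moreover have "(\<lambda>s. (norm (discretize x \<delta> s - x s))\<^sup>2) integrable_on {0..r}"
    using Suc.IH by (simp add: r_def)
  ultimately show ?case
    using Henstock_Kurzweil_Integration.integrable_combine[of 0 r "r + \<delta>"] r \<delta> by simp
qed

text \<open>The value 1 at \<open>t = 0\<close> keeps the mesh positive; with
  \<open>step_number\<close> equal to 0 there, the steps still add up to \<open>t\<close>.\<close>

definition step :: "real \<Rightarrow> nat \<Rightarrow> real" where
  "step t n = (if t = 0 then 1 else t / real (Suc n))"

definition step_number :: "real \<Rightarrow> nat \<Rightarrow> nat" where
  "step_number t n = (if t = 0 then 0 else Suc n)"

lemma step: "t \<ge> 0 \<Longrightarrow> step t n > 0" "real (step_number t n) * step t n = t"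
  by (auto simp: step_def step_number_def)

lemma step_tendsto: "t > 0 \<Longrightarrow> (\<lambda>n. step t n) \<longlonglongrightarrow> 0"
  using tendsto_mult[OF tendsto_const[of t] LIMSEQ_inverse_real_of_nat]
  by (simp add: step_def divide_inverse)

lemma discretize_L2:
  assumes x: "ito_integrand S Om x" and t: "t \<ge> 0"
  shows "L2_approximates (\<lambda>n. discretize x (step t n)) x 0 t"
  unfolding L2_approximates_def
proof (intro conjI allI)
  show int: "(\<lambda>s. (norm (discretize x (step t n) s - x s))\<^sup>2) integrable_on {0..t}" for n
    using discretize_integrable[OF x step(1)[OF t], of n "step_number t n"] unfolding step(2) .
  show "(\<lambda>n. integral {0..t} (\<lambda>s. (norm (discretize x (step t n) s - x s))\<^sup>2)) \<longlonglongrightarrow> 0"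
  proof (cases "t = 0")
    case True
    then show ?thesis by simp
  next
    case False
    show ?thesis
    proof (rule LIMSEQ_I)
      fix e :: real assume e: "e > 0"
      define \<epsilon> where "\<epsilon> = e / (2 * t)"
      have \<epsilon>: "\<epsilon> > 0" using e t False by (simp add: \<epsilon>_def)
      obtain d where d: "d > 0" "\<And>\<delta> s. \<delta> \<in> {0<..<d} \<Longrightarrow> s \<in> {0..t} \<Longrightarrow> (norm (discretize x \<delta> s - x s))\<^sup>2 \<le> \<epsilon>"
        using discretize_approximates[OF x t \<epsilon>] by blast
      obtain N where N: "\<And>n. n \<ge> N \<Longrightarrow> step t n < d"
        using LIMSEQ_D[OF step_tendsto d(1), of t] t False by (auto simp: abs_less_iff)
      have "norm (integral {0..t} (\<lambda>s. (norm (discretize x (step t n) s - x s))\<^sup>2) - 0) < e" if "n \<ge> N" for n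
      proof -
        have "integral {0..t} (\<lambda>s. (norm (discretize x (step t n) s - x s))\<^sup>2) \<le> integral {0..t} (\<lambda>s. \<epsilon>)"
          using d(2)[of "step t n"] step(1)[OF t, of n] N[OF that]
          by (intro integral_le int) auto
        also have "\<dots> = e / 2" using t False by (simp add: \<epsilon>_def)
        finally show ?thesis
          using integral_nonneg[OF int, of n] e by simp
      qed
      then show "\<exists>N. \<forall>n\<ge>N. norm (integral {0..t} (\<lambda>s. (norm (discretize x (step t n) s - x s))\<^sup>2) - 0) < e" by blast
    qed
  qed
qed

text \<open>The isometry, with the difference of \<open>X\<close> and \<open>Y\<close> estimated
  through \<open>x\<close>; the factor 2 comes from (p + q)^2 <= 2 (p^2 + q^2).\<close>

lemma simple_integral_distance:
  assumes b: "b \<in> centred_addits S Om" and X: "simple_process S Om X" and Y: "simple_process S Om Y"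
    and t: "t \<ge> 0" and int: "(\<lambda>s. (norm (X s - x s))\<^sup>2) integrable_on {0..t}"
      "(\<lambda>s. (norm (Y s - x s))\<^sup>2) integrable_on {0..t}"
  shows "(norm (simple_integral S Om X b 0 t - simple_integral S Om Y b 0 t))\<^sup>2 \<le>
    2 * (norm (b 1))\<^sup>2 * (integral {0..t} (\<lambda>s. (norm (X s - x s))\<^sup>2) + integral {0..t} (\<lambda>s. (norm (Y s - x s))\<^sup>2))"
proof (rule has_integral_le[OF simple_integral_isometry[OF b X Y t]])
  show "((\<lambda>s. 2 * (norm (b 1))\<^sup>2 * ((norm (X s - x s))\<^sup>2 + (norm (Y s - x s))\<^sup>2)) has_integral
    2 * (norm (b 1))\<^sup>2 * (integral {0..t} (\<lambda>s. (norm (X s - x s))\<^sup>2) + integral {0..t} (\<lambda>s. (norm (Y s - x s))\<^sup>2))) {0..t}"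
    by (intro has_integral_mult_right has_integral_add integrable_integral int)
  fix s
  have "(norm (X s - Y s))\<^sup>2 \<le> (norm (X s - x s) + norm (Y s - x s))\<^sup>2"
    using norm_triangle_ineq4[of "X s - x s" "Y s - x s"] by (intro power_mono) auto
  also have "\<dots> \<le> 2 * ((norm (X s - x s))\<^sup>2 + (norm (Y s - x s))\<^sup>2)"
    using sum_squares_bound[of "norm (X s - x s)" "norm (Y s - x s)"] by (simp add: power2_sum)
  finally show "(norm (b 1))\<^sup>2 * (norm (X s - Y s))\<^sup>2 \<le> 2 * (norm (b 1))\<^sup>2 * ((norm (X s - x s))\<^sup>2 + (norm (Y s - x s))\<^sup>2)"
    using mult_left_mono[of "(norm (X s - Y s))\<^sup>2" "2 * ((norm (X s - x s))\<^sup>2 + (norm (Y s - x s))\<^sup>2)" "(norm (b 1))\<^sup>2"]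
    by (simp add: algebra_simps)
qed

text \<open>The integrals of two approximating sequences have vanishing distance, so the description
  that defines \<open>ito_integral\<close> has a unique solution; the discretizations provide one
  such sequence.\<close>

lemma ito_integral_limit:
  assumes b: "b \<in> centred_addits S Om" and x: "ito_integrand S Om x" and t: "t \<ge> 0"
  shows "(\<lambda>n. simple_integral S Om (discretize x (step t n)) b 0 t) \<longlonglongrightarrow> ito_integral S Om x b 0 t"
proof -
  define D where "D = (\<lambda>n. discretize x (step t n))"
  define I where "I X = integral {0..t} (\<lambda>s. (norm (X s - x s))\<^sup>2)" for X
  define SI where "SI X = simple_integral S Om X b 0 t" for X
  have D_simple: "simple_process S Om (D n)" for n
    unfolding D_def by (rule discretize_simple[OF ito_integrand_in[OF x] step(1)[OF t]])
  have D_L2: "L2_approximates D x 0 t" unfolding D_def by (rule discretize_L2[OF x t])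
  have I_D: "(\<lambda>n. I (D n)) \<longlonglongrightarrow> 0" using D_L2 by (simp add: L2_approximates_def I_def)
  have dist: "(norm (SI (X n) - SI (Y k)))\<^sup>2 \<le> 2 * (norm (b 1))\<^sup>2 * (I (X n) + I (Y k))"
    if "\<And>n. simple_process S Om (X n)" "\<And>n. simple_process S Om (Y n)"
      "L2_approximates X x 0 t" "L2_approximates Y x 0 t" for X Y n k
    unfolding SI_def I_def using that unfolding L2_approximates_def
    by (intro simple_integral_distance b t) auto
  have I_nonneg: "I (D n) \<ge> 0" for n
    unfolding I_def using D_L2 by (intro integral_nonneg) (auto simp: L2_approximates_def)
  have "Cauchy (\<lambda>n. SI (D n))"
  proof (rule CauchyI)
    fix e :: real assume e: "e > 0"
    have "(\<lambda>n. 2 * (norm (b 1))\<^sup>2 * I (D n)) \<longlonglongrightarrow> 2 * (norm (b 1))\<^sup>2 * 0"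
      by (intro tendsto_mult tendsto_const I_D)
    then obtain N where N: "\<And>n. n \<ge> N \<Longrightarrow> norm (2 * (norm (b 1))\<^sup>2 * I (D n) - 0) < e\<^sup>2 / 2"
      using LIMSEQ_D[of _ 0 "e\<^sup>2 / 2"] e by (metis half_gt_zero mult_zero_right zero_less_power)
    have "norm (SI (D k) - SI (D l)) < e" if "k \<ge> N" "l \<ge> N" for k l
    proof -
      have "(norm (SI (D k) - SI (D l)))\<^sup>2 \<le> 2 * (norm (b 1))\<^sup>2 * I (D k) + 2 * (norm (b 1))\<^sup>2 * I (D l)"
        using dist[OF D_simple D_simple D_L2 D_L2, of k l] by (simp add: algebra_simps)
      also have "\<dots> < e\<^sup>2" using N[OF that(1)] N[OF that(2)] by simp
      finally show ?thesis using e by (simp add: power_less_imp_less_base)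
    qed
    then show "\<exists>N. \<forall>k\<ge>N. \<forall>l\<ge>N. norm (SI (D k) - SI (D l)) < e" by blast
  qed
  then obtain y where y: "(\<lambda>n. SI (D n)) \<longlonglongrightarrow> y"
    using Cauchy_convergent convergentD by blast
  have "ito_integral S Om x b 0 t = y"
    unfolding ito_integral_def
  proof (rule the_equality)
    show "\<exists>X. (\<forall>n. simple_process S Om (X n)) \<and> L2_approximates X x 0 t \<and>
     (\<lambda>n. simple_integral S Om (X n) b 0 t) \<longlonglongrightarrow> y"
      using D_simple D_L2 y unfolding SI_def by blast
    fix y' assume "\<exists>X. (\<forall>n. simple_process S Om (X n)) \<and> L2_approximates X x 0 t \<and>
     (\<lambda>n. simple_integral S Om (X n) b 0 t) \<longlonglongrightarrow> y'"
    then obtain X where X: "\<And>n. simple_process S Om (X n)" "L2_approximates X x 0 t"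
      "(\<lambda>n. SI (X n)) \<longlonglongrightarrow> y'" unfolding SI_def by blast
    have I_X: "(\<lambda>n. I (X n)) \<longlonglongrightarrow> 0" using X(2) by (simp add: L2_approximates_def I_def)
    have "(\<lambda>n. 2 * (norm (b 1))\<^sup>2 * (I (X n) + I (D n))) \<longlonglongrightarrow> 2 * (norm (b 1))\<^sup>2 * (0 + 0)"
      by (intro tendsto_intros I_D I_X)
    moreover have "(\<lambda>n. (norm (SI (X n) - SI (D n)))\<^sup>2) \<longlonglongrightarrow> (norm (y' - y))\<^sup>2"
      by (intro tendsto_intros X(3) y)
    ultimately have "(norm (y' - y))\<^sup>2 \<le> 2 * (norm (b 1))\<^sup>2 * (0 + 0)"
      using dist[OF X(1) D_simple X(2) D_L2] by (intro LIMSEQ_le) auto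
    then show "y' = y" by simp
  qed
  then show ?thesis using y by (simp add: SI_def D_def)
qed

text \<open>A contraction in a weighted supremum norm: \<open>c\<close> times the integral of
  \<open>exp (2 * c * r)\<close> over \<open>[0, t]\<close> is at most half of
  \<open>exp (2 * c * t)\<close>, so the integral equation halves every bound \<open>M\<close> on
  the weighted squared distance. Iteration forces it to be 0.\<close>

lemma ito_equation_unique:
  assumes b: "b \<in> centred_addits S Om"
    and u: "ito_integrand S Om u" "\<And>t. t \<ge> 0 \<Longrightarrow> u t = Om t + ito_integral S Om u b 0 t"
    and w: "ito_integrand S Om w" "\<And>t. t \<ge> 0 \<Longrightarrow> w t = Om t + ito_integral S Om w b 0 t"
    and T: "T \<ge> 0"
  shows "u T = w T"
proof -
  define c where "c = (norm (b 1))\<^sup>2"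
  define \<phi> where "\<phi> s = (norm (u s - w s))\<^sup>2" for s
  note u_in = ito_integrand_in[OF u(1)] and w_in = ito_integrand_in[OF w(1)]
  have c: "c \<ge> 0" by (simp add: c_def)
  have half: "\<phi> t \<le> M / 2 * exp (2 * c * t)"
    if M: "\<And>s. s \<in> {0..T} \<Longrightarrow> \<phi> s \<le> M * exp (2 * c * s)" and t: "t \<in> {0..T}" for M t
  proof -
    have t0: "t \<ge> 0" using t by simp
    have "M \<ge> 0" using order_trans[OF _ M[of 0]] T by (simp add: \<phi>_def)
    have int: "((\<lambda>r. c * (M * exp (2 * c * r))) has_integral (M / 2 * exp (2 * c * t) - M / 2 * exp (2 * c * 0))) {0..t}"
      using t0 by (intro fundamental_theorem_of_calculus)
        (auto intro!: derivative_eq_intros simp: has_real_derivative_iff_has_vector_derivative[symmetric])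
    \<comment> \<open>The bound is integrated rather than \<open>\<phi>\<close>: for the
      discretizations the squared distance at \<open>r\<close> is \<open>\<phi>\<close> at the
      preceding grid point, and the bound is nondecreasing.\<close>
    have "(norm (simple_integral S Om (discretize u (step t n)) b 0 t - simple_integral S Om (discretize w (step t n)) b 0 t))\<^sup>2
        \<le> M / 2 * exp (2 * c * t) - M / 2 * exp (2 * c * 0)" for n
    proof (rule has_integral_le[OF simple_integral_isometry[OF b _ _ t0] int])
      let ?d = "step t n"
      have d: "?d > 0" by (rule step(1)[OF t0])
      show "simple_process S Om (discretize u ?d)" "simple_process S Om (discretize w ?d)"
        using discretize_simple[OF u_in d] discretize_simple[OF w_in d] by simp_all
      fix r assume r: "r \<in> {0..t}"
      define g where "g = grid ?d r"
      have g: "0 \<le> g" "g \<le> r" using grid_bounds[OF d, of r] r by (auto simp: g_def)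
      have "discretize u ?d r - discretize w ?d r = m g (r - g) (u g - w g) (Om (r - g))"
        using g r by (simp add: discretize_def g_def m_diff_left u_in w_in Om_in)
      then have "(norm (discretize u ?d r - discretize w ?d r))\<^sup>2 = \<phi> g"
        using g r by (simp add: norm_m H_diff u_in w_in Om_in norm_Om \<phi>_def)
      also have "\<dots> \<le> M * exp (2 * c * g)" using g r t by (intro M) auto
      also have "\<dots> \<le> M * exp (2 * c * r)"
        using \<open>M \<ge> 0\<close> g c by (intro mult_left_mono) (auto intro: mult_left_mono)
      finally show "(norm (b 1))\<^sup>2 * (norm (discretize u ?d r - discretize w ?d r))\<^sup>2 \<le> c * (M * exp (2 * c * r))"
        using c unfolding c_def by (rule mult_left_mono)
    qed
    moreover have "(\<lambda>n. (norm (simple_integral S Om (discretize u (step t n)) b 0 t - simple_integral S Om (discretize w (step t n)) b 0 t))\<^sup>2)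
        \<longlonglongrightarrow> (norm (ito_integral S Om u b 0 t - ito_integral S Om w b 0 t))\<^sup>2"
      by (intro tendsto_intros ito_integral_limit b u(1) w(1) t0)
    ultimately have "(norm (ito_integral S Om u b 0 t - ito_integral S Om w b 0 t))\<^sup>2 \<le> M / 2 * exp (2 * c * t) - M / 2 * exp (2 * c * 0)"
      by (intro LIMSEQ_le_const2) auto
    moreover have "u t - w t = ito_integral S Om u b 0 t - ito_integral S Om w b 0 t"
      using u(2)[OF t0] w(2)[OF t0] by simp
    ultimately show ?thesis using \<open>M \<ge> 0\<close> by (simp add: \<phi>_def)
  qed
  have bnd: "\<exists>B. \<forall>s\<in>{0..T}. norm (x s) \<le> B" if "ito_integrand S Om x" for x
  proof -
    have "continuous_on {0..T} (\<lambda>s. (norm (x s))\<^sup>2)"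
      using that continuous_on_subset[of "{0..}" _ "{0..T}"] unfolding ito_integrand_def by auto
    then have "continuous_on {0..T} (\<lambda>s. sqrt ((norm (x s))\<^sup>2))" by (rule continuous_on_real_sqrt)
    then have "bounded ((\<lambda>s. norm (x s)) ` {0..T})"
      by (intro compact_imp_bounded compact_continuous_image compact_Icc) simp
    then show ?thesis unfolding bounded_iff by auto
  qed
  obtain B where B: "\<And>s. s \<in> {0..T} \<Longrightarrow> norm (u s) \<le> B" using bnd[OF u(1)] by blast
  obtain B' where B': "\<And>s. s \<in> {0..T} \<Longrightarrow> norm (w s) \<le> B'" using bnd[OF w(1)] by blast
  define M where "M = (B + B')\<^sup>2"
  have start: "\<phi> s \<le> M * exp (2 * c * s)" if s: "s \<in> {0..T}" for s
  proof -
    have "\<phi> s \<le> M" unfolding \<phi>_def M_def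
      using B[OF s] B'[OF s] norm_triangle_ineq4[of "u s" "w s"] by (intro power_mono) auto
    also have "\<dots> \<le> M * exp (2 * c * s)"
      using s c mult_left_mono[of 1 "exp (2 * c * s)" M] by (simp add: M_def)
    finally show ?thesis .
  qed
  have iter: "\<forall>s\<in>{0..T}. \<phi> s \<le> M * (1/2) ^ n * exp (2 * c * s)" for n
  proof (induction n)
    case (Suc n)
    show ?case
    proof
      fix s assume s: "s \<in> {0..T}"
      have "\<phi> s \<le> M * (1/2) ^ n / 2 * exp (2 * c * s)"
        by (rule half[OF _ s]) (use Suc.IH in blast)
      then show "\<phi> s \<le> M * (1/2) ^ Suc n * exp (2 * c * s)" by simp
    qed
  qed (use start in simp)
  have "(\<lambda>n. M * (1/2) ^ n * exp (2 * c * T)) \<longlonglongrightarrow> M * 0 * exp (2 * c * T)"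
    by (intro tendsto_intros LIMSEQ_power_zero) auto
  then have "\<phi> T \<le> M * 0 * exp (2 * c * T)"
    by (rule LIMSEQ_le_const) (use iter T in auto)
  then show ?thesis by (simp add: \<phi>_def)
qed

text \<open>Since \<open>u (s + t)\<close> factors and its second factor pairs with
  \<open>Om t\<close> to 1, the derivative of \<open>F\<close> has to be 1; the identity serves as
  \<open>F\<close>.\<close>

lemma exponential_unit_ito_integrand:
  assumes u: "u \<in> exponential_units S Om"
  shows "ito_integrand S Om u"
  unfolding ito_integrand_def
proof (intro conjI exI[of _ complex_of_real] allI impI)
  note u' = exponential_unitD[OF u]
  show "u \<in> adapted_processes S"
    using u'(1,5) unfolding adapted_processes_def by (simp add: PiE_def)
  obtain \<gamma> where \<gamma>: "\<gamma> \<ge> 0" "\<And>t. t \<ge> 0 \<Longrightarrow> (norm (u t))\<^sup>2 = exp (\<gamma> * t)"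
    by (rule norm_exponential_unit[OF u]) (rule that)
  have "continuous_on {0..} (\<lambda>t. exp (\<gamma> * t))" by (intro continuous_intros)
  then show "continuous_on {0..} (\<lambda>t. (norm (u t))\<^sup>2)"
    by (rule continuous_on_eq) (simp add: \<gamma>(2))
  show "analytic_on_nonneg complex_of_real"
    unfolding analytic_on_nonneg_def by (intro exI[of _ "\<lambda>z. z"]) (auto intro: analytic_intros)
  show "complex_of_real 0 = 0" by simp
  fix s t :: real assume st: "s \<ge> 0" "t \<ge> 0"
  have "vector_derivative complex_of_real (at t within {0..}) = 1"
  proof (rule vector_derivative_within)
    have "t islimpt {t..t + 1}" by (simp add: islimpt_Icc)
    then have "t islimpt {0..}" by (rule islimpt_subset) (use st in auto)
    then show "at t within {0..} \<noteq> bot" by (simp add: trivial_limit_within)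
    show "(complex_of_real has_vector_derivative 1) (at t within {0..})"
      by (auto intro!: derivative_eq_intros)
  qed
  then show "cinner (u (s + t)) (m s t (u s) (Om t)) =
      of_real ((norm (u s))\<^sup>2) * vector_derivative complex_of_real (at t within {0..})"
    unfolding u'(2)[OF st, symmetric] using st u'(1,3) by (simp add: cinner_m Om_in cinner_self)
qed

text \<open>The vector \<open>u s\<close> factors out of every summand because
  \<open>u (s + a)\<close> is the product of \<open>u s\<close> and \<open>u a\<close>. This allows
  recursion on the first step of a sum starting at 0.\<close>

lemma ito_sum_unit:
  assumes u: "u \<in> exponential_units S Om" and b: "b \<in> centred_addits S Om"
    and "s \<ge> 0" "pos_list P"
  shows "ito_sum u b P s = m s (sum_list P) (u s) (ito_sum u b P 0)"
  using assms(3,4)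
proof (induction P arbitrary: s)
  case Nil
  then show ?case using exponential_unitD(1)[OF u] by (simp add: m_zero_right)
next
  case (Cons a P)
  note u' = exponential_unitD[OF u] and b' = centred_additD[OF b]
  define p where "p = sum_list P"
  define J where "J = ito_sum u b P 0"
  have a: "a \<ge> 0" "p \<ge> 0" "s \<ge> 0" and P: "pos_list P"
    using Cons.prems by (auto simp: p_def pos_list_sum_nonneg)
  have in': "J \<in> H p" "u s \<in> H s" "u a \<in> H a" "b a \<in> H a"
    using ito_sum_in[OF b u'(1), of 0 P] P a u'(1) b'(1) by (auto simp: J_def p_def)
  have IH: "ito_sum u b P r = m r p (u r) J" if "r \<ge> 0" for r
    using Cons.IH[OF that P] by (simp add: p_def J_def)
  have "ito_sum u b (a # P) s = m (s + a) p (m s a (u s) (b a)) (Om p) + m (s + a) p (m s a (u s) (u a)) J"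
    using a IH[of "s + a"] by (simp add: p_def[symmetric] u'(2))
  also have "\<dots> = m s (a + p) (u s) (m a p (b a) (Om p)) + m s (a + p) (u s) (m a p (u a) J)"
    using a in' by (simp add: m_assoc Om_in)
  also have "\<dots> = m s (a + p) (u s) (ito_sum u b (a # P) 0)"
    using a in' IH[of a] by (simp add: p_def[symmetric] exponential_unit_0[OF u] m_add_right m_in Om_in)
  finally show ?case by (simp add: p_def)
qed

text \<open>Splitting off the first step leaves a local error followed by \<open>Om p\<close>, and
  the error of the other \<open>n\<close> steps preceded by \<open>u \<delta>\<close>. The latter
  error is orthogonal to \<open>Om p\<close>, so squares add, and the factors
  \<open>norm (u \<delta>)\<close> accumulate to the exponential.\<close>

lemma associated_ito_error:
  assumes u: "u \<in> exponential_units S Om" and b: "b \<in> centred_addits S Om"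
    and \<gamma>: "\<gamma> \<ge> 0" "\<And>t. t \<ge> 0 \<Longrightarrow> (norm (u t))\<^sup>2 = exp (\<gamma> * t)" and \<delta>: "\<delta> > 0"
  shows "(norm (u (real n * \<delta>) - Om (real n * \<delta>) - ito_sum u b (replicate n \<delta>) 0))\<^sup>2
    \<le> real n * (norm (u \<delta> - Om \<delta> - b \<delta>))\<^sup>2 * exp (\<gamma> * (real n * \<delta>))"
proof (induction n)
  case 0
  then show ?case by (simp add: exponential_unit_0[OF u])
next
  case (Suc n)
  note u' = exponential_unitD[OF u] and b' = centred_additD[OF b]
  define p where "p = real n * \<delta>"
  define J where "J = ito_sum u b (replicate n \<delta>) 0"
  define e where "e = (norm (u \<delta> - Om \<delta> - b \<delta>))\<^sup>2"
  have a: "p \<ge> 0" "\<delta> \<ge> 0" and P: "pos_list (replicate n \<delta>)" "sum_list (replicate n \<delta>) = p"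
    using \<delta> by (auto simp: p_def sum_list_replicate)
  have J: "J \<in> H p" "cinner (Om p) J = 0"
    using ito_sum_in[OF b u'(1), of 0 "replicate n \<delta>"] ito_sum_orthogonal[OF b u'(1), of 0 "replicate n \<delta>" "Om 0"] P
    by (auto simp: J_def Om_in)
  have in': "u p \<in> H p" "u \<delta> \<in> H \<delta>" "b \<delta> \<in> H \<delta>" "Om p \<in> H p" "Om \<delta> \<in> H \<delta>"
    using a u'(1) b'(1) by (auto simp: Om_in)
  have Suc_eq: "real (Suc n) * \<delta> = \<delta> + p" by (simp add: p_def algebra_simps)
  have "ito_sum u b (replicate (Suc n) \<delta>) 0 = m \<delta> p (b \<delta>) (Om p) + m \<delta> p (u \<delta>) J"
    using ito_sum_unit[OF u b a(2) P(1)] P(2) by (simp add: exponential_unit_0[OF u] J_def)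
  then have eq: "u (real (Suc n) * \<delta>) - Om (real (Suc n) * \<delta>) - ito_sum u b (replicate (Suc n) \<delta>) 0 =
      m \<delta> p (u \<delta> - Om \<delta> - b \<delta>) (Om p) + m \<delta> p (u \<delta>) (u p - Om p - J)"
    unfolding Suc_eq u'(2)[OF a(2,1), symmetric] m_Om[OF a(2,1), symmetric]
    using a in' J by (simp add: m_diff_left m_diff_right H_diff)
  have "cinner (Om p) (u p) = 1"
    using u'(3)[OF a(1)] cinner_commute[of "Om p" "u p"] by simp
  then have "cinner (m \<delta> p (u \<delta> - Om \<delta> - b \<delta>) (Om p)) (m \<delta> p (u \<delta>) (u p - Om p - J)) = 0"
    using a in' J by (simp add: cinner_m H_diff cinner_diff_right cinner_Om)
  from norm_add_orthogonal[OF this]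
  have "(norm (u (real (Suc n) * \<delta>) - Om (real (Suc n) * \<delta>) - ito_sum u b (replicate (Suc n) \<delta>) 0))\<^sup>2
      = e + exp (\<gamma> * \<delta>) * (norm (u p - Om p - J))\<^sup>2"
    unfolding eq using a in' J by (simp add: norm_m H_diff norm_Om power_mult_distrib e_def \<gamma>(2))
  also have "\<dots> \<le> e * exp (\<gamma> * (\<delta> + p)) + exp (\<gamma> * \<delta>) * (real n * e * exp (\<gamma> * p))"
  proof (rule add_mono)
    show "e \<le> e * exp (\<gamma> * (\<delta> + p))"
      using mult_left_mono[of 1 "exp (\<gamma> * (\<delta> + p))" e] \<gamma>(1) a by (simp add: e_def)
    show "exp (\<gamma> * \<delta>) * (norm (u p - Om p - J))\<^sup>2 \<le> exp (\<gamma> * \<delta>) * (real n * e * exp (\<gamma> * p))"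
      using Suc.IH by (intro mult_left_mono) (auto simp: p_def J_def e_def)
  qed
  also have "\<dots> = real (Suc n) * e * exp (\<gamma> * (\<delta> + p))"
    by (simp add: exp_add algebra_simps)
  finally show ?case unfolding Suc_eq e_def .
qed

lemma associated_solves:
  assumes u: "u \<in> exponential_units S Om" and b: "b \<in> centred_addits S Om" and ub: "associated u b"
    and t: "t \<ge> 0"
  shows "u t = Om t + ito_integral S Om u b 0 t"
proof -
  obtain \<gamma> where \<gamma>: "\<gamma> \<ge> 0" "\<And>t. t \<ge> 0 \<Longrightarrow> (norm (u t))\<^sup>2 = exp (\<gamma> * t)"
    by (rule norm_exponential_unit[OF u]) (rule that)
  obtain C where C: "\<And>t. t \<in> {0..1} \<Longrightarrow> (norm (u t - Om t - b t))\<^sup>2 \<le> C * t\<^sup>2"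
    using ub unfolding associated_def by blast
  note u_in = exponential_unitD(1)[OF u]
  define SI where "SI n = simple_integral S Om (discretize u (step t n)) b 0 t" for n
  have SI: "SI n = ito_sum u b (replicate (step_number t n) (step t n)) 0" for n
    unfolding SI_def
    using discretize_integral[OF b u_in step(1)[OF t, of n], of "step_number t n"] unfolding step(2) by simp
  have "SI \<longlonglongrightarrow> ito_integral S Om u b 0 t"
    unfolding SI_def by (intro ito_integral_limit b exponential_unit_ito_integrand u t)
  moreover have "SI \<longlonglongrightarrow> u t - Om t"
  proof (cases "t = 0")
    case True
    then have "SI = (\<lambda>n. 0)" by (simp add: SI step_number_def fun_eq_iff)
    then show ?thesis using True by (simp add: exponential_unit_0[OF u])
  next
    case False
    then have t': "t > 0" using t by simp
    have "(\<lambda>n. norm (SI n - (u t - Om t))) \<longlonglongrightarrow> 0"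
    proof (rule tendsto_sandwich[OF _ _ tendsto_const])
      show "\<forall>\<^sub>F n in sequentially. 0 \<le> norm (SI n - (u t - Om t))" by simp
      have "\<forall>\<^sub>F n in sequentially. step t n < 1"
        using order_tendstoD(2)[OF step_tendsto[OF t'], of 1] by simp
      then show "\<forall>\<^sub>F n in sequentially. norm (SI n - (u t - Om t)) \<le> sqrt (\<bar>C\<bar> * t * exp (\<gamma> * t) * step t n)"
      proof eventually_elim
        case (elim n)
        define k where "k = step_number t n"
        define \<delta> where "\<delta> = step t n"
        have \<delta>: "\<delta> > 0" "\<delta> < 1" "real k * \<delta> = t"
          using step(1)[OF t] step(2) elim by (auto simp: \<delta>_def k_def)
        have "(norm (u (real k * \<delta>) - Om (real k * \<delta>) - ito_sum u b (replicate k \<delta>) 0))\<^sup>2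
            \<le> real k * (norm (u \<delta> - Om \<delta> - b \<delta>))\<^sup>2 * exp (\<gamma> * (real k * \<delta>))"
          by (rule associated_ito_error[OF u b \<gamma> \<delta>(1)])
        then have "(norm (u t - Om t - SI n))\<^sup>2 \<le> real k * (norm (u \<delta> - Om \<delta> - b \<delta>))\<^sup>2 * exp (\<gamma> * t)"
          unfolding \<delta>(3) SI k_def[symmetric] \<delta>_def[symmetric] .
        \<comment> \<open>As \<open>real k * \<delta>\<close> is \<open>t\<close>, one factor
          \<open>\<delta>\<close> is left over and tends to 0. The absolute value is taken because
          the constant of \<open>associated\<close> carries no sign.\<close>
        also have "\<dots> \<le> real k * (\<bar>C\<bar> * \<delta>\<^sup>2) * exp (\<gamma> * t)"
        proof -
          have "C * \<delta>\<^sup>2 \<le> \<bar>C\<bar> * \<delta>\<^sup>2" by (intro mult_right_mono) auto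
          then show ?thesis
            using order_trans[OF C[of \<delta>]] \<delta> by (intro mult_right_mono mult_left_mono) auto
        qed
        also have "\<dots> = \<bar>C\<bar> * (real k * \<delta>) * exp (\<gamma> * t) * \<delta>" by (simp add: power2_eq_square)
        also have "\<dots> = \<bar>C\<bar> * t * exp (\<gamma> * t) * \<delta>" by (simp only: \<delta>(3))
        finally show ?case
          unfolding \<delta>_def by (intro real_le_rsqrt) (simp add: norm_minus_commute)
      qed
      have "(\<lambda>n. sqrt (\<bar>C\<bar> * t * exp (\<gamma> * t) * step t n)) \<longlonglongrightarrow> sqrt (\<bar>C\<bar> * t * exp (\<gamma> * t) * 0)"
        by (intro tendsto_real_sqrt tendsto_mult tendsto_const step_tendsto t')
      then show "(\<lambda>n. sqrt (\<bar>C\<bar> * t * exp (\<gamma> * t) * step t n)) \<longlonglongrightarrow> 0" by simp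
    qed
    then show ?thesis by (rule LIM_zero_cancel[OF tendsto_norm_zero_cancel])
  qed
  ultimately have "ito_integral S Om u b 0 t = u t - Om t" by (rule LIMSEQ_unique)
  then show ?thesis by simp
qed

text \<open>\<open>Exp_addit\<close> is a description over all Ito integrands, so uniqueness is
  required among these and not only among units; outside the half-line the two functions agree by
  extensionality.\<close>

lemma Exp_associated:
  assumes u: "u \<in> exponential_units S Om" and b: "b \<in> centred_addits S Om" and ub: "associated u b"
  shows "Exp_addit S Om b = u"
  unfolding Exp_addit_def
proof (rule the_equality)
  show "ito_integrand S Om u \<and> (\<forall>t\<ge>0. u t = Om t + ito_integral S Om u b 0 t)"
    using exponential_unit_ito_integrand[OF u] associated_solves[OF u b ub] by blast
  fix w assume w: "ito_integrand S Om w \<and> (\<forall>t\<ge>0. w t = Om t + ito_integral S Om w b 0 t)"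
  show "w = u"
  proof (rule extensionalityI[of _ "{0..}"])
    show "w \<in> extensional {0..}" using w unfolding ito_integrand_def adapted_processes_def by (simp add: PiE_def)
    show "u \<in> extensional {0..}" by (rule exponential_unitD(5)[OF u])
    show "w t = u t" if "t \<in> {0..}" for t
    proof (rule ito_equation_unique[OF b])
      show "ito_integrand S Om w" "ito_integrand S Om u"
        using w exponential_unit_ito_integrand[OF u] by blast+
      show "w t = Om t + ito_integral S Om w b 0 t" if "t \<ge> 0" for t using w that by blast
      show "u t = Om t + ito_integral S Om u b 0 t" if "t \<ge> 0" for t
        using associated_solves[OF u b ub that] .
      show "t \<ge> 0" using that by simp
    qed
  qed
qed

section \<open>Logarithmic sums\<close>

lemma m_sum_left:
  assumes "s \<ge> 0" "t \<ge> 0" "y \<in> H t" "finite A" "\<And>i. i \<in> A \<Longrightarrow> f i \<in> H s"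
  shows "(\<Sum>i\<in>A. f i) \<in> H s \<and> m s t (\<Sum>i\<in>A. f i) y = (\<Sum>i\<in>A. m s t (f i) y)"
  using assms(4,5)
  by (induction A rule: finite_induct) (auto simp: assms(1-3) H_zero H_add m_zero_left m_add_left)

lemma iterated_mult_in:
  assumes "\<delta> \<ge> 0" "\<And>j. y j \<in> H \<delta>"
  shows "iterated_mult S Om \<delta> y k \<in> H (real k * \<delta>)"
proof (induction k)
  case (Suc k)
  have "real (Suc k) * \<delta> = real k * \<delta> + \<delta>" by (simp add: algebra_simps)
  then show ?case using Suc assms m_in[of "real k * \<delta>" \<delta>] by simp
qed (simp add: Om_in)

lemma iterated_mult_Om:
  assumes "\<delta> \<ge> 0" "\<And>j. j \<in> {1..k} \<Longrightarrow> y j = Om \<delta>"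
  shows "iterated_mult S Om \<delta> y k = Om (real k * \<delta>)"
  using assms(2)
proof (induction k)
  case (Suc k)
  have "real (Suc k) * \<delta> = real k * \<delta> + \<delta>" by (simp add: algebra_simps)
  then show ?case using Suc assms(1) by (simp add: m_Om)
qed simp

text \<open>\<open>G (Suc k)\<close> is \<open>G k\<close> followed by \<open>Om \<delta>\<close>
  plus \<open>Om\<close> followed by \<open>\<beta>\<close>, which is the recursion of
  \<open>b\<close> at multiples of \<open>\<delta>\<close>. The errors are orthogonal because
  \<open>G k\<close> and \<open>b\<close> are orthogonal to \<open>Om\<close>, a fact carried along
  in the induction; with \<open>Om\<close> as neighbour no growth factor appears.\<close>

lemma log_sum_error:
  assumes b: "b \<in> centred_addits S Om" and \<delta>: "\<delta> \<ge> 0" and \<beta>: "\<beta> \<in> H \<delta>" "cinner \<beta> (Om \<delta>) = 0"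
  defines "G \<equiv> \<lambda>k. \<Sum>i\<in>{1..k}. iterated_mult S Om \<delta> (\<lambda>j. if j = i then \<beta> else Om \<delta>) k"
  shows "(norm (G k - b (real k * \<delta>)))\<^sup>2 \<le> real k * (norm (\<beta> - b \<delta>))\<^sup>2"
proof -
  note b' = centred_additD[OF b]
  have "G k \<in> H (real k * \<delta>) \<and> cinner (G k) (Om (real k * \<delta>)) = 0 \<and>
    (norm (G k - b (real k * \<delta>)))\<^sup>2 \<le> real k * (norm (\<beta> - b \<delta>))\<^sup>2"
  proof (induction k)
    case 0
    then show ?case by (simp add: G_def H_zero centred_addit_0[OF b])
  next
    case (Suc k)
    define p where "p = real k * \<delta>"
    have p: "p \<ge> 0" "real (Suc k) * \<delta> = p + \<delta>" using \<delta> by (auto simp: p_def algebra_simps)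
    have IH: "G k \<in> H p" "cinner (G k) (Om p) = 0" "(norm (G k - b p))\<^sup>2 \<le> real k * (norm (\<beta> - b \<delta>))\<^sup>2"
      using Suc.IH by (auto simp: p_def)
    have in': "Om p \<in> H p" "Om \<delta> \<in> H \<delta>" "b p \<in> H p" "b \<delta> \<in> H \<delta>"
      using p \<delta> b' by (auto simp: Om_in)
    let ?it = "\<lambda>i. iterated_mult S Om \<delta> (\<lambda>j. if j = i then \<beta> else Om \<delta>)"
    have "G (Suc k) = (\<Sum>i\<in>{1..k}. ?it i (Suc k)) + ?it (Suc k) (Suc k)" by (simp add: G_def)
    also have "(\<Sum>i\<in>{1..k}. ?it i (Suc k)) = (\<Sum>i\<in>{1..k}. m p \<delta> (?it i k) (Om \<delta>))"
      by (rule sum.cong) (auto simp: p_def)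
    also have "\<dots> = m p \<delta> (G k) (Om \<delta>)"
    proof -
      have "?it i k \<in> H p" for i
        unfolding p_def by (rule iterated_mult_in) (use \<delta> \<beta> in' in auto)
      then show ?thesis unfolding G_def
        using m_sum_left[of p \<delta> "Om \<delta>" "{1..k}" "\<lambda>i. ?it i k"] p \<delta> in' by simp
    qed
    \<comment> \<open>In this term the exceptional slot is the last one, so the first
      \<open>k\<close> factors are all \<open>Om \<delta>\<close>.\<close>
    also have "?it (Suc k) (Suc k) = m p \<delta> (Om p) \<beta>"
      using iterated_mult_Om[OF \<delta>, of k "\<lambda>j. if j = Suc k then \<beta> else Om \<delta>"] by (simp add: p_def)
    finally have G: "G (Suc k) = m p \<delta> (G k) (Om \<delta>) + m p \<delta> (Om p) \<beta>" .
    have "G (Suc k) \<in> H (p + \<delta>)" unfolding G using p \<delta> \<beta> in' IH by (simp add: H_add m_in)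
    moreover have "cinner (G (Suc k)) (Om (p + \<delta>)) = 0"
      unfolding G m_Om[OF p(1) \<delta>, symmetric] using p \<delta> \<beta> in' IH by (simp add: cinner_add_left cinner_m)
    moreover have "(norm (G (Suc k) - b (p + \<delta>)))\<^sup>2 \<le> real (Suc k) * (norm (\<beta> - b \<delta>))\<^sup>2"
    proof -
      have eq: "G (Suc k) - b (p + \<delta>) = m p \<delta> (G k - b p) (Om \<delta>) + m p \<delta> (Om p) (\<beta> - b \<delta>)"
        unfolding G b'(2)[OF p(1) \<delta>] using p \<delta> \<beta> in' IH by (simp add: m_diff_left m_diff_right)
      have "cinner (m p \<delta> (G k - b p) (Om \<delta>)) (m p \<delta> (Om p) (\<beta> - b \<delta>)) = 0"
        using p \<delta> \<beta> in' IH b'(4)[OF p(1)] by (simp add: cinner_m H_diff cinner_diff_left)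
      from norm_add_orthogonal[OF this]
      have "(norm (G (Suc k) - b (p + \<delta>)))\<^sup>2 = (norm (G k - b p))\<^sup>2 + (norm (\<beta> - b \<delta>))\<^sup>2"
        unfolding eq using p \<delta> \<beta> in' IH by (simp add: norm_m H_diff norm_Om)
      then show ?thesis using IH(3) by (simp add: algebra_simps)
    qed
    ultimately show ?case unfolding p(2) by blast
  qed
  then show ?thesis by blast
qed

lemma Log_associated:
  assumes u: "u \<in> exponential_units S Om" and b: "b \<in> centred_addits S Om" and ub: "associated u b"
  shows "Log_unit S Om u = b"
proof (rule extensionalityI[of _ "{0..}"])
  show "Log_unit S Om u \<in> extensional {0..}" by (simp add: Log_unit_def)
  show "b \<in> extensional {0..}" by (rule centred_additD(6)[OF b])
  obtain C where C: "\<And>t. t \<in> {0..1} \<Longrightarrow> (norm (u t - Om t - b t))\<^sup>2 \<le> C * t\<^sup>2"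
    using ub unfolding associated_def by blast
  fix t :: real assume "t \<in> {0..}"
  then have t: "t \<ge> 0" by simp
  define L where "L n = (\<Sum>i\<in>{1..2 ^ n}. log_term S Om u t n i)" for n
  have small: "(\<lambda>n. t / 2 ^ n) \<longlonglongrightarrow> 0"
    using tendsto_mult[OF tendsto_const[of t] LIMSEQ_power_zero[of "1/2::real"]]
    by (simp add: power_divide)
  have "(\<lambda>n. norm (L n - b t)) \<longlonglongrightarrow> 0"
  proof (rule tendsto_sandwich[OF _ _ tendsto_const])
    show "\<forall>\<^sub>F n in sequentially. 0 \<le> norm (L n - b t)" by simp
    have "\<forall>\<^sub>F n in sequentially. t / 2 ^ n < 1"
      using order_tendstoD(2)[OF small, of 1] by simp
    then show "\<forall>\<^sub>F n in sequentially. norm (L n - b t) \<le> sqrt (\<bar>C\<bar> * t * (t / 2 ^ n))"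
    proof eventually_elim
      case (elim n)
      define \<delta> where "\<delta> = t / 2 ^ n"
      have \<delta>: "\<delta> \<ge> 0" "\<delta> < 1" "real (2 ^ n) * \<delta> = t" using t elim by (auto simp: \<delta>_def)
      have "u \<delta> - Om \<delta> \<in> H \<delta>" "cinner (u \<delta> - Om \<delta>) (Om \<delta>) = 0"
        using exponential_unitD(1,3)[OF u \<delta>(1)] \<delta>(1) by (simp_all add: H_diff Om_in cinner_diff_left cinner_Om)
      from log_sum_error[OF b \<delta>(1) this, of "2 ^ n"]
      have "(norm (L n - b t))\<^sup>2 \<le> real (2 ^ n) * (norm (u \<delta> - Om \<delta> - b \<delta>))\<^sup>2"
        unfolding L_def log_term_def \<delta>_def[symmetric] \<delta>(3) .
      also have "\<dots> \<le> real (2 ^ n) * (\<bar>C\<bar> * \<delta>\<^sup>2)"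
      proof -
        have "C * \<delta>\<^sup>2 \<le> \<bar>C\<bar> * \<delta>\<^sup>2" by (intro mult_right_mono) auto
        then show ?thesis using order_trans[OF C[of \<delta>]] \<delta> by (intro mult_left_mono) auto
      qed
      also have "\<dots> = \<bar>C\<bar> * (real (2 ^ n) * \<delta>) * \<delta>" by (simp add: power2_eq_square)
      also have "\<dots> = \<bar>C\<bar> * t * \<delta>" by (simp only: \<delta>(3))
      finally show ?case unfolding \<delta>_def by (rule real_le_rsqrt)
    qed
    have "(\<lambda>n. sqrt (\<bar>C\<bar> * t * (t / 2 ^ n))) \<longlonglongrightarrow> sqrt (\<bar>C\<bar> * t * 0)"
      by (intro tendsto_real_sqrt tendsto_mult tendsto_const small)
    then show "(\<lambda>n. sqrt (\<bar>C\<bar> * t * (t / 2 ^ n))) \<longlonglongrightarrow> 0" by simp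
  qed
  then have "L \<longlonglongrightarrow> b t" by (rule LIM_zero_cancel[OF tendsto_norm_zero_cancel])
  then have "lim L = b t" by (rule limI)
  then show "Log_unit S Om u t = b t" using t by (simp add: Log_unit_def L_def[abs_def])
qed

end

theorem theorem5p10:
  fixes S :: "('a::complex_hilbert_space, 'b::complex_hilbert_space) sps"
    and Om :: "real \<Rightarrow> 'a"
  assumes "spatial_super_product_system S Om"
  shows "Exp_addit S Om \<in> centred_addits S Om \<rightarrow> exponential_units S Om \<and>
         Log_unit S Om \<in> exponential_units S Om \<rightarrow> centred_addits S Om \<and>
         (\<forall>b\<in>centred_addits S Om. Log_unit S Om (Exp_addit S Om b) = b) \<and>
         (\<forall>u\<in>exponential_units S Om. Exp_addit S Om (Log_unit S Om u) = u)"
proof -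
  interpret spatial_system S Om using assms by unfold_locales
  have "Exp_addit S Om b \<in> exponential_units S Om \<and> Log_unit S Om (Exp_addit S Om b) = b"
    if b: "b \<in> centred_addits S Om" for b
    using associated_unit_exists[OF b] Exp_associated[OF _ b] Log_associated[OF _ b] by metis
  moreover have "Log_unit S Om u \<in> centred_addits S Om \<and> Exp_addit S Om (Log_unit S Om u) = u"
    if u: "u \<in> exponential_units S Om" for u
    using associated_addit_exists[OF u] Exp_associated[OF u] Log_associated[OF u] by metis
  ultimately show ?thesis by blast
qed

end
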